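(* Let $\psi:\mathbb{R}^m\times\mathbb{R}^m\times M^{n\times n}_+\to[0,\infty)$ and, for images $P_1=(\Omega_1,c_1)$, $P_2=(\Omega_2,c_2)$, let $$I_{P_1,P_2}(y)=\int_{\Omega_1}\psi(c_1(x),c_2(y(x)),Dy(x))\,dx.$$ The following two conditions are equivalent: (A) for all images $P_1=(\Omega_1,c_1)$, $P_2=(\Omega_2,c_2)$ and all orientation-preserving invertible $y$ with $y(\Omega_1)=\Omega_2$, one has $I_{P_1,P_2}(y)=0$ if and only if $P_1\sim P_2$ with corresponding rigid transformation $y$; (B) for all $c_1,c_2\in\mathbb{R}^m$ and $A\in M^{n\times n}_+$, one has $\psi(c_1,c_2,A)=0$ if and only if $c_1=c_2$ and $A\in SO(n)$.
   Context: $M^{n\times n}_+$ denotes the set of real $n\times n$ matrices with positive determinant. An image is a pair $P=(\Omega,c)$ with $\Omega\subset\mathbb{R}^n$ a bounded Lipschitz domain and $c:\Omega\to\mathbb{R}^m$ a (measurable) intensity map. For images $P=(\Omega,c)$ and $P'=(\Omega',c')$, $P\sim P'$ with corresponding rigid transformation $E$ means that $E(x)=a+Rx$ for some $a\in\mathbb{R}^n$ and $R\in SO(n)$, with $\Omega'=E(\Omega)$ and $c'(E(x))=c(x)$ (for a.e. $x\in\Omega$). $Dy$ is the distributional gradient of $y$. An orientation-preserving invertible map $y$ with $y(\Omega_1)=\Omega_2$ means a homeomorphism $y:\Omega_1\to\Omega_2$ with $y\in W^{1,p}(\Omega_1,\mathbb{R}^n)$ and $y^{-1}\in W^{1,p}(\Omega_2,\mathbb{R}^n)$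 for some fixed exponent $p>n$, and $\det Dy(x)>0$ for a.e. $x\in\Omega_1$. The function $\psi$ is taken to be Borel measurable so that the integral (with values in $[0,\infty]$) is defined. *)

theory Defs
  imports "HOL-Analysis.Analysis"
begin

text \<open>Throughout, maps on a subset of Euclidean space are total functions; only their
  values on that subset matter.\<close>

definition partial_deriv :: "'n \<Rightarrow> (real^'n \<Rightarrow> real) \<Rightarrow> real^'n \<Rightarrow> real" where
  "partial_deriv j f x = frechet_derivative f (at x) (axis j 1)"

primrec k_times_cont_diff :: "nat \<Rightarrow> (real^'n \<Rightarrow> real) \<Rightarrow> bool" where
  "k_times_cont_diff 0 f \<longleftrightarrow> continuous_on UNIV f"
| "k_times_cont_diff (Suc k) f \<longleftrightarrow>
     (\<forall>x. f differentiable (at x)) \<and> (\<forall>j. k_times_cont_diff k (partial_deriv j f))"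

definition test_function :: "(real^'n) set \<Rightarrow> (real^'n \<Rightarrow> real) \<Rightarrow> bool" where
  "test_function \<Omega> \<phi> \<longleftrightarrow>
     (\<forall>k. k_times_cont_diff k \<phi>) \<and>
     compact (closure {x. \<phi> x \<noteq> 0}) \<and> closure {x. \<phi> x \<noteq> 0} \<subseteq> \<Omega>"

definition locally_integrable_on ::
    "(real^'n \<Rightarrow> 'b::euclidean_space) \<Rightarrow> (real^'n) set \<Rightarrow> bool"
    (infixr "locally'_integrable'_on" 46) where
  "f locally_integrable_on \<Omega> \<longleftrightarrow>
     (\<forall>K. compact K \<and> K \<subseteq> \<Omega> \<longrightarrow> f absolutely_integrable_on K)"

text \<open>Row \<open>i\<close> of the matrix \<open>G x\<close> is the gradient of the \<open>i\<close>-th component of \<open>y\<close>.\<close>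

definition has_weak_gradient ::
    "(real^'n) set \<Rightarrow> (real^'n \<Rightarrow> real^'k) \<Rightarrow> (real^'n \<Rightarrow> real^'n^'k) \<Rightarrow> bool" where
  "has_weak_gradient \<Omega> y G \<longleftrightarrow>
     y locally_integrable_on \<Omega> \<and> G locally_integrable_on \<Omega> \<and>
     (\<forall>\<phi> i j. test_function \<Omega> \<phi> \<longrightarrow>
        (LINT x|lebesgue_on \<Omega>. y x $ i * partial_deriv j \<phi> x) =
        - (LINT x|lebesgue_on \<Omega>. G x $ i $ j * \<phi> x))"

text \<open>On an open set a weak gradient is unique up to a null set, so choosing a
  representative is harmless in all uses below, which are insensitive to null sets.\<close>

definition weak_gradient ::
    "(real^'n) set \<Rightarrow> (real^'n \<Rightarrow> real^'k) \<Rightarrow> real^'n \<Rightarrow> real^'n^'k" where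
  "weak_gradient \<Omega> y = (SOME G. has_weak_gradient \<Omega> y G)"

definition in_Lp ::
    "real \<Rightarrow> (real^'n) set \<Rightarrow> (real^'n \<Rightarrow> 'b::euclidean_space) \<Rightarrow> bool" where
  "in_Lp p \<Omega> f \<longleftrightarrow>
     f \<in> borel_measurable (lebesgue_on \<Omega>) \<and>
     integrable (lebesgue_on \<Omega>) (\<lambda>x. norm (f x) powr p)"

definition in_W1p :: "real \<Rightarrow> (real^'n) set \<Rightarrow> (real^'n \<Rightarrow> real^'k) \<Rightarrow> bool" where
  "in_W1p p \<Omega> y \<longleftrightarrow>
     in_Lp p \<Omega> y \<and> (\<exists>G. has_weak_gradient \<Omega> y G \<and> in_Lp p \<Omega> G)"

text \<open>Near each boundary point, \<open>\<Omega>\<close> is the part strictly above a Lipschitz graph in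
  suitable rotated coordinates: \<open>e\<close> is the vertical direction, and
  \<open>x - (x \<bullet> e) *\<^sub>R e\<close> is the projection of \<open>x\<close> to the hyperplane orthogonal to \<open>e\<close>.\<close>

definition lipschitz_boundary :: "(real^'n) set \<Rightarrow> bool" where
  "lipschitz_boundary \<Omega> \<longleftrightarrow>
     (\<forall>x0\<in>frontier \<Omega>. \<exists>r>0. \<exists>e g L. norm e = 1 \<and>
        L-lipschitz_on {z. z \<bullet> e = 0} g \<and>
        \<Omega> \<inter> ball x0 r = {x \<in> ball x0 r. g (x - (x \<bullet> e) *\<^sub>R e) < x \<bullet> e})"

definition bounded_lipschitz_domain :: "(real^'n) set \<Rightarrow> bool" where
  "bounded_lipschitz_domain \<Omega> \<longleftrightarrow>
     open \<Omega> \<and> connected \<Omega> \<and> \<Omega> \<noteq> {} \<and> bounded \<Omega> \<and> lipschitz_boundary \<Omega>"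

type_synonym ('n, 'm) image_pair = "(real^'n) set \<times> (real^'n \<Rightarrow> real^'m)"

fun is_image :: "('n::finite, 'm::finite) image_pair \<Rightarrow> bool" where
  "is_image (\<Omega>, c) \<longleftrightarrow>
     bounded_lipschitz_domain \<Omega> \<and> c \<in> borel_measurable (lebesgue_on \<Omega>)"

definition rigid_transformation :: "(real^'n \<Rightarrow> real^'n) \<Rightarrow> bool" where
  "rigid_transformation E \<longleftrightarrow> (\<exists>a R. rotation_matrix R \<and> E = (\<lambda>x. a + R *v x))"

fun image_equiv_via ::
    "(real^'n \<Rightarrow> real^'n) \<Rightarrow> ('n::finite, 'm::finite) image_pair \<Rightarrow>
     ('n, 'm) image_pair \<Rightarrow> bool" where
  "image_equiv_via E (\<Omega>, c) (\<Omega>', c') \<longleftrightarrow>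
     rigid_transformation E \<and> \<Omega>' = E ` \<Omega> \<and> (AE x in lebesgue_on \<Omega>. c' (E x) = c x)"

definition orientation_preserving_invertible ::
    "real \<Rightarrow> (real^'n) set \<Rightarrow> (real^'n) set \<Rightarrow> (real^'n \<Rightarrow> real^'n) \<Rightarrow> bool" where
  "orientation_preserving_invertible p \<Omega>\<^sub>1 \<Omega>\<^sub>2 y \<longleftrightarrow>
     (\<exists>z. homeomorphism \<Omega>\<^sub>1 \<Omega>\<^sub>2 y z \<and> in_W1p p \<Omega>\<^sub>1 y \<and> in_W1p p \<Omega>\<^sub>2 z) \<and>
     (AE x in lebesgue_on \<Omega>\<^sub>1. 0 < det (weak_gradient \<Omega>\<^sub>1 y x))"

fun image_functional ::
    "(real^'m \<Rightarrow> real^'m \<Rightarrow> real^'n^'n \<Rightarrow> real) \<Rightarrow> ('n::finite, 'm::finite) image_pair \<Rightarrow>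
     ('n, 'm) image_pair \<Rightarrow> (real^'n \<Rightarrow> real^'n) \<Rightarrow> ennreal" where
  "image_functional \<psi> (\<Omega>\<^sub>1, c\<^sub>1) (\<Omega>\<^sub>2, c\<^sub>2) y =
     (\<integral>\<^sup>+ x. ennreal (\<psi> (c\<^sub>1 x) (c\<^sub>2 (y x)) (weak_gradient \<Omega>\<^sub>1 y x)) \<partial>lebesgue_on \<Omega>\<^sub>1)"

end

theory Submission
  imports Defs
begin

text \<open>
  Condition (A) implies (B) by testing with \<open>y = A\<close> on the unit ball and constant intensities.

  For the converse, a \<open>W\<^sup>1\<^sup>,\<^sup>p\<close> homeomorphism with \<open>p > n\<close> is differentiable almost everywhere, and
  since \<open>det Dy > 0\<close> its inverse is pointwise Lipschitz at almost every image point. Hence preimages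
  of null sets are null, the integrand is measurable, and a vanishing functional forces
  \<open>c\<^sub>1 = c\<^sub>2 \<circ> y\<close> and \<open>Dy \<in> SO(n)\<close> almost everywhere. Then \<open>y\<close> is locally 1-Lipschitz (mollify), and
  it does not decrease volume (Vitali covering of the image). If \<open>|y a - y b| < |a - b|\<close>, the images of
  the touching balls of radius \<open>|a - b| / 2\<close> about \<open>a\<close> and \<open>b\<close> would be disjoint subsets of two
  overlapping balls of the same radius, which leaves too little volume. So \<open>y\<close> is a local isometry,
  hence affine on the connected domain.
\<close>

subsection \<open>Smooth bump functions\<close>

text \<open>That Dy is orthogonal almost everywhere does not by itself give rigidity: the fold
  sending x_1 to |x_1| has this property and is 1-Lipschitz. Injectivity excludes folds, and it
  enters through volume, since images of disjoint balls stay disjoint. The volume inequality is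
  proved from the image side: no uniform Lipschitz bound for the inverse is at hand, but at y(x),
  for almost every x, the inverse has pointwise Lipschitz constants arbitrarily close to 1. That the
  resulting affine map is a rotation and not a reflection is read off from the gradient at a single
  point. A second obstacle is measurability: the intensity of the target image is only Lebesgue
  measurable, and a homeomorphism may pull a null set back to a set of positive measure. The
  condition det Dy > 0 prevents this. All Sobolev estimates come from one identity, the derivative
  of a mollified function as the centre and the radius of the mollifier move linearly. A fixed
  radius yields the Lipschitz bound; a radius growing from 0 yields Morrey's estimate.\<close>

definition flat :: "nat \<Rightarrow> real \<Rightarrow> real" where
  "flat m t = (if t > 0 then exp (- inverse t) * inverse t ^ m else 0)"

lemma flat_nonneg: "0 \<le> flat m t"
  by (simp add: flat_def)

lemma flat_0_le_1: "flat 0 t \<le> 1"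
  by (simp add: flat_def)

lemma flat_pos: "t > 0 \<Longrightarrow> 0 < flat m t"
  by (simp add: flat_def)

lemma flat_zero: "t \<le> 0 \<Longrightarrow> flat m t = 0"
  by (simp add: flat_def)

lemma flat_tendsto_0: "(flat m \<longlongrightarrow> 0) (at_right 0)"
proof -
  have "((\<lambda>t. inverse t ^ m / exp (inverse t)) \<longlongrightarrow> 0) (at_right (0::real))"
    by (rule filterlim_compose[OF tendsto_power_div_exp_0 filterlim_inverse_at_top_right])
  then show ?thesis
  proof (rule Lim_transform_eventually)
    show "\<forall>\<^sub>F t in at_right 0. inverse t ^ m / exp (inverse t) = flat m t"
      by (auto simp: eventually_at_filter flat_def exp_minus divide_simps)
  qed
qed

text \<open>Differentiation raises the power of \<open>inverse t\<close>, so the whole family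
  indexed by \<open>m\<close> is carried along and is closed under derivatives up to linear
  combinations; \<open>flat 0\<close> is the usual exp(-1/t). At \<open>t = 0\<close> the right
  difference quotient of \<open>flat m\<close> is \<open>flat (Suc m)\<close>, which tends to
  0.\<close>

lemma flat_has_derivative:
  "(flat m has_real_derivative (flat (m + 2) t - of_nat m * flat (m + 1) t)) (at t)"
proof -
  consider "t > 0" | "t < 0" | "t = 0" by linarith
  then show ?thesis
  proof cases
    case 1
    have "((\<lambda>t. inverse t ^ m) has_real_derivative - of_nat m * inverse t ^ (m + 1)) (at t)"
      using DERIV_power[OF DERIV_inverse[of t], of m] 1 by (cases m) (simp_all add: algebra_simps)
    from DERIV_mult[OF DERIV_fun_exp[OF DERIV_minus[OF DERIV_inverse]] this]
    have "((\<lambda>t. exp (- inverse t) * inverse t ^ m) has_real_derivative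
        (flat (m + 2) t - of_nat m * flat (m + 1) t)) (at t)"
      using 1 by (simp add: flat_def power2_eq_square algebra_simps)
    then show ?thesis
      by (rule has_field_derivative_transform_within_open[where S = "{0<..}"])
        (use 1 in \<open>simp_all add: flat_def\<close>)
  next
    case 2
    have "((\<lambda>t. 0) has_real_derivative (flat (m + 2) t - of_nat m * flat (m + 1) t)) (at t)"
      using 2 by (simp add: flat_def)
    then show ?thesis
      by (rule has_field_derivative_transform_within_open[where S = "{..<0}"])
        (use 2 in \<open>simp_all add: flat_def\<close>)
  next
    case 3
    have "((\<lambda>h. (flat m (0 + h) - flat m 0) / h) \<longlongrightarrow> 0) (at 0)"
    proof (rule filterlim_split_at)
      show "((\<lambda>h. (flat m (0 + h) - flat m 0) / h) \<longlongrightarrow> 0) (at_left 0)"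
        by (rule tendsto_eventually) (auto simp: eventually_at_filter flat_def)
      show "((\<lambda>h. (flat m (0 + h) - flat m 0) / h) \<longlongrightarrow> 0) (at_right 0)"
        by (rule Lim_transform_eventually[OF flat_tendsto_0[of "Suc m"]])
          (auto simp: eventually_at_filter flat_def divide_simps)
    qed
    then show ?thesis
      using 3 by (simp add: DERIV_def flat_def)
  qed
qed

lemma partial_deriv_eqI:
  "(f has_derivative D) (at x) \<Longrightarrow> partial_deriv j f x = D (axis j 1)"
  unfolding partial_deriv_def by (metis frechet_derivative_at)

text \<open>A syntactic class closed under partial derivatives. Membership is checked by structure,
  and smoothness of every order then follows by one induction on the order, without writing out
  iterated derivatives.\<close>

inductive smooth_expr :: "(real^'n \<Rightarrow> real) \<Rightarrow> bool" where
  const: "smooth_expr (\<lambda>x. c)"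
| coord: "smooth_expr (\<lambda>x. x $ i)"
| add: "smooth_expr f \<Longrightarrow> smooth_expr g \<Longrightarrow> smooth_expr (\<lambda>x. f x + g x)"
| mult: "smooth_expr f \<Longrightarrow> smooth_expr g \<Longrightarrow> smooth_expr (\<lambda>x. f x * g x)"
| flat: "smooth_expr f \<Longrightarrow> smooth_expr (\<lambda>x. flat m (f x))"

lemma smooth_expr_sum:
  "(\<And>i. i \<in> I \<Longrightarrow> smooth_expr (f i)) \<Longrightarrow> smooth_expr (\<lambda>x. \<Sum>i\<in>I. f i x)"
  by (induction I rule: infinite_finite_induct) (auto intro: smooth_expr.intros)

lemma smooth_expr_diff:
  assumes "smooth_expr f" "smooth_expr g"
  shows "smooth_expr (\<lambda>x. f x - g x)"
  using smooth_expr.add[OF assms(1) smooth_expr.mult[OF smooth_expr.const[of "-1"] assms(2)]]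
  by simp

lemma smooth_expr_has_derivative:
  fixes f :: "real^'n \<Rightarrow> real"
  shows "smooth_expr f \<Longrightarrow>
     \<exists>D. (\<forall>x. (f has_derivative D x) (at x)) \<and> (\<forall>j. smooth_expr (\<lambda>x. D x (axis j 1)))"
proof (induction rule: smooth_expr.induct)
  case (const c)
  then show ?case
    by (intro exI[of _ "\<lambda>x h. 0"]) (auto intro: smooth_expr.intros)
next
  case (coord i)
  have "((\<lambda>x. x $ i) has_derivative (\<lambda>h. h $ i)) (at x)" for x :: "real^'n"
    by (rule bounded_linear_imp_has_derivative[OF bounded_linear_vec_nth])
  then show ?case
    by (intro exI[of _ "\<lambda>x h. h $ i"]) (auto intro: smooth_expr.intros)
next
  case (add f g)
  then obtain D E where "\<And>x. (f has_derivative D x) (at x)" "\<And>j. smooth_expr (\<lambda>x. D x (axis j 1))"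
    "\<And>x. (g has_derivative E x) (at x)" "\<And>j. smooth_expr (\<lambda>x. E x (axis j 1))"
    by blast
  then show ?case
    by (intro exI[of _ "\<lambda>x h. D x h + E x h"] conjI allI has_derivative_add smooth_expr.add) auto
next
  case (mult f g)
  then obtain D E where "\<And>x. (f has_derivative D x) (at x)" "\<And>j. smooth_expr (\<lambda>x. D x (axis j 1))"
    "\<And>x. (g has_derivative E x) (at x)" "\<And>j. smooth_expr (\<lambda>x. E x (axis j 1))"
    by blast
  with mult.hyps show ?case
    by (intro exI[of _ "\<lambda>x h. f x * E x h + D x h * g x"] conjI allI has_derivative_mult
        smooth_expr.add smooth_expr.mult) auto
next
  case (flat f m)
  then obtain D where D: "\<And>x. (f has_derivative D x) (at x)" "\<And>j. smooth_expr (\<lambda>x. D x (axis j 1))"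
    by blast
  let ?E = "\<lambda>x h. D x h * (flat (m + 2) (f x) - of_nat m * flat (m + 1) (f x))"
  have "((\<lambda>x. flat m (f x)) has_derivative ?E x) (at x)" for x
    using DERIV_compose_FDERIV[OF flat_has_derivative D(1)] by simp
  moreover have "smooth_expr (\<lambda>x. ?E x (axis j 1))" for j
    by (intro smooth_expr.mult D(2) smooth_expr_diff smooth_expr.const smooth_expr.flat flat.hyps)
  ultimately show ?case
    by (intro exI[of _ ?E]) auto
qed

lemma smooth_expr_k_times_cont_diff: "smooth_expr f \<Longrightarrow> k_times_cont_diff k f"
proof (induction k arbitrary: f)
  case 0
  then show ?case
    using smooth_expr_has_derivative[OF 0]
    by (auto intro!: continuous_at_imp_continuous_on dest: has_derivative_continuous)
next
  case (Suc k)
  obtain D where D: "\<And>x. (f has_derivative D x) (at x)" "\<And>j. smooth_expr (\<lambda>x. D x (axis j 1))"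
    using smooth_expr_has_derivative[OF Suc.prems] by blast
  have "partial_deriv j f = (\<lambda>x. D x (axis j 1))" for j
    using partial_deriv_eqI[OF D(1)] by auto
  with D Suc.IH show ?case
    by (auto simp: differentiable_def)
qed

lemma test_functionI:
  assumes "smooth_expr \<phi>" "compact C" "C \<subseteq> U" "\<And>x. x \<notin> C \<Longrightarrow> \<phi> x = 0"
  shows "test_function U \<phi>"
proof -
  have "{x. \<phi> x \<noteq> 0} \<subseteq> C" using assms(4) by auto
  then have "closure {x. \<phi> x \<noteq> 0} \<subseteq> C"
    using \<open>compact C\<close> by (simp add: closure_minimal compact_imp_closed)
  with assms show ?thesis
    unfolding test_function_def
    using smooth_expr_k_times_cont_diff
    by (meson bounded_subset closed_closure compact_eq_bounded_closed order_trans)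
qed

lemma test_functionD:
  assumes "test_function U \<phi>"
  obtains C where "compact C" "C \<subseteq> U" "\<And>x. x \<notin> C \<Longrightarrow> \<phi> x = 0"
    "\<And>x j. x \<notin> C \<Longrightarrow> partial_deriv j \<phi> x = 0"
    "\<And>x. \<phi> differentiable (at x)" "continuous_on UNIV \<phi>"
    "\<And>j. continuous_on UNIV (partial_deriv j \<phi>)"
proof
  let ?C = "closure {x. \<phi> x \<noteq> 0}"
  show "compact ?C" "?C \<subseteq> U" using assms by (auto simp: test_function_def)
  show 0: "\<phi> x = 0" if "x \<notin> ?C" for x
    using contra_subsetD[OF closure_subset that] by simp
  have k: "k_times_cont_diff k \<phi>" for k using assms by (auto simp: test_function_def)
  show "\<phi> differentiable (at x)" for x
    using k[of "Suc 0"] by simp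
  show "continuous_on UNIV \<phi>" using k[of 0] by simp
  show "continuous_on UNIV (partial_deriv j \<phi>)" for j using k[of "Suc 0"] by simp
  show "partial_deriv j \<phi> x = 0" if "x \<notin> ?C" for x j
  proof -
    have "(\<phi> has_derivative (\<lambda>h. 0)) (at x)"
    proof (rule has_derivative_transform_within_open)
      show "((\<lambda>_. 0) has_derivative (\<lambda>h. 0)) (at x)" by simp
      show "open (- ?C)" "x \<in> - ?C" using that open_Compl[OF closed_closure] by simp_all
      show "0 = \<phi> y" if "y \<in> - ?C" for y using 0[of y] that by (metis ComplD)
    qed
    then show ?thesis
      using partial_deriv_eqI[of \<phi> "\<lambda>h. 0"] by simp
  qed
qed

subsection \<open>Lebesgue points\<close>

text \<open>The measure with density \<open>F\<close> gives no mass to the zero set of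
  \<open>F\<close>, so that set has an open superset of small mass. Vitali's theorem extracts
  disjoint balls inside this superset that almost cover the bad points; each ball has volume at most
  a constant times its mass, hence the total volume is small.\<close>

lemma negligible_density_points:
  fixes F :: "'a::euclidean_space \<Rightarrow> ennreal"
  assumes F[measurable]: "F \<in> borel_measurable lebesgue" and fin: "(\<integral>\<^sup>+u. F u \<partial>lebesgue) < \<infinity>"
    and "c > 0"
  shows "negligible {a. F a = 0 \<and>
    (\<forall>d>0. \<exists>r. 0 < r \<and> r < d \<and> ennreal (c * r ^ DIM('a)) < (\<integral>\<^sup>+u\<in>ball a r. F u \<partial>lebesgue))}"
    (is "negligible ?B")
proof -
  define \<nu> where "\<nu> = density lebesgue F"
  have sets_\<nu>[simp]: "sets \<nu> = sets lebesgue" by (simp add: \<nu>_def)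
  have \<nu>: "emeasure \<nu> A = (\<integral>\<^sup>+u\<in>A. F u \<partial>lebesgue)" if "A \<in> sets lebesgue" for A
    using that by (simp add: \<nu>_def emeasure_density)
  have \<nu>_fin: "emeasure \<nu> A \<noteq> \<infinity>" if "A \<in> sets lebesgue" for A
  proof -
    have "emeasure \<nu> A \<le> (\<integral>\<^sup>+u. F u \<partial>lebesgue)"
      unfolding \<nu>[OF that] by (intro nn_integral_mono) (auto simp: indicator_def)
    with fin show ?thesis by (auto simp: top_unique)
  qed
  define E where "E = {a. F a = 0}"
  have E: "E \<in> sets lebesgue"
    using measurable_sets[OF F, of "{0}"] by (simp add: E_def vimage_def)
  have \<nu>E: "emeasure \<nu> E = 0"
    unfolding \<nu>[OF E] by (subst nn_integral_0_iff_AE) (use E in \<open>auto simp: E_def indicator_def\<close>)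
  \<comment> \<open>Outer regularity of \<nu> is inherited from Lebesgue measure: the nested open
    sets \<open>U k\<close> decrease to \<open>Z\<close>, which exceeds \<open>E\<close> only by a
    null set, and \<nu> is finite, so it is continuous from above.\<close>
  have small: "\<exists>U. open U \<and> E \<subseteq> U \<and> emeasure \<nu> U < \<delta>" if "\<delta> > 0" for \<delta> :: ennreal
  proof -
    have "\<exists>T. open T \<and> E \<subseteq> T \<and> emeasure lebesgue (T - E) < ennreal (1 / Suc k)" for k
      using sets_lebesgue_outer_open[OF E, of "1 / Suc k"] by (metis of_nat_0_less_iff zero_less_Suc zero_less_divide_1_iff)
    then obtain T where T: "\<And>k. open (T k)" "\<And>k. E \<subseteq> T k"
      "\<And>k. emeasure lebesgue (T k - E) < ennreal (1 / Suc k)" by metis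
    define U where "U k = (\<Inter>i\<le>k. T i)" for k
    have oU: "open (U k)" and EU: "E \<subseteq> U k" for k
      using T by (auto simp: U_def)
    have "decseq U" unfolding decseq_def U_def by force
    define Z where "Z = (\<Inter>k. U k)"
    have mZ: "Z \<in> sets lebesgue" unfolding Z_def
      by (intro sets.countable_INT) (use oU in auto)
    have "emeasure lebesgue (Z - E) \<le> ennreal (1 / Suc k)" for k
    proof -
      have "Z - E \<subseteq> T k - E" by (auto simp: Z_def U_def)
      moreover have "T k - E \<in> sets lebesgue" using T(1) E by auto
      ultimately show ?thesis
        by (intro order_trans[OF emeasure_mono less_imp_le[OF T(3)]])
    qed
    moreover have "(\<lambda>k. ennreal (1 / Suc k)) \<longlonglongrightarrow> 0"
      using tendsto_ennrealI[OF LIMSEQ_inverse_real_of_nat] by (simp add: inverse_eq_divide)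
    ultimately have "emeasure lebesgue (Z - E) \<le> 0"
      by (intro LIMSEQ_le_const) auto
    then have "Z - E \<in> null_sets lebesgue" using mZ E by (simp add: null_sets_def)
    then have "emeasure \<nu> (Z - E) = 0"
      using absolutely_continuousI_density[OF F]
      by (auto simp: absolutely_continuous_def \<nu>_def null_sets_def)
    moreover have "emeasure \<nu> Z \<le> emeasure \<nu> (Z - E) + emeasure \<nu> E"
    proof -
      have "Z \<subseteq> (Z - E) \<union> E" by auto
      then have "emeasure \<nu> Z \<le> emeasure \<nu> ((Z - E) \<union> E)"
        by (intro emeasure_mono) (use mZ E in auto)
      also have "\<dots> \<le> emeasure \<nu> (Z - E) + emeasure \<nu> E"
        by (intro emeasure_subadditive) (use mZ E in auto)
      finally show ?thesis .
    qed
    ultimately have "emeasure \<nu> Z = 0" using \<nu>E by simp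
    moreover have "(\<lambda>k. emeasure \<nu> (U k)) \<longlonglongrightarrow> emeasure \<nu> Z"
      unfolding Z_def using \<open>decseq U\<close> oU \<nu>_fin
      by (intro Lim_emeasure_decseq) auto
    ultimately have "\<forall>\<^sub>F k in sequentially. emeasure \<nu> (U k) < \<delta>"
      using order_tendstoD(2) that by metis
    then obtain k where "emeasure \<nu> (U k) < \<delta>"
      by (auto dest: eventually_happens)
    with oU EU show ?thesis by blast
  qed
  define V where "V = unit_ball_vol (real DIM('a))"
  have "V > 0" by (simp add: V_def)
  show ?thesis
    unfolding negligible_outer_le
  proof (intro allI impI)
    fix e :: real assume "e > 0"
    \<comment> \<open>A selected ball has volume at most \<open>V / c\<close> times its \<nu>-mass,
      and \<open>V / c * \<delta> = e\<close>.\<close>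
    define \<delta> where "\<delta> = e * c / V"
    have "\<delta> > 0" using \<open>e > 0\<close> \<open>c > 0\<close> \<open>V > 0\<close> by (simp add: \<delta>_def)
    then obtain U where U: "open U" "E \<subseteq> U" "emeasure \<nu> U < ennreal \<delta>"
      using small[of "ennreal \<delta>"] by auto
    define K where "K = {(a, r). 0 < r \<and> ball a r \<subseteq> U \<and> ennreal (c * r ^ DIM('a)) < emeasure \<nu> (ball a r)}"
    have cover: "\<exists>i. i \<in> K \<and> x \<in> ball (fst i) (snd i) \<and> snd i < d" if "x \<in> ?B" "0 < d" for x d
    proof -
      have "x \<in> U" using that U by (auto simp: E_def)
      then obtain d' where d': "d' > 0" "ball x d' \<subseteq> U"
        using \<open>open U\<close> open_contains_ball by blast
      have "min d d' > 0" using d' that by auto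
      moreover have "\<forall>d>0. \<exists>r. 0 < r \<and> r < d \<and>
          ennreal (c * r ^ DIM('a)) < (\<integral>\<^sup>+u\<in>ball x r. F u \<partial>lebesgue)"
        using that(1) by simp
      ultimately obtain r where "0 < r" "r < min d d'"
          "ennreal (c * r ^ DIM('a)) < (\<integral>\<^sup>+u\<in>ball x r. F u \<partial>lebesgue)"
        by meson
      then have "(x, r) \<in> K" using d' by (auto simp: K_def \<nu>)
      with \<open>0 < r\<close> \<open>r < min d d'\<close> show ?thesis by (intro exI[of _ "(x, r)"]) auto
    qed
    obtain C where C: "countable C" "C \<subseteq> K"
      "pairwise (\<lambda>i j. disjnt (ball (fst i) (snd i)) (ball (fst j) (snd j))) C"
      "negligible (?B - (\<Union>i\<in>C. ball (fst i) (snd i)))"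
      by (rule Vitali_covering_theorem_balls[of ?B K fst snd, OF cover]) (assumption | rule that)+
    let ?b = "\<lambda>i::'a \<times> real. ball (fst i) (snd i)"
    have disj: "disjoint_family_on ?b C"
      using C(3) by (auto simp: pairwise_def disjoint_family_on_def disjnt_def)
    have "emeasure lebesgue (\<Union>i\<in>C. ?b i) = (\<integral>\<^sup>+i. emeasure lebesgue (?b i) \<partial>count_space C)"
      using C(1) disj by (intro emeasure_UN_countable) auto
    also have "\<dots> \<le> (\<integral>\<^sup>+i. ennreal (V / c) * emeasure \<nu> (?b i) \<partial>count_space C)"
    proof (intro nn_integral_mono)
      fix i assume "i \<in> space (count_space C)"
      then obtain a r where i: "i = (a, r)" "0 < r" "ennreal (c * r ^ DIM('a)) < emeasure \<nu> (ball a r)"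
        using C(2) by (auto simp: K_def)
      have "emeasure lebesgue (ball a r) = ennreal (V * r ^ DIM('a))"
        using i(2) by (simp add: emeasure_ball V_def)
      also have "\<dots> = ennreal (V / c) * ennreal (c * r ^ DIM('a))"
        using \<open>c > 0\<close> \<open>V > 0\<close> i(2) by (simp flip: ennreal_mult)
      also have "\<dots> \<le> ennreal (V / c) * emeasure \<nu> (ball a r)"
        using i(3) by (intro mult_left_mono) auto
      finally show "emeasure lebesgue (?b i) \<le> ennreal (V / c) * emeasure \<nu> (?b i)"
        by (simp add: i)
    qed
    also have "\<dots> = ennreal (V / c) * (\<integral>\<^sup>+i. emeasure \<nu> (?b i) \<partial>count_space C)"
      by (rule nn_integral_cmult) auto
    also have "(\<integral>\<^sup>+i. emeasure \<nu> (?b i) \<partial>count_space C) = emeasure \<nu> (\<Union>i\<in>C. ?b i)"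
      using C(1) disj by (intro emeasure_UN_countable[symmetric]) auto
    also have "\<dots> \<le> emeasure \<nu> U"
    proof (rule emeasure_mono)
      show "(\<Union>i\<in>C. ?b i) \<subseteq> U" using C(2) unfolding K_def by fastforce
    qed (use U(1) in simp)
    also have "ennreal (V / c) * emeasure \<nu> U \<le> ennreal (V / c) * ennreal \<delta>"
      using U(3) by (intro mult_left_mono) auto
    also have "\<dots> = ennreal e"
      using \<open>c > 0\<close> \<open>V > 0\<close> \<open>e > 0\<close> by (simp add: \<delta>_def flip: ennreal_mult)
    finally have le: "emeasure lebesgue (\<Union>i\<in>C. ?b i) \<le> ennreal e"
      by (simp add: mult_left_mono)
    have oS: "open (\<Union>i\<in>C. ?b i)" by auto
    then have W: "(\<Union>i\<in>C. ?b i) \<in> lmeasurable"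
      using le by (auto simp: fmeasurable_def top_unique less_top[symmetric])
    have We: "measure lebesgue (\<Union>i\<in>C. ?b i) \<le> e"
      using le \<open>e > 0\<close> by (simp add: measure_def enn2real_leI)
    have R: "?B - (\<Union>i\<in>C. ?b i) \<in> lmeasurable" "measure lebesgue (?B - (\<Union>i\<in>C. ?b i)) = 0"
      using C(4) by (simp_all only: negligible_iff_measure)
    have RW: "(?B - (\<Union>i\<in>C. ?b i)) \<union> (\<Union>i\<in>C. ?b i) \<in> lmeasurable"
      by (rule fmeasurable.Un[OF R(1) W])
    have RWe: "measure lebesgue ((?B - (\<Union>i\<in>C. ?b i)) \<union> (\<Union>i\<in>C. ?b i)) \<le> e"
      using measure_Un_le[OF fmeasurableD[OF R(1)] fmeasurableD[OF W]] R(2) We by linarith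
    show "\<exists>T. ?B \<subseteq> T \<and> T \<in> lmeasurable \<and> measure lebesgue T \<le> e"
      by (intro exI[of _ "(?B - (\<Union>i\<in>C. ?b i)) \<union> (\<Union>i\<in>C. ?b i)"] conjI RW RWe) blast
  qed
qed

lemma norm_add_powr_le:
  fixes x y :: "'b::real_normed_vector"
  assumes "p > 0"
  shows "norm (x + y) powr p \<le> 2 powr p * (norm x powr p + norm y powr p)"
proof -
  have "norm (x + y) powr p \<le> (2 * max (norm x) (norm y)) powr p"
    using norm_triangle_ineq[of x y] assms by (intro powr_mono2) auto
  also have "\<dots> = 2 powr p * max (norm x) (norm y) powr p" by (simp add: powr_mult)
  also have "\<dots> \<le> 2 powr p * (norm x powr p + norm y powr p)"
    by (intro mult_left_mono) (auto simp: max_def)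
  finally show ?thesis .
qed

text \<open>The value \<open>h a\<close> is approximated by a point \<open>q\<close> of a countable
  dense set. The part of |h - q|^p that exceeds the approximation error vanishes at
  \<open>a\<close>, so it is controlled by \<open>negligible_density_points\<close>; only countably
  many exceptional sets arise.\<close>

lemma lebesgue_points_UNIV:
  fixes h :: "'a::euclidean_space \<Rightarrow> 'b::euclidean_space"
  assumes h[measurable]: "h \<in> borel_measurable lebesgue"
    and fin: "(\<integral>\<^sup>+u. ennreal (norm (h u) powr p) \<partial>lebesgue) < \<infinity>" and "p > 0"
  shows "\<exists>N. negligible N \<and> (\<forall>a. a \<notin> N \<longrightarrow> (\<forall>e>0. \<exists>d>0. \<forall>r. 0 < r \<longrightarrow> r < d \<longrightarrow>
    (\<integral>\<^sup>+u\<in>ball a r. ennreal (norm (h u - h a) powr p) \<partial>lebesgue) \<le> ennreal (e * r ^ DIM('a))))"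
proof -
  obtain Q :: "'b set" where Q: "countable Q" "\<And>X. open X \<Longrightarrow> X \<noteq> {} \<Longrightarrow> \<exists>q\<in>Q. q \<in> X"
    using countable_dense_setE by metis
  have ball_meas[measurable]: "ball a r \<in> sets lebesgue" for a :: 'a and r by simp
  \<comment> \<open>The cutoff at \<open>1 / Suc k\<close> makes \<open>F\<close> vanish at every
    point where \<open>h\<close> is that close to \<open>q\<close>. The ball of radius
    \<open>m\<close> keeps the constant contribution of \<open>q\<close> integrable.\<close>
  define F where "F q k m u = ennreal (norm (h u - q) powr p) *
      indicator {u. norm (h u - q) > 1 / Suc k} u * indicator (ball 0 (real m)) u"
    for q and k m :: nat and u
  have F_meas[measurable]: "F q k m \<in> borel_measurable lebesgue" for q k m
    unfolding F_def by measurable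
  have F_fin: "(\<integral>\<^sup>+u. F q k m u \<partial>lebesgue) < \<infinity>" for q k m
  proof -
    have "F q k m u \<le> ennreal (2 powr p) * ennreal (norm (h u) powr p) +
        ennreal (2 powr p * norm q powr p) * indicator (ball 0 (real m)) u" for u
    proof -
      have "norm (h u - q) powr p \<le> 2 powr p * (norm (h u) powr p) + 2 powr p * norm q powr p"
        using norm_add_powr_le[OF \<open>p > 0\<close>, of "h u" "- q"] by (simp add: algebra_simps)
      then have "ennreal (norm (h u - q) powr p) \<le>
          ennreal (2 powr p) * ennreal (norm (h u) powr p) + ennreal (2 powr p * norm q powr p)"
        by (simp flip: ennreal_mult ennreal_plus)
      then show ?thesis by (auto simp: F_def indicator_def)
    qed
    then have "(\<integral>\<^sup>+u. F q k m u \<partial>lebesgue) \<le> (\<integral>\<^sup>+u. ennreal (2 powr p) * ennreal (norm (h u) powr p) +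
        ennreal (2 powr p * norm q powr p) * indicator (ball 0 (real m)) u \<partial>lebesgue)"
      by (intro nn_integral_mono)
    also have "\<dots> = (\<integral>\<^sup>+u. ennreal (2 powr p) * ennreal (norm (h u) powr p) \<partial>lebesgue) +
        (\<integral>\<^sup>+u. ennreal (2 powr p * norm q powr p) * indicator (ball 0 (real m) :: 'a set) u \<partial>lebesgue)"
      by (rule nn_integral_add) measurable
    also have "\<dots> = ennreal (2 powr p) * (\<integral>\<^sup>+u. ennreal (norm (h u) powr p) \<partial>lebesgue) +
        ennreal (2 powr p * norm q powr p) * emeasure lebesgue (ball 0 (real m) :: 'a set)"
      by (subst nn_integral_cmult, measurable) (subst nn_integral_cmult_indicator, simp_all)
    also have "\<dots> < \<infinity>"
      using fin by (simp add: ennreal_mult_less_top emeasure_ball)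
    finally show ?thesis .
  qed
  define B where "B q k m j = {a. F q k m a = 0 \<and> (\<forall>d>0. \<exists>r. 0 < r \<and> r < d \<and>
      ennreal (1 / Suc j * r ^ DIM('a)) < (\<integral>\<^sup>+u\<in>ball a r. F q k m u \<partial>lebesgue))}" for q k m j
  have negB: "negligible (B q k m j)" for q k m j
    unfolding B_def by (rule negligible_density_points) (use F_fin in \<open>simp_all\<close>)
  define N where "N = (\<Union>q\<in>Q. \<Union>k. \<Union>m. \<Union>j. B q k m j)"
  have "negligible N"
    unfolding N_def negligible_iff_null_sets using negB Q(1)
    by (intro null_sets_UN' null_sets_UN) (auto simp: negligible_iff_null_sets)
  define V where "V = unit_ball_vol (real DIM('a))"
  have "V > 0" by (simp add: V_def)
  have "\<exists>d>0. \<forall>r. 0 < r \<longrightarrow> r < d \<longrightarrow>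
    (\<integral>\<^sup>+u\<in>ball a r. ennreal (norm (h u - h a) powr p) \<partial>lebesgue) \<le> ennreal (e * r ^ DIM('a))"
    if a: "a \<notin> N" and e: "e > 0" for a e
  proof -
    have "(\<lambda>k. V * 2 powr p * 2 * (1 / real (Suc k)) powr p) \<longlonglongrightarrow> V * 2 powr p * 2 * 0 powr p"
      using \<open>p > 0\<close> LIMSEQ_inverse_real_of_nat
      by (intro tendsto_mult tendsto_const tendsto_powr') (auto simp: inverse_eq_divide)
    then have "\<forall>\<^sub>F k in sequentially. V * 2 powr p * 2 * (1 / real (Suc k)) powr p < e / 2"
      using e \<open>p > 0\<close> by (intro order_tendstoD(2)) auto
    then obtain k where k: "V * 2 powr p * 2 * (1 / real (Suc k)) powr p < e / 2"
      by (auto dest: eventually_happens)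
    obtain q where q: "q \<in> Q" "norm (h a - q) < 1 / Suc k"
      using Q(2)[of "ball (h a) (1 / Suc k)"] by (auto simp: dist_norm)
    obtain m :: nat where m: "norm a < m" using reals_Archimedean2 by blast
    \<comment> \<open>The error is split in two halves of \<open>e\<close>: the choice of
      \<open>k\<close> pays for the region where \<open>h\<close> is close to \<open>q\<close>, the
      choice of \<open>j\<close> for the mass of \<open>F\<close>. The factors
      \<open>2 powr p\<close> come from \<open>norm_add_powr_le\<close>.\<close>
    obtain j :: nat where j: "1 / Suc j < e / (2 * 2 powr p)"
      using reals_Archimedean[of "e / (2 * 2 powr p)"] e by (auto simp: inverse_eq_divide)
    have "a \<notin> B q k m j" using a q by (auto simp: N_def)
    moreover have "F q k m a = 0" using q by (simp add: F_def)
    ultimately obtain d where d: "d > 0" "\<And>r. 0 < r \<Longrightarrow> r < d \<Longrightarrow>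
        (\<integral>\<^sup>+u\<in>ball a r. F q k m u \<partial>lebesgue) \<le> ennreal (1 / Suc j * r ^ DIM('a))"
      unfolding B_def by (fastforce simp: not_less)
    define \<kappa> where "\<kappa> = (1 / real (Suc k)) powr p"
    have "(\<integral>\<^sup>+u\<in>ball a r. ennreal (norm (h u - h a) powr p) \<partial>lebesgue) \<le> ennreal (e * r ^ DIM('a))"
      if r: "0 < r" "r < min d (m - norm a)" for r
    proof -
      have "ennreal (norm (h u - h a) powr p) \<le> ennreal (2 powr p) * F q k m u + ennreal (2 powr p * 2 * \<kappa>)"
        if u: "u \<in> ball a r" for u
      proof -
        have "norm u \<le> norm a + norm (u - a)" using norm_triangle_ineq[of a "u - a"] by simp
        then have um: "u \<in> ball 0 (real m)" using r u by (auto simp: dist_norm norm_minus_commute)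
        have "norm (q - h a) powr p \<le> \<kappa>"
          unfolding \<kappa>_def using q \<open>p > 0\<close> by (intro powr_mono2) (auto simp: norm_minus_commute)
        moreover have "norm (h u - h a) powr p \<le> 2 powr p * (norm (h u - q) powr p + norm (q - h a) powr p)"
          using norm_add_powr_le[OF \<open>p > 0\<close>, of "h u - q" "q - h a"] by simp
        moreover have "2 powr p * (norm (h u - q) powr p + norm (q - h a) powr p) \<le>
            2 powr p * (norm (h u - q) powr p + \<kappa>)"
          using calculation(1) by (intro mult_left_mono) auto
        ultimately have 1: "norm (h u - h a) powr p \<le> 2 powr p * (norm (h u - q) powr p + \<kappa>)" by linarith
        show ?thesis
        proof (cases "norm (h u - q) > 1 / Suc k")
          case True
          then have "F q k m u = ennreal (norm (h u - q) powr p)" using um by (simp add: F_def)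
          moreover have "0 \<le> 2 powr p * \<kappa>" by (simp add: \<kappa>_def)
          ultimately show ?thesis using 1 by (simp add: algebra_simps flip: ennreal_mult ennreal_plus)
        next
          case False
          then have "norm (h u - q) powr p \<le> \<kappa>"
            unfolding \<kappa>_def using \<open>p > 0\<close> by (intro powr_mono2) auto
          then have "2 powr p * (norm (h u - q) powr p + \<kappa>) \<le> 2 powr p * (\<kappa> + \<kappa>)"
            by (intro mult_left_mono) auto
          from order_trans[OF 1 this] have "norm (h u - h a) powr p \<le> 2 powr p * 2 * \<kappa>"
            by (simp add: algebra_simps)
          then show ?thesis by (simp add: ennreal_leI add_increasing)
        qed
      qed
      then have "(\<integral>\<^sup>+u\<in>ball a r. ennreal (norm (h u - h a) powr p) \<partial>lebesgue) \<le>
          (\<integral>\<^sup>+u. ennreal (2 powr p) * (F q k m u * indicator (ball a r) u) +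
            ennreal (2 powr p * 2 * \<kappa>) * indicator (ball a r) u \<partial>lebesgue)"
        by (intro nn_integral_mono) (auto simp: indicator_def)
      also have "\<dots> = (\<integral>\<^sup>+u. ennreal (2 powr p) * (F q k m u * indicator (ball a r) u) \<partial>lebesgue) +
          (\<integral>\<^sup>+u. ennreal (2 powr p * 2 * \<kappa>) * indicator (ball a r) u \<partial>lebesgue)"
        by (rule nn_integral_add) measurable
      also have "\<dots> = ennreal (2 powr p) * (\<integral>\<^sup>+u\<in>ball a r. F q k m u \<partial>lebesgue) +
          ennreal (2 powr p * 2 * \<kappa>) * emeasure lebesgue (ball a r)"
        by (subst nn_integral_cmult, measurable) (subst nn_integral_cmult_indicator, simp_all)
      also have "\<dots> \<le> ennreal (2 powr p) * ennreal (1 / Suc j * r ^ DIM('a)) +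
          ennreal (2 powr p * 2 * \<kappa>) * ennreal (V * r ^ DIM('a))"
        using d(2)[of r] r by (intro add_mono mult_left_mono) (auto simp: emeasure_ball V_def)
      also have "\<dots> = ennreal ((2 powr p * (1 / Suc j) + V * 2 powr p * 2 * \<kappa>) * r ^ DIM('a))"
        using r \<open>V > 0\<close> by (simp add: \<kappa>_def algebra_simps flip: ennreal_mult ennreal_plus)
      also have "\<dots> \<le> ennreal (e * r ^ DIM('a))"
      proof (intro ennreal_leI mult_right_mono)
        have "2 powr p * (1 / Suc j) \<le> 2 powr p * (e / (2 * 2 powr p))"
          using j by (intro mult_left_mono) auto
        also have "\<dots> = e / 2" by simp
        finally show "2 powr p * (1 / Suc j) + V * 2 powr p * 2 * \<kappa> \<le> e"
          using k unfolding \<kappa>_def by linarith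
      qed (use r in auto)
      finally show ?thesis .
    qed
    note est = this
    show ?thesis
    proof (intro exI[of _ "min d (m - norm a)"] conjI allI impI)
      show "min d (m - norm a) > 0" using d(1) m by simp
    qed (rule est)
  qed
  note good = this
  show ?thesis
  proof (rule exI[of _ N], rule conjI)
    show "negligible N" by fact
  qed (intro allI impI, rule good)
qed

text \<open>Localisation: \<open>U\<close> is a countable union of closed boxes, and
  \<open>h\<close> is cut off outside one box at a time. Small balls about an interior point of the
  box do not see the cutoff, and the faces of the boxes are null.\<close>

lemma lebesgue_points:
  fixes h :: "'a::euclidean_space \<Rightarrow> 'b::euclidean_space"
  assumes "open U" and h: "h \<in> borel_measurable (lebesgue_on U)" and "p > 0"
    and fin: "\<And>C. compact C \<Longrightarrow> C \<subseteq> U \<Longrightarrow> (\<integral>\<^sup>+u\<in>C. ennreal (norm (h u) powr p) \<partial>lebesgue) < \<infinity>"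
  shows "\<exists>N. negligible N \<and> (\<forall>a\<in>U - N. \<forall>e>0. \<exists>d>0. \<forall>r. 0 < r \<longrightarrow> r < d \<longrightarrow>
    (\<integral>\<^sup>+u\<in>ball a r. ennreal (norm (h u - h a) powr p) \<partial>lebesgue) \<le> ennreal (e * r ^ DIM('a)))"
proof -
  obtain D where D: "countable D" "D \<subseteq> Pow U" "\<And>X. X \<in> D \<Longrightarrow> \<exists>a b. X = cbox a b" "\<Union>D = U"
    by (rule open_countable_Union_open_cbox[OF \<open>open U\<close>]) (rule that)
  let ?good = "\<lambda>N h a. \<forall>e>0. \<exists>d>0. \<forall>r. 0 < r \<longrightarrow> r < d \<longrightarrow>
    (\<integral>\<^sup>+u\<in>ball a r. ennreal (norm (h u - h a) powr p) \<partial>lebesgue) \<le> ennreal (e * r ^ DIM('a))"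
  have "\<forall>X\<in>D. \<exists>N. negligible N \<and> (\<forall>a\<in>X - N. ?good N h a)"
  proof
    fix X assume "X \<in> D"
    obtain b c where X: "X = cbox b c" using D(3)[OF \<open>X \<in> D\<close>] by blast
    have "X \<subseteq> U" using D(2) \<open>X \<in> D\<close> by auto
    define h' where "h' u = indicator X u *\<^sub>R h u" for u
    have "h \<in> borel_measurable (lebesgue_on X)"
      by (rule measurable_restrict_mono[OF h \<open>X \<subseteq> U\<close>])
    then have m: "h' \<in> borel_measurable lebesgue"
      unfolding h'_def by (subst borel_measurable_restrict_space_iff[symmetric]) (auto simp: X)
    have "ennreal (norm (h' u) powr p) = ennreal (norm (h u) powr p) * indicator X u" for u
      by (simp add: h'_def indicator_def)
    then have f: "(\<integral>\<^sup>+u. ennreal (norm (h' u) powr p) \<partial>lebesgue) < \<infinity>"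
      using fin[of X] \<open>X \<subseteq> U\<close> by (simp add: X)
    obtain N where N: "negligible N" "\<And>a. a \<notin> N \<Longrightarrow> ?good N h' a"
      using lebesgue_points_UNIV[OF m f \<open>p > 0\<close>] by blast
    have good: "?good N h a" if a: "a \<in> X - (N \<union> (cbox b c - box b c))" for a
    proof (intro allI impI)
      fix e :: real assume "e > 0"
      then obtain d where d: "d > 0" "\<And>r. 0 < r \<Longrightarrow> r < d \<Longrightarrow>
        (\<integral>\<^sup>+u\<in>ball a r. ennreal (norm (h' u - h' a) powr p) \<partial>lebesgue) \<le> ennreal (e * r ^ DIM('a))"
        using N(2)[of a] a by blast
      have "a \<in> box b c" using a by (auto simp: X)
      then obtain d' where d': "d' > 0" "ball a d' \<subseteq> box b c"
        using open_box open_contains_ball by blast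
      show "\<exists>d>0. \<forall>r. 0 < r \<longrightarrow> r < d \<longrightarrow>
        (\<integral>\<^sup>+u\<in>ball a r. ennreal (norm (h u - h a) powr p) \<partial>lebesgue) \<le> ennreal (e * r ^ DIM('a))"
      proof (intro exI[of _ "min d d'"] conjI allI impI)
        fix r assume r: "0 < r" "r < min d d'"
        have "h' u = h u" if "u \<in> ball a r" for u
        proof -
          have "u \<in> ball a d'" using that r by auto
          then have "u \<in> X" using d' box_subset_cbox[of b c] unfolding X by blast
          then show ?thesis by (simp add: h'_def)
        qed
        then have "(\<integral>\<^sup>+u\<in>ball a r. ennreal (norm (h u - h a) powr p) \<partial>lebesgue) =
            (\<integral>\<^sup>+u\<in>ball a r. ennreal (norm (h' u - h' a) powr p) \<partial>lebesgue)"
          using r by (intro nn_integral_cong) (auto simp: indicator_def)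
        also have "\<dots> \<le> ennreal (e * r ^ DIM('a))" using d(2) r by auto
        finally show "(\<integral>\<^sup>+u\<in>ball a r. ennreal (norm (h u - h a) powr p) \<partial>lebesgue) \<le> ennreal (e * r ^ DIM('a))" .
      qed (use d d' in auto)
    qed
    show "\<exists>N. negligible N \<and> (\<forall>a\<in>X - N. ?good N h a)"
    proof (rule exI[of _ "N \<union> (cbox b c - box b c)"], intro conjI ballI)
      show "negligible (N \<union> (cbox b c - box b c))"
        by (rule negligible_Un[OF N(1) negligible_frontier_interval])
    qed (rule good)
  qed
  then obtain N where N': "\<forall>X\<in>D. negligible (N X) \<and> (\<forall>a\<in>X - N X. ?good N h a)"
    by (rule bchoice[THEN exE])
  have N: "negligible (N X)" "\<forall>a\<in>X - N X. ?good N h a" if "X \<in> D" for X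
    using bspec[OF N' that] by (rule conjunct1, rule conjunct2)
  have "negligible (\<Union>X\<in>D. N X)"
    unfolding negligible_iff_null_sets using D(1) N(1)
    by (intro null_sets_UN') (auto simp: negligible_iff_null_sets)
  moreover have "\<forall>a\<in>U - (\<Union>X\<in>D. N X). ?good N h a"
  proof
    fix a assume a: "a \<in> U - (\<Union>X\<in>D. N X)"
    obtain X where "X \<in> D" "a \<in> X" using a D(4) by auto
    with a have "a \<in> X - N X" by blast
    with N(2)[OF \<open>X \<in> D\<close>] show "?good N h a" by (rule bspec)
  qed
  ultimately show ?thesis by (intro exI conjI)
qed

subsection \<open>Mollification along paths\<close>

text \<open>Passage from the Bochner integral of the definitions to the gauge integral over a fixed
  box, the setting of \<open>leibniz_rule_field_derivative\<close>.\<close>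

lemma LINT_restrict_cbox:
  fixes h :: "real^'n \<Rightarrow> real"
  assumes "open U" "cbox c d \<subseteq> U" "continuous_on (cbox c d) h"
    and 0: "\<And>u. u \<in> U - cbox c d \<Longrightarrow> h u = 0"
  shows "(LINT u|lebesgue_on U. h u) = integral (cbox c d) h"
proof -
  have "(LINT u|lebesgue_on U. h u) = (LINT u|lebesgue. indicator U u *\<^sub>R h u)"
    using assms(1) by (intro integral_restrict_space) simp
  also have "\<dots> = (LINT u:cbox c d|lebesgue. h u)"
    unfolding set_lebesgue_integral_def
    using assms(2) 0 by (intro Bochner_Integration.integral_cong) (auto simp: indicator_def)
  also have "\<dots> = integral (cbox c d) h"
    using absolutely_integrable_continuous[OF assms(3)] by (intro set_lebesgue_integral_eq_integral(2))
  finally show ?thesis .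
qed

lemma locally_integrable_on_linear:
  assumes "bounded_linear L" "g locally_integrable_on U"
  shows "(\<lambda>x. L (g x)) locally_integrable_on U"
  using assms(2) absolutely_integrable_linear[OF _ assms(1)]
  unfolding locally_integrable_on_def by (auto simp: o_def)

lemma continuous_imp_locally_integrable_on:
  fixes f :: "real^'n \<Rightarrow> 'b::euclidean_space"
  assumes "continuous_on U f"
  shows "f locally_integrable_on U"
  unfolding locally_integrable_on_def set_integrable_def
proof safe
  fix C assume "compact C" "C \<subseteq> U"
  then have "integrable lborel (\<lambda>x. indicator C x *\<^sub>R f x)"
    using assms by (intro borel_integrable_compact) (auto intro: continuous_on_subset)
  then show "integrable lebesgue (\<lambda>x. indicator C x *\<^sub>R f x)"
    using integrable_completion[OF borel_measurable_integrable] by blast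
qed

lemma integrable_mult_compact_support:
  fixes h :: "real^'n \<Rightarrow> real"
  assumes "open U" "h locally_integrable_on U" "continuous_on UNIV \<phi>"
    and C: "compact C" "C \<subseteq> U" and 0: "\<And>u. u \<notin> C \<Longrightarrow> \<phi> u = 0"
  shows "integrable (lebesgue_on U) (\<lambda>u. h u * \<phi> u)"
proof -
  have cont: "continuous_on C \<phi>" using assms(3) continuous_on_subset by blast
  have Cl: "C \<in> sets lebesgue" using C(1) by (simp add: compact_imp_closed)
  have "(\<lambda>u. \<phi> u * h u) absolutely_integrable_on C"
  proof (rule absolutely_integrable_bounded_measurable_product[OF bilinear_times _ Cl])
    show "\<phi> \<in> borel_measurable (lebesgue_on C)"
      by (rule continuous_imp_measurable_on_sets_lebesgue[OF cont Cl])
    show "bounded (\<phi> ` C)"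
      using compact_continuous_image[OF cont C(1)] compact_imp_bounded by blast
    show "h absolutely_integrable_on C"
      using assms(2) C by (auto simp: locally_integrable_on_def)
  qed
  then have "integrable lebesgue (\<lambda>u. indicator U u *\<^sub>R (h u * \<phi> u))"
    unfolding set_integrable_def
    by (rule Bochner_Integration.integrable_cong[THEN iffD1, rotated 2])
      (use C 0 in \<open>auto simp: indicator_def mult.commute\<close>)
  then show ?thesis
    using \<open>open U\<close> by (subst integrable_restrict_space) auto
qed

text \<open>Scalar version of \<open>has_weak_gradient\<close> with vector-valued \<open>g\<close>.
  The analysis is done for the functions \<open>w \<bullet> y x\<close>, whose gradient is
  \<open>w v* G x\<close>.\<close>

definition weak_grad :: "(real^'n) set \<Rightarrow> (real^'n \<Rightarrow> real) \<Rightarrow> (real^'n \<Rightarrow> real^'n) \<Rightarrow> bool" where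
  "weak_grad U f g \<longleftrightarrow> f locally_integrable_on U \<and> g locally_integrable_on U \<and>
     (\<forall>\<phi> j. test_function U \<phi> \<longrightarrow>
        (LINT x|lebesgue_on U. f x * partial_deriv j \<phi> x) =
        - (LINT x|lebesgue_on U. g x $ j * \<phi> x))"

section \<open>The normalised mollifier and its derivatives\<close>

definition bump_mass :: "'n::finite itself \<Rightarrow> real" where
  "bump_mass _ = (LINT w|lborel. flat 0 (1 - w \<bullet> (w::real^'n)))"

definition mollifier :: "real^'n \<Rightarrow> real \<Rightarrow> real^'n \<Rightarrow> real" where
  "mollifier x s u = flat 0 (1 - (u - x) \<bullet> (u - x) / s\<^sup>2) / (s ^ CARD('n) * bump_mass TYPE('n))"

text \<open>The scalar factor in the gradient of the mollifier, which in the variable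
  \<open>u\<close> equals \<open>- mollifier_aux x s u *\<^sub>R (u - x)\<close>. The index 2
  appears because the derivative of \<open>flat 0\<close> is \<open>flat 2\<close>.\<close>

definition mollifier_aux :: "real^'n \<Rightarrow> real \<Rightarrow> real^'n \<Rightarrow> real" where
  "mollifier_aux x s u =
     2 * flat 2 (1 - (u - x) \<bullet> (u - x) / s\<^sup>2) / (s ^ (CARD('n) + 2) * bump_mass TYPE('n))"

lemma continuous_on_flat: "continuous_on S (flat m)"
  using flat_has_derivative DERIV_isCont continuous_at_imp_continuous_on by blast

lemma continuous_on_flat_compose[continuous_intros]:
  "continuous_on S f \<Longrightarrow> continuous_on S (\<lambda>x. flat m (f x))"
  using continuous_on_compose2[OF continuous_on_flat[of UNIV]] by blast

lemma bump_integrable: "integrable lborel (\<lambda>w::real^'n. flat 0 (1 - w \<bullet> w))"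
proof -
  have "integrable lborel (\<lambda>w::real^'n. indicator (cball 0 1) w *\<^sub>R flat 0 (1 - w \<bullet> w))"
    by (intro borel_integrable_compact continuous_intros) auto
  also have "(\<lambda>w::real^'n. indicator (cball 0 1) w *\<^sub>R flat 0 (1 - w \<bullet> w)) = (\<lambda>w. flat 0 (1 - w \<bullet> w))"
    by (auto simp: fun_eq_iff indicator_def norm_le_square flat_zero)
  finally show ?thesis .
qed

lemma bump_mass_pos: "bump_mass TYPE('n::finite) > 0"
proof -
  let ?b = "\<lambda>w::real^'n. flat 0 (1 - w \<bullet> w)"
  have "bump_mass TYPE('n) \<ge> 0"
    unfolding bump_mass_def by (simp add: flat_nonneg)
  moreover have "bump_mass TYPE('n) \<noteq> 0"
  proof
    assume "bump_mass TYPE('n) = 0"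
    then have "AE w in lborel. ?b w = 0"
      unfolding bump_mass_def
      using integral_nonneg_eq_0_iff_AE[OF bump_integrable[where 'n='n]] by (simp add: flat_nonneg)
    then have "AE w in lborel. w \<notin> ball (0::real^'n) 1"
    proof (rule AE_mp, intro AE_I2 impI notI)
      fix w :: "real^'n" assume "?b w = 0" "w \<in> ball 0 1"
      then have "norm w < 1" by simp
      then have "w \<bullet> w < 1" by (simp add: norm_lt_square)
      then show False using flat_pos[of "1 - w \<bullet> w" 0] \<open>?b w = 0\<close> by simp
    qed
    then have "ball (0::real^'n) 1 \<in> null_sets lborel"
      by (subst AE_iff_null_sets) auto
    then show False
      using unit_ball_vol_pos[of "real CARD('n)"] by (simp add: null_sets_def emeasure_ball)
  qed
  ultimately show ?thesis by simp
qed

lemma mollifier_nonneg: "s > 0 \<Longrightarrow> 0 \<le> mollifier x s u"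
  unfolding mollifier_def using bump_mass_pos
  by (intro divide_nonneg_nonneg flat_nonneg mult_nonneg_nonneg) (auto intro: less_imp_le)

lemma mollifier_le:
  fixes x :: "real^'n"
  assumes "s > 0"
  shows "mollifier x s u \<le> 1 / (s ^ CARD('n) * bump_mass TYPE('n))"
  unfolding mollifier_def using bump_mass_pos[where 'n='n] assms
  by (intro divide_right_mono flat_0_le_1 mult_nonneg_nonneg) (auto intro: less_imp_le)

lemma ball_complement_arg:
  fixes x :: "real^'n"
  assumes "s > 0" "u \<notin> ball x s"
  shows "1 - (u - x) \<bullet> (u - x) / s\<^sup>2 \<le> 0"
proof -
  have "s \<le> norm (u - x)" using assms by (simp add: dist_norm norm_minus_commute)
  then have "s\<^sup>2 \<le> (u - x) \<bullet> (u - x)"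
    using assms by (simp add: power2_norm_eq_inner[symmetric] power_mono)
  then show ?thesis using assms by simp
qed

lemma mollifier_eq_0: "s > 0 \<Longrightarrow> u \<notin> ball x s \<Longrightarrow> mollifier x s u = 0"
  unfolding mollifier_def by (simp add: flat_zero[OF ball_complement_arg])

lemma mollifier_aux_eq_0: "s > 0 \<Longrightarrow> u \<notin> ball x s \<Longrightarrow> mollifier_aux x s u = 0"
  unfolding mollifier_aux_def by (simp add: flat_zero[OF ball_complement_arg])

lemma continuous_on_mollifier: "s > 0 \<Longrightarrow> continuous_on S (mollifier x s)"
  unfolding mollifier_def using bump_mass_pos
  by (intro continuous_intros) (auto simp: less_le)

lemma smooth_expr_mollifier: "s > 0 \<Longrightarrow> smooth_expr (mollifier (x::real^'n) s)"
proof -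
  assume "s > 0"
  have "smooth_expr (\<lambda>u. flat 0 (1 - (\<Sum>i\<in>UNIV. (u $ i - x $ i) * (u $ i - x $ i)) * (1 / s\<^sup>2)) *
      (1 / (s ^ CARD('n) * bump_mass TYPE('n))))"
    by (intro smooth_expr.mult smooth_expr.flat smooth_expr_diff smooth_expr_sum smooth_expr.coord smooth_expr.const)
  moreover have "(\<lambda>u. flat 0 (1 - (\<Sum>i\<in>UNIV. (u $ i - x $ i) * (u $ i - x $ i)) * (1 / s\<^sup>2)) *
      (1 / (s ^ CARD('n) * bump_mass TYPE('n)))) = mollifier x s"
    by (simp add: mollifier_def inner_vec_def fun_eq_iff)
  ultimately show ?thesis by simp
qed

lemma integral_mollifier_lborel:
  fixes x :: "real^'n"
  assumes "s > 0"
  shows "integrable lborel (mollifier x s)" "(LINT u|lborel. mollifier x s u) = 1"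
proof -
  have eq: "mollifier x s = (\<lambda>u. indicator (cball x s) u *\<^sub>R mollifier x s u)"
    by (auto simp: fun_eq_iff indicator_def intro!: mollifier_eq_0[OF assms])
  show "integrable lborel (mollifier x s)"
    by (subst eq, intro borel_integrable_compact continuous_on_mollifier assms) auto
  have [measurable]: "mollifier x s \<in> borel_measurable borel"
    using continuous_on_mollifier[OF assms, of UNIV] by (rule borel_measurable_continuous_onI)
  have "(LINT u|lborel. mollifier x s u) =
      (LINT u|density (distr lborel borel (\<lambda>w. x + s *\<^sub>R w)) (\<lambda>_. ennreal (s ^ CARD('n))). mollifier x s u)"
    using lborel_affine[of s x] assms by (simp add: ennreal_power)
  also have "\<dots> = (LINT w|lborel. s ^ CARD('n) * mollifier x s (x + s *\<^sub>R w))"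
    using assms by (subst integral_density) (auto simp: integral_distr)
  also have "\<dots> = (LINT w|lborel. flat 0 (1 - w \<bullet> (w::real^'n)) / bump_mass TYPE('n))"
    using assms by (intro Bochner_Integration.integral_cong) (auto simp: mollifier_def power2_eq_square)
  also have "\<dots> = bump_mass TYPE('n) / bump_mass TYPE('n)"
    by (simp add: bump_mass_def)
  also have "\<dots> = 1"
    using bump_mass_pos[where 'n='n] by simp
  finally show "(LINT u|lborel. mollifier x s u) = 1" .
qed

lemma integral_mollifier:
  fixes x :: "real^'n"
  assumes "s > 0" "open U" "cball x s \<subseteq> U"
  shows "integrable (lebesgue_on U) (mollifier x s)" "(LINT u|lebesgue_on U. mollifier x s u) = 1"
proof -
  have eq: "indicator U u * mollifier x s u = mollifier x s u" for u
  proof (cases "u \<in> U")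
    case False
    then have "u \<notin> ball x s" using assms(3) ball_subset_cball[of x s] by blast
    then show ?thesis using mollifier_eq_0[OF assms(1), of u x] by simp
  qed simp
  have m: "mollifier x s \<in> borel_measurable lborel"
    using integral_mollifier_lborel(1)[OF assms(1)] by blast
  have "integrable lebesgue (mollifier x s)"
    using integral_mollifier_lborel(1)[OF assms(1)] integrable_completion[OF m] by simp
  then show "integrable (lebesgue_on U) (mollifier x s)"
    using assms(2) by (subst integrable_restrict_space) (simp_all add: eq)
  have "(LINT u|lebesgue_on U. mollifier x s u) = (LINT u|lebesgue. mollifier x s u)"
    using assms(2) by (subst integral_restrict_space) (simp_all add: eq)
  then show "(LINT u|lebesgue_on U. mollifier x s u) = 1"
    using integral_mollifier_lborel(2)[OF assms(1)] integral_completion[OF m] by simp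
qed

lemma flat_0_has_derivative: "(flat 0 has_real_derivative flat 2 t) (at t)"
  using flat_has_derivative[of 0 t] by (simp add: numeral_2_eq_2)

lemma mollifier_has_derivative:
  fixes x :: "real^'n"
  assumes "s > 0"
  shows "(mollifier x s has_derivative (\<lambda>h. - ((u - x) \<bullet> h) * mollifier_aux x s u)) (at u)"
proof -
  let ?q = "\<lambda>u. 1 - (u - x) \<bullet> (u - x) / s\<^sup>2"
  have q: "(?q has_derivative (\<lambda>h. - (2 * ((u - x) \<bullet> h)) / s\<^sup>2)) (at u)"
    using assms by (auto intro!: derivative_eq_intros
      simp: inner_commute fun_eq_iff field_simps power2_eq_square power4_eq_xxxx)
  show ?thesis
    unfolding mollifier_def
    by (rule has_derivative_eq_rhs[OF bounded_linear.has_derivative[OF bounded_linear_divide DERIV_compose_FDERIV[OF flat_0_has_derivative q]]])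
      (use assms bump_mass_pos[where 'n='n] in \<open>auto simp: fun_eq_iff mollifier_aux_def power2_eq_square power_add field_simps\<close>)
qed

text \<open>The terms with \<open>mollifier_aux\<close> come from the moving argument of the bump,
  the last term from the factor \<open>s ^ CARD('n)\<close> in the normalisation. This sum is minus
  a divergence in \<open>u\<close>, which makes the weak gradient applicable.\<close>

lemma mollifier_path_derivative:
  fixes a v u :: "real^'n" and s0 t \<rho> :: real
  assumes "s0 + t * \<rho> > 0"
  defines "x \<equiv> a + t *\<^sub>R v" and "s \<equiv> s0 + t * \<rho>"
  shows "((\<lambda>t. mollifier (a + t *\<^sub>R v) (s0 + t * \<rho>) u) has_real_derivative
     (((u - x) \<bullet> v + \<rho> / s * ((u - x) \<bullet> (u - x))) * mollifier_aux x s u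
       - CARD('n) * \<rho> / s * mollifier x s u)) (at t)"
proof -
  let ?q = "\<lambda>t. 1 - (u - (a + t *\<^sub>R v)) \<bullet> (u - (a + t *\<^sub>R v)) / (s0 + t * \<rho>)\<^sup>2"
  let ?Q = "2 * ((u - x) \<bullet> v) / s\<^sup>2 + 2 * \<rho> * ((u - x) \<bullet> (u - x)) / s ^ 3"
  have inner: "((\<lambda>t. (u - (a + t *\<^sub>R v)) \<bullet> (u - (a + t *\<^sub>R v))) has_real_derivative - 2 * ((u - x) \<bullet> v)) (at t)"
    unfolding has_field_derivative_def x_def
    by (auto intro!: derivative_eq_intros simp: fun_eq_iff inner_commute algebra_simps)
  have "s > 0" using assms by simp
  have sq: "((\<lambda>t. (s0 + t * \<rho>)\<^sup>2) has_real_derivative 2 * \<rho> * s) (at t)"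
    by (auto intro!: derivative_eq_intros simp: s_def)
  have q: "(?q has_real_derivative ?Q) (at t)"
    by (rule DERIV_cong[OF DERIV_diff[OF DERIV_const DERIV_divide[OF inner sq]]], unfold s_def[symmetric] x_def[symmetric])
      (use \<open>s > 0\<close> in \<open>simp_all add: field_simps
        power2_eq_square power3_eq_cube\<close>)
  have S: "((\<lambda>t. (s0 + t * \<rho>) ^ CARD('n) * bump_mass TYPE('n)) has_real_derivative
      CARD('n) * (\<rho> * s ^ (CARD('n) - 1)) * bump_mass TYPE('n)) (at t)"
    by (auto intro!: derivative_eq_intros simp: s_def)
  have f: "((\<lambda>t. flat 0 (?q t)) has_real_derivative (flat 2 (?q t) * ?Q)) (at t)"
    using DERIV_chain2[OF flat_0_has_derivative q] .
  obtain k where k: "CARD('n) = Suc k" by (metis zero_less_card_finite gr0_implies_Suc)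
  show ?thesis
    unfolding mollifier_def
    by (rule DERIV_cong[OF DERIV_divide[OF f S]], unfold s_def[symmetric] x_def[symmetric])
      (use \<open>s > 0\<close> bump_mass_pos[where 'n='n] in \<open>simp_all add: mollifier_aux_def k
        power2_eq_square power3_eq_cube field_simps\<close>)
qed

lemma partial_deriv_mollifier_linear:
  fixes x :: "real^'n"
  assumes "s > 0"
  shows "partial_deriv j (\<lambda>u. mollifier x s u * (b + c * (u $ j - x $ j))) u =
    - ((u - x) $ j * (b + c * (u - x) $ j)) * mollifier_aux x s u + c * mollifier x s u"
proof -
  have l: "((\<lambda>u. b + c * (u $ j - x $ j)) has_derivative (\<lambda>h. c * h $ j)) (at u)"
    by (auto intro!: derivative_eq_intros bounded_linear_imp_has_derivative bounded_linear_vec_nth)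
  show ?thesis
    unfolding partial_deriv_eqI[OF has_derivative_mult[OF mollifier_has_derivative[OF assms] l]]
    by (simp add: inner_axis algebra_simps)
qed

lemma test_function_mollifier_linear:
  fixes x :: "real^'n"
  assumes "s > 0" "cball x s \<subseteq> U"
  shows "test_function U (\<lambda>u. mollifier x s u * (b + c * (u $ j - x $ j)))"
proof (rule test_functionI)
  show "smooth_expr (\<lambda>u. mollifier x s u * (b + c * (u $ j - x $ j)))"
    by (intro smooth_expr.mult smooth_expr_mollifier assms smooth_expr.add smooth_expr_diff
        smooth_expr.coord smooth_expr.const)
  show "mollifier x s u * (b + c * (u $ j - x $ j)) = 0" if "u \<notin> cball x s" for u
    using mollifier_eq_0[of s u x] assms(1) that by auto
qed (use assms(2) in auto)

lemma integrable_mult_test_function: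
  fixes h :: "real^'n \<Rightarrow> real"
  assumes "open U" "h locally_integrable_on U" "test_function U \<phi>"
  shows "integrable (lebesgue_on U) (\<lambda>u. h u * \<phi> u)"
    and "integrable (lebesgue_on U) (\<lambda>u. h u * partial_deriv j \<phi> u)"
  by (rule test_functionD[OF assms(3)]; intro integrable_mult_compact_support[OF assms(1,2)]; assumption)+

text \<open>The left-hand weight is minus the divergence of the test field
  \<open>mollifier x s u * (v + c * (u - x))\<close>; for \<open>c = \<rho> / s\<close> it is also the derivative of the mollifier when
  its centre moves with velocity \<open>v\<close> and its radius with velocity \<open>\<rho>\<close>.\<close>

lemma weak_grad_test_sum:
  fixes f :: "real^'n \<Rightarrow> real" and v :: "real^'n" and c :: real
  assumes "open U" and wg: "weak_grad U f g" and "s > 0" and xs: "cball x s \<subseteq> U"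
  shows "(LINT u|lebesgue_on U. f u * (((u - x) \<bullet> v + c * ((u - x) \<bullet> (u - x))) * mollifier_aux x s u
       - CARD('n) * c * mollifier x s u)) =
    (LINT u|lebesgue_on U. (g u \<bullet> (v + c *\<^sub>R (u - x))) * mollifier x s u)"
proof -
  define \<phi> where "\<phi> j = (\<lambda>u. mollifier x s u * (v $ j + c * (u $ j - x $ j)))" for j
  have test: "test_function U (\<phi> j)" for j
    unfolding \<phi>_def by (rule test_function_mollifier_linear[OF \<open>s > 0\<close> xs])
  have sum1: "((u - x) \<bullet> v + c * ((u - x) \<bullet> (u - x))) * mollifier_aux x s u - CARD('n) * c * mollifier x s u
      = - (\<Sum>j\<in>UNIV. partial_deriv j (\<phi> j) u)" for u
    unfolding \<phi>_def partial_deriv_mollifier_linear[OF \<open>s > 0\<close>]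
    by (simp add: inner_vec_def sum.distrib sum_subtractf sum_negf sum_distrib_left sum_distrib_right algebra_simps)
  have sum2: "(g u \<bullet> (v + c *\<^sub>R (u - x))) * mollifier x s u = (\<Sum>j\<in>UNIV. g u $ j * \<phi> j u)" for u
    by (simp add: \<phi>_def inner_vec_def sum_distrib_left sum_distrib_right algebra_simps)
  have loc: "f locally_integrable_on U" "g locally_integrable_on U"
    using wg by (auto simp: weak_grad_def)
  have int1: "integrable (lebesgue_on U) (\<lambda>u. f u * partial_deriv j (\<phi> j) u)" for j
    by (rule integrable_mult_test_function(2)[OF \<open>open U\<close> loc(1) test])
  have int2: "integrable (lebesgue_on U) (\<lambda>u. g u $ j * \<phi> j u)" for j
    by (rule integrable_mult_test_function(1)[OF \<open>open U\<close>
        locally_integrable_on_linear[OF bounded_linear_vec_nth loc(2)] test])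
  have "(LINT u|lebesgue_on U. f u * (((u - x) \<bullet> v + c * ((u - x) \<bullet> (u - x))) * mollifier_aux x s u
       - CARD('n) * c * mollifier x s u)) = (LINT u|lebesgue_on U. - (\<Sum>j\<in>UNIV. f u * partial_deriv j (\<phi> j) u))"
    unfolding sum1 by (simp add: sum_distrib_left)
  also have "\<dots> = - (\<Sum>j\<in>UNIV. LINT u|lebesgue_on U. f u * partial_deriv j (\<phi> j) u)"
    using int1 by simp
  also have "\<dots> = (\<Sum>j\<in>UNIV. LINT u|lebesgue_on U. g u $ j * \<phi> j u)"
    using wg test by (simp add: weak_grad_def sum_negf)
  also have "\<dots> = (LINT u|lebesgue_on U. (g u \<bullet> (v + c *\<^sub>R (u - x))) * mollifier x s u)"
    unfolding sum2 using int2 by simp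
  finally show ?thesis .
qed

lemma continuous_on_path_kernel:
  fixes f :: "real^'n \<Rightarrow> real" and a v :: "real^'n" and s0 \<rho> :: real
  assumes f2: "continuous_on (U \<times> cbox c d) (\<lambda>p. f (snd p))"
    and nz: "\<And>p. p \<in> U \<times> cbox c d \<Longrightarrow> s0 + fst p * \<rho> \<noteq> 0"
    and bm: "bump_mass TYPE('n) \<noteq> 0"
  shows "continuous_on (U \<times> cbox c d) (\<lambda>p. f (snd p) *
         (((snd p - (a + fst p *\<^sub>R v)) \<bullet> v + \<rho> / (s0 + fst p * \<rho>) * ((snd p - (a + fst p *\<^sub>R v)) \<bullet> (snd p - (a + fst p *\<^sub>R v)))) * mollifier_aux (a + fst p *\<^sub>R v) (s0 + fst p * \<rho>) (snd p)
       - CARD('n) * (\<rho> / (s0 + fst p * \<rho>)) * mollifier (a + fst p *\<^sub>R v) (s0 + fst p * \<rho>) (snd p)))"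
  unfolding mollifier_def mollifier_aux_def
  by (intro continuous_intros f2 ballI) (simp_all only: nz bm mult_eq_0_iff power_eq_0_iff simp_thms)

text \<open>The parameter occurs in the kernel alone, so continuity of \<open>f\<close> suffices for
  differentiating under the integral; \<open>weak_grad_test_sum\<close> then replaces
  \<open>f\<close> by its weak gradient. The fixed box contains all supports, so the domain of
  integration does not move.\<close>

lemma mollification_path_derivative:
  fixes f :: "real^'n \<Rightarrow> real" and a v :: "real^'n" and s0 \<rho> t0 :: real
  assumes "open \<Omega>" and wg: "weak_grad \<Omega> f g" and cont: "continuous_on \<Omega> f"
    and Q: "cbox c d \<subseteq> \<Omega>" and U: "open U" "convex U" "t0 \<in> U"
    and pos: "\<And>t. t \<in> U \<Longrightarrow> s0 + t * \<rho> > 0"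
    and sub: "\<And>t. t \<in> U \<Longrightarrow> cball (a + t *\<^sub>R v) (s0 + t * \<rho>) \<subseteq> cbox c d"
  defines "x \<equiv> a + t0 *\<^sub>R v" and "s \<equiv> s0 + t0 * \<rho>"
  shows "((\<lambda>t. LINT u|lebesgue_on \<Omega>. f u * mollifier (a + t *\<^sub>R v) (s0 + t * \<rho>) u) has_real_derivative
      (LINT u|lebesgue_on \<Omega>. (g u \<bullet> (v + (\<rho> / s) *\<^sub>R (u - x))) * mollifier x s u)) (at t0)"
proof -
  define X where "X t = a + t *\<^sub>R v" for t
  define S where "S t = s0 + t * \<rho>" for t
  have S: "S t > 0" if "t \<in> U" for t using pos that by (simp add: S_def)
  have B: "cball (X t) (S t) \<subseteq> cbox c d" if "t \<in> U" for t using sub that by (simp add: S_def X_def)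
  define D where "D t u = ((u - X t) \<bullet> v + \<rho> / S t * ((u - X t) \<bullet> (u - X t))) * mollifier_aux (X t) (S t) u
       - CARD('n) * (\<rho> / S t) * mollifier (X t) (S t) u" for t u
  have fQ: "continuous_on (cbox c d) f" using cont Q continuous_on_subset by blast
  have contD: "continuous_on (U \<times> cbox c d) (\<lambda>(t, u). f u * D t u)"
  proof -
    have f2: "continuous_on (U \<times> cbox c d) (\<lambda>p. f (snd p))"
      by (rule continuous_on_compose2[OF fQ]) (auto intro: continuous_intros)
    have nz: "s0 + fst p * \<rho> \<noteq> 0" if "p \<in> U \<times> cbox c d" for p
      using pos[of "fst p"] that by (auto simp: mem_Times_iff)
    have bm: "bump_mass TYPE('n) \<noteq> 0"
      using bump_mass_pos[where 'n='n] by simp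
    show ?thesis
      unfolding D_def X_def S_def split_beta by (rule continuous_on_path_kernel[OF f2 nz bm])
  qed
  have der: "((\<lambda>t. f u * mollifier (X t) (S t) u) has_field_derivative f u * D t u) (at t within U)"
    if "t \<in> U" for t u
  proof -
    have p: "s0 + t * \<rho> > 0" by (rule pos[OF that])
    have D: "((\<lambda>t. mollifier (X t) (S t) u) has_real_derivative D t u) (at t)"
      using mollifier_path_derivative[OF p, of a v u] unfolding D_def X_def S_def by simp
    show ?thesis by (rule has_field_derivative_at_within[OF DERIV_cmult[OF D]])
  qed
  have "((\<lambda>t. integral (cbox c d) (\<lambda>u. f u * mollifier (X t) (S t) u)) has_real_derivative
      integral (cbox c d) (\<lambda>u. f u * D t0 u)) (at t0 within U)"
  proof (rule leibniz_rule_field_derivative[where f = "\<lambda>t u. f u * mollifier (X t) (S t) u"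
        and fx = "\<lambda>t u. f u * D t u", OF _ _ contD \<open>t0 \<in> U\<close> \<open>convex U\<close>])
    show "((\<lambda>t. f u * mollifier (X t) (S t) u) has_field_derivative f u * D t u) (at t within U)"
      if "t \<in> U" for t u using that by (rule der)
    show "(\<lambda>u. f u * mollifier (X t) (S t) u) integrable_on cbox c d" if "t \<in> U" for t
      by (rule integrable_continuous[OF continuous_on_mult[OF fQ continuous_on_mollifier[OF S[OF that]]]])
  qed
  then have 1: "((\<lambda>t. integral (cbox c d) (\<lambda>u. f u * mollifier (X t) (S t) u)) has_real_derivative
      integral (cbox c d) (\<lambda>u. f u * D t0 u)) (at t0)"
    unfolding at_within_open[OF \<open>t0 \<in> U\<close> \<open>open U\<close>] .
  have out: "u \<notin> ball (X t) (S t)" if "t \<in> U" "u \<in> \<Omega> - cbox c d" for u t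
    using B[OF that(1)] that(2) ball_subset_cball[of "X t" "S t"] by blast
  have eq: "integral (cbox c d) (\<lambda>u. f u * mollifier (X t) (S t) u) =
      (LINT u|lebesgue_on \<Omega>. f u * mollifier (X t) (S t) u)" if "t \<in> U" for t
  proof (rule LINT_restrict_cbox[symmetric, OF \<open>open \<Omega>\<close> Q])
    show "continuous_on (cbox c d) (\<lambda>u. f u * mollifier (X t) (S t) u)"
      by (rule continuous_on_mult[OF fQ continuous_on_mollifier[OF S[OF that]]])
    show "f u * mollifier (X t) (S t) u = 0" if u: "u \<in> \<Omega> - cbox c d" for u
      using mollifier_eq_0[OF S[OF \<open>t \<in> U\<close>] out[OF \<open>t \<in> U\<close> u]] by simp
  qed
  have 2: "((\<lambda>t. LINT u|lebesgue_on \<Omega>. f u * mollifier (X t) (S t) u) has_real_derivative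
      integral (cbox c d) (\<lambda>u. f u * D t0 u)) (at t0)"
    by (rule has_field_derivative_transform_within_open[OF 1 \<open>open U\<close> \<open>t0 \<in> U\<close>]) (rule eq)
  have "integral (cbox c d) (\<lambda>u. f u * D t0 u) = (LINT u|lebesgue_on \<Omega>. f u * D t0 u)"
  proof (rule LINT_restrict_cbox[symmetric, OF \<open>open \<Omega>\<close> Q])
    have "continuous_on (cbox c d) ((\<lambda>(t, u). f u * D t u) \<circ> Pair t0)"
      using U by (intro continuous_on_compose continuous_on_subset[OF contD] continuous_intros) auto
    then show "continuous_on (cbox c d) (\<lambda>u. f u * D t0 u)" by (simp add: o_def)
    show "f u * D t0 u = 0" if u: "u \<in> \<Omega> - cbox c d" for u
      using mollifier_eq_0[OF S[OF U(3)] out[OF U(3) u]] mollifier_aux_eq_0[OF S[OF U(3)] out[OF U(3) u]]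
      by (simp add: D_def)
  qed
  also have "\<dots> = (LINT u|lebesgue_on \<Omega>. (g u \<bullet> (v + (\<rho> / s) *\<^sub>R (u - x))) * mollifier x s u)"
    using weak_grad_test_sum[OF \<open>open \<Omega>\<close> wg, of s x v "\<rho> / s"] S[OF \<open>t0 \<in> U\<close>] B[OF \<open>t0 \<in> U\<close>] Q
    unfolding D_def X_def S_def x_def s_def by auto
  finally show ?thesis using 2 by (simp add: X_def S_def)
qed

lemma mollifier_average_close:
  fixes f :: "real^'n \<Rightarrow> real"
  assumes "open U" "f locally_integrable_on U" "s > 0" "cball x s \<subseteq> U"
    and close: "\<And>u. u \<in> ball x s \<Longrightarrow> \<bar>f u - b\<bar> \<le> e"
  shows "\<bar>(LINT u|lebesgue_on U. f u * mollifier x s u) - b\<bar> \<le> e"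
proof -
  note m = integral_mollifier[OF assms(3,1,4)]
  have i: "integrable (lebesgue_on U) (\<lambda>u. f u * mollifier x s u)"
    by (rule integrable_mult_compact_support[OF assms(1,2) continuous_on_mollifier _ assms(4)])
      (use assms(3) mollifier_eq_0[of s _ x] in auto)
  have "(LINT u|lebesgue_on U. f u * mollifier x s u) - b =
      (LINT u|lebesgue_on U. f u * mollifier x s u - b * mollifier x s u)"
    using m i by simp
  also have "\<bar>\<dots>\<bar> \<le> (LINT u|lebesgue_on U. e * mollifier x s u)"
    unfolding real_norm_def[symmetric]
  proof (rule Bochner_Integration.integral_norm_bound_integral)
    show "norm (f u * mollifier x s u - b * mollifier x s u) \<le> e * mollifier x s u" for u
    proof (cases "u \<in> ball x s")
      case True
      have "norm (f u * mollifier x s u - b * mollifier x s u) = \<bar>f u - b\<bar> * mollifier x s u"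
        using mollifier_nonneg[OF assms(3), of x u] by (simp add: abs_mult flip: left_diff_distrib)
      also have "\<dots> \<le> e * mollifier x s u"
        using close[OF True] mollifier_nonneg[OF assms(3)] by (rule mult_right_mono)
      finally show ?thesis .
    next
      case False
      then show ?thesis using mollifier_eq_0[OF assms(3), of u x] by simp
    qed
  qed (use m i in auto)
  also have "\<dots> = e" using m by simp
  finally show ?thesis .
qed

subsection \<open>Weak gradients and differentiability\<close>

lemma locally_integrable_imp_measurable:
  fixes h :: "real^'n \<Rightarrow> 'b::euclidean_space"
  assumes "open U" "h locally_integrable_on U"
  shows "h \<in> borel_measurable (lebesgue_on U)"
proof -
  obtain D where D: "countable D" "D \<subseteq> Pow U" "\<And>X. X \<in> D \<Longrightarrow> \<exists>a b. X = cbox a b" "\<Union>D = U"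
    by (rule open_countable_Union_open_cbox[OF assms(1)]) (rule that)
  have X: "X \<subseteq> U" "compact X" "X \<in> sets lebesgue" if "X \<in> D" for X
    using D(2,3) that by (auto, metis compact_cbox, metis cbox_borel sets_completionI_sets sets_lborel)
  show ?thesis
  proof (rule measurable_piecewise_restrict[OF D(1)])
    fix X assume "X \<in> D"
    note X = X[OF this]
    show "X \<inter> space (lebesgue_on U) \<in> sets (lebesgue_on U)"
      using X assms(1) by (auto simp: sets_restrict_space)
    have "h absolutely_integrable_on X"
      using assms(2) X by (auto simp: locally_integrable_on_def)
    then have "h \<in> borel_measurable (lebesgue_on X)"
      by (intro integrable_imp_measurable set_lebesgue_integral_eq_integral(1))
    then show "h \<in> borel_measurable (restrict_space (lebesgue_on U) X)"
      using X assms(1) by (simp add: restrict_restrict_space Int_absorb1)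
  qed (use D(4) in auto)
qed

text \<open>By translation invariance the integral of the shift of \<psi> by
  \<open>t *\<^sub>R e\<close> is constant in \<open>t\<close>; its derivative at 0 is the integral
  in question.\<close>

lemma integral_partial_deriv_eq_0:
  fixes \<psi> :: "real^'n \<Rightarrow> real"
  assumes der: "\<And>x. (\<psi> has_derivative D x) (at x)" and cont: "continuous_on UNIV (\<lambda>x. D x e)"
    and C: "compact C" and 0: "\<And>x. x \<notin> C \<Longrightarrow> \<psi> x = 0" "\<And>x. x \<notin> C \<Longrightarrow> D x e = 0"
  shows "(LINT x|lebesgue. D x e) = 0"
proof -
  obtain B where B: "\<And>x. x \<in> C \<Longrightarrow> norm x \<le> B"
    using compact_imp_bounded[OF C] by (auto simp: bounded_iff)
  \<comment> \<open>The margin \<open>norm e\<close> keeps every shift with |t| < 1 supported inside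
    the box.\<close>
  obtain c d :: "real^'n" where cd: "cball 0 (B + norm e) \<subseteq> cbox c d"
    using bounded_subset_cbox_symmetric[OF bounded_cball] by metis
  have out: "u + t *\<^sub>R e \<notin> C" if "u \<notin> cbox c d" "t \<in> {-1<..<1}" for u t
  proof
    assume "u + t *\<^sub>R e \<in> C"
    then have "norm (u + t *\<^sub>R e) \<le> B" by (rule B)
    moreover have "norm u \<le> norm (u + t *\<^sub>R e) + norm (t *\<^sub>R e)"
      using norm_triangle_ineq4[of "u + t *\<^sub>R e" "t *\<^sub>R e"] by simp
    moreover have "norm (t *\<^sub>R e) \<le> norm e"
      using mult_right_mono[of "\<bar>t\<bar>" 1 "norm e"] that(2) by auto
    ultimately have "u \<in> cball 0 (B + norm e)" by simp
    then show False using cd that(1) by blast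
  qed
  have cont\<psi>: "continuous_on UNIV \<psi>"
    using der by (auto intro!: continuous_at_imp_continuous_on dest: has_derivative_continuous)
  then have [measurable]: "\<psi> \<in> borel_measurable borel" by (rule borel_measurable_continuous_onI)
  have shift: "integral (cbox c d) (\<lambda>u. \<psi> (u + t *\<^sub>R e)) = (LINT u|lborel. \<psi> u)" if "t \<in> {-1<..<1}" for t
  proof -
    have "integral (cbox c d) (\<lambda>u. \<psi> (u + t *\<^sub>R e)) = (LINT u|lebesgue_on UNIV. \<psi> (u + t *\<^sub>R e))"
    proof (rule LINT_restrict_cbox[symmetric])
      show "continuous_on (cbox c d) (\<lambda>u. \<psi> (u + t *\<^sub>R e))"
        by (rule continuous_on_compose2[OF cont\<psi>]) (auto intro: continuous_intros)
      show "\<psi> (u + t *\<^sub>R e) = 0" if u: "u \<in> UNIV - cbox c d" for u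
        by (rule 0(1)[OF out]) (use u \<open>t \<in> _\<close> in auto)
    qed auto
    also have "\<dots> = (LINT u|lborel. \<psi> (u + t *\<^sub>R e))"
    proof -
      have "(\<lambda>u. \<psi> (u + t *\<^sub>R e)) \<in> borel_measurable lborel" by measurable
      from integral_completion[OF this] show ?thesis by (simp add: lebesgue_on_UNIV_eq)
    qed
    also have "\<dots> = (LINT u|distr lborel borel ((+) (t *\<^sub>R e)). \<psi> u)"
      by (subst integral_distr) (auto simp: add.commute)
    also have "\<dots> = (LINT u|lborel. \<psi> u)"
      by (simp add: lborel_distr_plus)
    finally show ?thesis .
  qed
  have path: "((\<lambda>t. \<psi> (u + t *\<^sub>R e)) has_real_derivative D (u + t *\<^sub>R e) e) (at t within {-1<..<1})" for u t
  proof -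
    have lin: "linear (D (u + t *\<^sub>R e))" using has_derivative_linear[OF der] .
    have l: "((\<lambda>t. u + t *\<^sub>R e) has_derivative (\<lambda>h. h *\<^sub>R e)) (at t)"
      by (auto intro!: derivative_eq_intros)
    have "((\<lambda>t. \<psi> (u + t *\<^sub>R e)) has_derivative (\<lambda>h. D (u + t *\<^sub>R e) (h *\<^sub>R e))) (at t)"
      by (rule has_derivative_compose[OF l der])
    then have "((\<lambda>t. \<psi> (u + t *\<^sub>R e)) has_real_derivative D (u + t *\<^sub>R e) e) (at t)"
      by (simp add: has_field_derivative_def linear_cmul[OF lin] mult.commute[of _ "D _ _"])
    then show ?thesis by (rule has_field_derivative_at_within)
  qed
  have "((\<lambda>t. integral (cbox c d) (\<lambda>u. \<psi> (u + t *\<^sub>R e))) has_real_derivative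
      integral (cbox c d) (\<lambda>u. D (u + 0 *\<^sub>R e) e)) (at 0 within {-1<..<1})"
  proof (rule leibniz_rule_field_derivative[where f = "\<lambda>t u. \<psi> (u + t *\<^sub>R e)"
        and fx = "\<lambda>t u. D (u + t *\<^sub>R e) e", OF path])
    show "(\<lambda>u. \<psi> (u + t *\<^sub>R e)) integrable_on cbox c d" for t
      by (rule integrable_continuous, rule continuous_on_compose2[OF cont\<psi>]) (auto intro: continuous_intros)
    show "continuous_on ({-1<..<1} \<times> cbox c d) (\<lambda>(t, u). D (u + t *\<^sub>R e) e)"
      unfolding split_beta by (rule continuous_on_compose2[OF cont]) (auto intro!: continuous_intros)
  qed auto
  then have 1: "((\<lambda>t. integral (cbox c d) (\<lambda>u. \<psi> (u + t *\<^sub>R e))) has_real_derivative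
      integral (cbox c d) (\<lambda>u. D u e)) (at 0)"
    by (simp add: at_within_open[of "0::real" "{-1<..<1}"])
  have 2: "((\<lambda>t. LINT u|lborel. \<psi> u) has_real_derivative integral (cbox c d) (\<lambda>u. D u e)) (at 0)"
    by (rule has_field_derivative_transform_within_open[OF 1, of "{-1<..<1}"]) (use shift in auto)
  have "(LINT x|lebesgue. D x e) = (LINT x|lebesgue_on UNIV. D x e)" by (simp add: lebesgue_on_UNIV_eq)
  also have "\<dots> = integral (cbox c d) (\<lambda>u. D u e)"
  proof (rule LINT_restrict_cbox)
    show "continuous_on (cbox c d) (\<lambda>u. D u e)" using cont continuous_on_subset by blast
    show "D u e = 0" if "u \<in> UNIV - cbox c d" for u
      using out[of u 0] 0(2) that by simp
  qed auto
  also have "\<dots> = 0" using DERIV_unique[OF 2 DERIV_const] .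
  finally show ?thesis .
qed

text \<open>By the product rule the two sides differ by the integral of a partial derivative of a
  compactly supported function. Subtracting such an affine function makes the gradient small in mean
  near a Lebesgue point.\<close>

lemma weak_grad_affine:
  fixes v :: "real^'n"
  assumes "open U"
  shows "weak_grad U (\<lambda>x. v \<bullet> x + b) (\<lambda>x. v)"
  unfolding weak_grad_def
proof (intro conjI allI impI)
  have cont: "continuous_on S (\<lambda>x. v \<bullet> x + b)" for S by (intro continuous_intros)
  show loc: "(\<lambda>x. v \<bullet> x + b) locally_integrable_on U" "(\<lambda>x. v) locally_integrable_on U"
    by (intro continuous_imp_locally_integrable_on cont continuous_on_const)+
  fix \<phi> :: "real^'n \<Rightarrow> real" and j assume \<phi>: "test_function U \<phi>"
  show "(LINT x|lebesgue_on U. (v \<bullet> x + b) * partial_deriv j \<phi> x) = - (LINT x|lebesgue_on U. v $ j * \<phi> x)"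
  proof (rule test_functionD[OF \<phi>])
    fix C assume C: "compact C" "C \<subseteq> U" "\<And>x. x \<notin> C \<Longrightarrow> \<phi> x = 0"
      "\<And>x j. x \<notin> C \<Longrightarrow> partial_deriv j \<phi> x = 0" "\<And>x. \<phi> differentiable at x"
      "continuous_on UNIV \<phi>" "\<And>j. continuous_on UNIV (partial_deriv j \<phi>)"
    define D where "D x h = (v \<bullet> x + b) * frechet_derivative \<phi> (at x) h + (v \<bullet> h) * \<phi> x" for x h
    have D: "D x (axis j 1) = (v \<bullet> x + b) * partial_deriv j \<phi> x + v $ j * \<phi> x" for x
      by (simp add: D_def partial_deriv_def inner_axis)
    have l: "((\<lambda>x. v \<bullet> x + b) has_derivative (\<lambda>h. v \<bullet> h)) (at x)" for x
      by (auto intro!: derivative_eq_intros)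
    have "(LINT x|lebesgue. D x (axis j 1)) = 0"
    proof (rule integral_partial_deriv_eq_0[OF _ _ C(1)])
      show "((\<lambda>x. (v \<bullet> x + b) * \<phi> x) has_derivative D x) (at x)" for x
        using has_derivative_mult[OF l frechet_derivative_works[THEN iffD1, OF C(5)]] by (simp add: D_def[abs_def])
      show "continuous_on UNIV (\<lambda>x. D x (axis j 1))"
        unfolding D by (intro continuous_on_add continuous_on_mult cont C(6,7) continuous_on_const)
      show "(v \<bullet> x + b) * \<phi> x = 0" "D x (axis j 1) = 0" if "x \<notin> C" for x
        using C(3,4)[OF that] by (simp_all add: D)
    qed
    moreover have "(\<lambda>x. indicator U x *\<^sub>R D x (axis j 1)) = (\<lambda>x. D x (axis j 1))"
    proof
      show "indicator U x *\<^sub>R D x (axis j 1) = D x (axis j 1)" for x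
        using C(2) C(3,4)[of x] by (cases "x \<in> C") (auto simp: D)
    qed
    ultimately have "(LINT x|lebesgue_on U. D x (axis j 1)) = 0"
      using assms by (subst integral_restrict_space) (simp, simp only:)
    moreover have "(LINT x|lebesgue_on U. D x (axis j 1)) =
        (LINT x|lebesgue_on U. (v \<bullet> x + b) * partial_deriv j \<phi> x) + (LINT x|lebesgue_on U. v $ j * \<phi> x)"
      unfolding D
      by (intro Bochner_Integration.integral_add integrable_mult_test_function[OF assms _ \<phi>] loc(1)
          continuous_imp_locally_integrable_on continuous_on_const)
    ultimately show ?thesis by simp
  qed
qed

lemma weak_grad_diff:
  assumes "open U" "weak_grad U f g" "weak_grad U f' g'"
  shows "weak_grad U (\<lambda>x. f x - f' x) (\<lambda>x. g x - g' x)"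
  unfolding weak_grad_def
proof (intro conjI allI impI)
  have loc: "f locally_integrable_on U" "g locally_integrable_on U"
    "f' locally_integrable_on U" "g' locally_integrable_on U"
    using assms by (auto simp: weak_grad_def)
  then show "(\<lambda>x. f x - f' x) locally_integrable_on U" "(\<lambda>x. g x - g' x) locally_integrable_on U"
    unfolding locally_integrable_on_def by (auto intro: set_integral_diff(1))
  note locj = locally_integrable_on_linear[OF bounded_linear_vec_nth loc(2)]
    locally_integrable_on_linear[OF bounded_linear_vec_nth loc(4)]
  fix \<phi> j assume \<phi>: "test_function U \<phi>"
  have "(LINT x|lebesgue_on U. (f x - f' x) * partial_deriv j \<phi> x) =
    (LINT x|lebesgue_on U. f x * partial_deriv j \<phi> x) - (LINT x|lebesgue_on U. f' x * partial_deriv j \<phi> x)"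
    unfolding left_diff_distrib
    by (intro Bochner_Integration.integral_diff integrable_mult_test_function[OF assms(1) _ \<phi>] loc)
  moreover have "(LINT x|lebesgue_on U. (g x - g' x) $ j * \<phi> x) =
    (LINT x|lebesgue_on U. g x $ j * \<phi> x) - (LINT x|lebesgue_on U. g' x $ j * \<phi> x)"
    unfolding left_diff_distrib vector_minus_component
    by (intro Bochner_Integration.integral_diff integrable_mult_test_function[OF assms(1) _ \<phi>] locj)
  ultimately show "(LINT x|lebesgue_on U. (f x - f' x) * partial_deriv j \<phi> x) =
      - (LINT x|lebesgue_on U. (g x - g' x) $ j * \<phi> x)"
    using assms(2,3) \<phi> by (simp add: weak_grad_def)
qed

text \<open>Replaces Hoelder's inequality in the Morrey estimate: with \<open>lam\<close> proportional to \<open>t powr (- n / p)\<close>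
  both summands have the same integrable singularity at \<open>t = 0\<close>.\<close>

lemma le_plus_powr:
  fixes k lam p :: real
  assumes "lam > 0" "k \<ge> 0" "p \<ge> 1"
  shows "k \<le> lam + lam powr (1 - p) * k powr p"
proof (cases "k \<le> lam")
  case True
  then show ?thesis by (simp add: add_increasing2)
next
  case False
  then have "1 \<le> (k / lam) powr (p - 1)" using assms by (intro ge_one_powr_ge_zero) auto
  then have "k * 1 \<le> k * (k / lam) powr (p - 1)" using assms by (intro mult_left_mono) auto
  also have "\<dots> = lam powr (1 - p) * k powr p"
  proof -
    have "(k / lam) powr (p - 1) = k powr (p - 1) * lam powr (1 - p)"
      using assms powr_minus_divide[of lam "p - 1"] by (simp add: powr_divide)
    then show ?thesis
      using assms powr_mult_base[of k "p - 1"] by (simp add: mult_ac)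
  qed
  finally show ?thesis using assms by simp
qed

text \<open>\<open>le_plus_powr\<close> splits the integrand. The constant \<open>lam\<close> is
  integrated against a kernel of mass 1, while the p-th power meets the supremum of the
  kernel.\<close>

lemma mollifier_integral_bound:
  fixes k :: "real^'n \<Rightarrow> real"
  assumes U: "open U" and k: "k locally_integrable_on U" and s: "s > 0" "cball x s \<subseteq> U"
    and p: "p \<ge> 1" and "lam > 0" and "B \<ge> 0"
    and B: "(\<integral>\<^sup>+u\<in>ball x s. ennreal (\<bar>k u\<bar> powr p) \<partial>lebesgue) \<le> ennreal B"
  shows "(LINT u|lebesgue_on U. \<bar>k u\<bar> * mollifier x s u) \<le>
    lam + lam powr (1 - p) * (B / (s ^ CARD('n) * bump_mass TYPE('n)))"
proof -
  define M where "M = 1 / (s ^ CARD('n) * bump_mass TYPE('n))"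
  have "M \<ge> 0" using s bump_mass_pos[where 'n='n] by (simp add: M_def less_imp_le)
  note m = integral_mollifier[OF s(1) U s(2)]
  note m0 = mollifier_nonneg[OF s(1)]
  have k_meas[measurable]: "k \<in> borel_measurable (lebesgue_on U)"
    by (rule locally_integrable_imp_measurable[OF U k])
  have m_meas[measurable]: "mollifier x s \<in> borel_measurable (lebesgue_on U)" using m(1) by simp
  have b_meas[measurable]: "ball x s \<in> sets (lebesgue_on U)"
    using s U ball_subset_cball[of x s] by (subst sets_restrict_space_iff) auto
  have "integrable (lebesgue_on U) (\<lambda>u. k u * mollifier x s u)"
    by (rule integrable_mult_compact_support[OF U k continuous_on_mollifier _ s(2)])
      (use s mollifier_eq_0[of s _ x] in auto)
  then have "integrable (lebesgue_on U) (\<lambda>u. \<bar>k u\<bar> * mollifier x s u)"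
    using integrable_abs[of "lebesgue_on U" "\<lambda>u. k u * mollifier x s u"]
    by (simp add: abs_mult abs_of_nonneg[OF m0])
  then have "ennreal (LINT u|lebesgue_on U. \<bar>k u\<bar> * mollifier x s u) =
      (\<integral>\<^sup>+u. ennreal (\<bar>k u\<bar> * mollifier x s u) \<partial>lebesgue_on U)"
    using m0 by (intro nn_integral_eq_integral[symmetric] AE_I2 mult_nonneg_nonneg) auto
  also have "\<dots> \<le> (\<integral>\<^sup>+u. ennreal lam * ennreal (mollifier x s u) +
      ennreal (lam powr (1 - p) * M) * (ennreal (\<bar>k u\<bar> powr p) * indicator (ball x s) u) \<partial>lebesgue_on U)"
  proof (intro nn_integral_mono)
    fix u
    show "ennreal (\<bar>k u\<bar> * mollifier x s u) \<le> ennreal lam * ennreal (mollifier x s u) +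
      ennreal (lam powr (1 - p) * M) * (ennreal (\<bar>k u\<bar> powr p) * indicator (ball x s) u)"
    proof (cases "u \<in> ball x s")
      case True
      have "\<bar>k u\<bar> * mollifier x s u \<le> (lam + lam powr (1 - p) * \<bar>k u\<bar> powr p) * mollifier x s u"
        using le_plus_powr[OF \<open>lam > 0\<close> _ p, of "\<bar>k u\<bar>"] m0 by (intro mult_right_mono) auto
      also have "\<dots> = lam * mollifier x s u + lam powr (1 - p) * \<bar>k u\<bar> powr p * mollifier x s u"
        by (simp add: distrib_right)
      also have "\<dots> \<le> lam * mollifier x s u + lam powr (1 - p) * \<bar>k u\<bar> powr p * M"
        using mollifier_le[OF s(1), of x u] by (intro add_left_mono mult_left_mono) (auto simp: M_def)
      finally have "\<bar>k u\<bar> * mollifier x s u \<le> lam * mollifier x s u + lam powr (1 - p) * M * \<bar>k u\<bar> powr p"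
        by (simp add: mult_ac)
      then have "ennreal (\<bar>k u\<bar> * mollifier x s u) \<le>
          ennreal (lam * mollifier x s u + lam powr (1 - p) * M * \<bar>k u\<bar> powr p)" by (rule ennreal_leI)
      also have "\<dots> = ennreal lam * ennreal (mollifier x s u) + ennreal (lam powr (1 - p) * M) * ennreal (\<bar>k u\<bar> powr p)"
        using \<open>lam > 0\<close> \<open>M \<ge> 0\<close> m0[of x u] by (subst ennreal_plus) (auto simp: ennreal_mult)
      finally show ?thesis using True by simp
    next
      case False
      then show ?thesis using mollifier_eq_0[OF s(1), of u x] by simp
    qed
  qed
  also have "\<dots> = (\<integral>\<^sup>+u. ennreal lam * ennreal (mollifier x s u) \<partial>lebesgue_on U) +
      (\<integral>\<^sup>+u. ennreal (lam powr (1 - p) * M) * (ennreal (\<bar>k u\<bar> powr p) * indicator (ball x s) u) \<partial>lebesgue_on U)"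
    by (rule nn_integral_add) measurable
  also have "(\<integral>\<^sup>+u. ennreal lam * ennreal (mollifier x s u) \<partial>lebesgue_on U) = ennreal lam"
    by (subst nn_integral_cmult, measurable) (simp add: nn_integral_eq_integral[OF m(1)] m0 m(2))
  also have "(\<integral>\<^sup>+u. ennreal (lam powr (1 - p) * M) * (ennreal (\<bar>k u\<bar> powr p) * indicator (ball x s) u) \<partial>lebesgue_on U)
      = ennreal (lam powr (1 - p) * M) * (\<integral>\<^sup>+u. ennreal (\<bar>k u\<bar> powr p) * indicator (ball x s) u \<partial>lebesgue_on U)"
    by (rule nn_integral_cmult) measurable
  also have "(\<integral>\<^sup>+u. ennreal (\<bar>k u\<bar> powr p) * indicator (ball x s) u \<partial>lebesgue_on U) =
      (\<integral>\<^sup>+u\<in>ball x s. ennreal (\<bar>k u\<bar> powr p) \<partial>lebesgue)"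
  proof -
    have "u \<in> U" if "u \<in> ball x s" for u
      using that s(2) ball_subset_cball[of x s] by blast
    then show ?thesis
      using U by (subst nn_integral_restrict_space) (auto intro!: nn_integral_cong simp: indicator_def)
  qed
  also have "ennreal lam + ennreal (lam powr (1 - p) * M) * \<dots> \<le>
      ennreal lam + ennreal (lam powr (1 - p) * M) * ennreal B"
    using B by (intro add_left_mono mult_left_mono) auto
  also have "\<dots> = ennreal (lam + lam powr (1 - p) * M * B)"
    using \<open>lam > 0\<close> \<open>M \<ge> 0\<close> \<open>B \<ge> 0\<close> by (subst ennreal_plus) (auto simp: ennreal_mult)
  finally have "(LINT u|lebesgue_on U. \<bar>k u\<bar> * mollifier x s u) \<le> lam + lam powr (1 - p) * M * B"
    using \<open>lam > 0\<close> \<open>M \<ge> 0\<close> \<open>B \<ge> 0\<close> by (subst (asm) ennreal_le_iff) auto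
  then show ?thesis by (simp add: M_def mult_ac)
qed

lemma nn_integral_locally_integrable:
  fixes h :: "real^'n \<Rightarrow> 'b::euclidean_space"
  assumes "h locally_integrable_on U" "compact C" "C \<subseteq> U"
  shows "(\<integral>\<^sup>+u\<in>C. ennreal (norm (h u) powr 1) \<partial>lebesgue) < \<infinity>"
proof -
  have "integrable lebesgue (\<lambda>u. indicator C u *\<^sub>R h u)"
    using assms by (auto simp: locally_integrable_on_def set_integrable_def)
  then have "(\<integral>\<^sup>+u. ennreal (norm (indicator C u *\<^sub>R h u)) \<partial>lebesgue) < \<infinity>"
    by (simp add: integrable_iff_bounded)
  also have "(\<integral>\<^sup>+u. ennreal (norm (indicator C u *\<^sub>R h u)) \<partial>lebesgue) =
      (\<integral>\<^sup>+u\<in>C. ennreal (norm (h u) powr 1) \<partial>lebesgue)"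
    by (intro nn_integral_cong) (simp add: indicator_def)
  finally show ?thesis .
qed

section \<open>Mollified integrals, separation by test functions, uniqueness of weak
  gradients\<close>

lemma locally_integrable_on_const: "(\<lambda>x. c) locally_integrable_on U"
  by (intro continuous_imp_locally_integrable_on continuous_on_const)

lemma locally_integrable_on_diff:
  "f locally_integrable_on U \<Longrightarrow> g locally_integrable_on U \<Longrightarrow> (\<lambda>x. f x - g x) locally_integrable_on U"
  unfolding locally_integrable_on_def by (auto intro: set_integral_diff(1))

lemma test_function_mollifier:
  fixes x :: "real^'n"
  assumes "s > 0" "cball x s \<subseteq> U"
  shows "test_function U (mollifier x s)"
  using test_function_mollifier_linear[OF assms, of 1 0 undefined] by simp

lemma integrable_mult_mollifier:
  fixes x :: "real^'n"
  assumes "open U" "h locally_integrable_on U" "s > 0" "cball x s \<subseteq> U"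
  shows "integrable (lebesgue_on U) (\<lambda>u. h u * mollifier x s u)"
  by (rule integrable_mult_test_function(1)[OF assms(1,2) test_function_mollifier[OF assms(3,4)]])

lemma abs_mollifier_integral_le:
  fixes x :: "real^'n"
  assumes "open U" "s > 0" and k: "k locally_integrable_on U" and "cball x s \<subseteq> U"
    and le: "AE u in lebesgue_on U. u \<in> ball x s \<longrightarrow> \<bar>h u\<bar> \<le> k u"
  shows "\<bar>LINT u|lebesgue_on U. h u * mollifier x s u\<bar> \<le> (LINT u|lebesgue_on U. k u * mollifier x s u)"
proof -
  have "AE u in lebesgue_on U. norm (h u * mollifier x s u) \<le> k u * mollifier x s u"
    using le
  proof eventually_elim
    case (elim u)
    then show ?case
      using mollifier_nonneg[OF assms(2), of x u] mollifier_eq_0[OF assms(2), of u x]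
      by (cases "u \<in> ball x s") (auto simp: abs_mult intro: mult_right_mono)
  qed
  note le' = this
  show ?thesis
  proof (cases "integrable (lebesgue_on U) (\<lambda>u. h u * mollifier x s u)")
    case True
    have "norm (LINT u|lebesgue_on U. h u * mollifier x s u) \<le>
        (LINT u|lebesgue_on U. norm (h u * mollifier x s u))"
      by (rule integral_norm_bound)
    also have "\<dots> \<le> (LINT u|lebesgue_on U. k u * mollifier x s u)"
      by (rule integral_mono_AE[OF integrable_norm[OF True] _ le'])
        (rule integrable_mult_mollifier[OF assms(1,3,2,4)])
    finally show ?thesis by simp
  next
    \<comment> \<open>A function that is not integrable has Bochner integral 0 by convention, so the
      bound reduces to nonnegativity of the right-hand side.\<close>
    case False
    have "AE u in lebesgue_on U. 0 \<le> k u * mollifier x s u"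
      using le' by eventually_elim (use norm_ge_zero order_trans in blast)
    then have "0 \<le> (LINT u|lebesgue_on U. k u * mollifier x s u)"
      by (rule integral_nonneg_AE)
    then show ?thesis using not_integrable_integral_eq[OF False] by simp
  qed
qed

text \<open>The fundamental lemma of the calculus of variations. Mollifiers centred at a Lebesgue
  point are test functions, and their averages of \<open>h\<close> converge to the value there as
  the radius shrinks.\<close>

lemma test_functions_separate:
  fixes h :: "real^'n \<Rightarrow> real"
  assumes U: "open U" and h: "h locally_integrable_on U"
    and test: "\<And>\<phi>. test_function U \<phi> \<Longrightarrow> (LINT u|lebesgue_on U. h u * \<phi> u) = 0"
  shows "\<exists>N. negligible N \<and> (\<forall>a\<in>U - N. h a = 0)"
proof -
  have "\<exists>N. negligible N \<and> (\<forall>a\<in>U - N. \<forall>e>0. \<exists>d>0. \<forall>r. 0 < r \<longrightarrow> r < d \<longrightarrow>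
    (\<integral>\<^sup>+u\<in>ball a r. ennreal (norm (h u - h a) powr 1) \<partial>lebesgue) \<le> ennreal (e * r ^ DIM(real^'n)))"
    by (rule lebesgue_points[OF U locally_integrable_imp_measurable[OF U h]])
      (use nn_integral_locally_integrable[OF h] in auto)
  then obtain N where N: "negligible N" "\<And>a e. a \<in> U - N \<Longrightarrow> e > 0 \<Longrightarrow> \<exists>d>0. \<forall>r. 0 < r \<longrightarrow> r < d \<longrightarrow>
    (\<integral>\<^sup>+u\<in>ball a r. ennreal (norm (h u - h a) powr 1) \<partial>lebesgue) \<le> ennreal (e * r ^ DIM(real^'n))"
    by (elim exE conjE) (simp only: Ball_def)
  have "h a = 0" if a: "a \<in> U - N" for a
  proof -
    have "\<bar>h a\<bar> \<le> \<epsilon>" if "\<epsilon> > 0" for \<epsilon>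
    proof -
      define m where "m = bump_mass TYPE('n)"
      have "m > 0" unfolding m_def by (rule bump_mass_pos)
      then have "\<epsilon> / 2 * m > 0" using that by simp
      from N(2)[OF a this] obtain d where d: "d > 0" "\<And>r. 0 < r \<Longrightarrow> r < d \<Longrightarrow>
        (\<integral>\<^sup>+u\<in>ball a r. ennreal (norm (h u - h a) powr 1) \<partial>lebesgue) \<le> ennreal (\<epsilon> / 2 * m * r ^ DIM(real^'n))"
        by (elim exE conjE) simp
      obtain d' where d': "d' > 0" "cball a d' \<subseteq> U"
        using a U open_contains_cball by blast
      define s where "s = min (d / 2) d'"
      have s: "s > 0" "s < d" "s \<le> d'" using d(1) d'(1) by (auto simp: s_def)
      have sub: "cball a s \<subseteq> U" using d'(2) s(3) by (meson subset_cball order_trans)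
      define k where "k u = h u - h a" for u
      have k: "k locally_integrable_on U"
        unfolding k_def by (rule locally_integrable_on_diff[OF h locally_integrable_on_const])
      have "(\<integral>\<^sup>+u\<in>ball a s. ennreal (\<bar>k u\<bar> powr 1) \<partial>lebesgue) \<le> ennreal (\<epsilon> / 2 * m * s ^ CARD('n))"
        using d(2)[OF s(1,2)] by (simp add: k_def)
      \<comment> \<open>The bound is used with p = 1 and \<open>lam = \<epsilon> / 2\<close>; the
        power of \<open>lam\<close> is then 1, and the Lebesgue point estimate was scaled by
        \<open>m\<close> so that the second summand is also \<open>\<epsilon> / 2\<close>.\<close>
      then have "(LINT u|lebesgue_on U. \<bar>k u\<bar> * mollifier a s u) \<le>
          \<epsilon> / 2 + (\<epsilon> / 2) powr (1 - 1) * (\<epsilon> / 2 * m * s ^ CARD('n) / (s ^ CARD('n) * m))"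
        unfolding m_def
        by (intro mollifier_integral_bound[OF U k s(1) sub]) (use that s \<open>m > 0\<close> in \<open>auto simp: m_def\<close>)
      also have "\<dots> = \<epsilon>" using that s \<open>m > 0\<close> by simp
      finally have 1: "(LINT u|lebesgue_on U. \<bar>k u\<bar> * mollifier a s u) \<le> \<epsilon>" .
      have "(LINT u|lebesgue_on U. k u * mollifier a s u) =
          (LINT u|lebesgue_on U. h u * mollifier a s u) - (LINT u|lebesgue_on U. h a * mollifier a s u)"
        unfolding k_def left_diff_distrib
        by (intro Bochner_Integration.integral_diff integrable_mult_mollifier[OF U _ s(1) sub]
            h locally_integrable_on_const)
      also have "\<dots> = - h a"
        using test[OF test_function_mollifier[OF s(1) sub]] integral_mollifier[OF s(1) U sub] by simp
      finally have "- h a = (LINT u|lebesgue_on U. k u * mollifier a s u)" by simp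
      then have "\<bar>h a\<bar> = \<bar>LINT u|lebesgue_on U. k u * mollifier a s u\<bar>" by linarith
      also have "\<dots> \<le> (LINT u|lebesgue_on U. \<bar>k u * mollifier a s u\<bar>)"
        by (rule integral_abs_bound)
      also have "\<dots> = (LINT u|lebesgue_on U. \<bar>k u\<bar> * mollifier a s u)"
        by (simp add: abs_mult abs_of_nonneg[OF mollifier_nonneg[OF s(1)]])
      finally show ?thesis using 1 by simp
    qed
    then show ?thesis using field_le_epsilon[of "\<bar>h a\<bar>" 0] by simp
  qed
  with N(1) show ?thesis by blast
qed

lemma weak_grad_unique:
  assumes U: "open U" and "weak_grad U f g" "weak_grad U f g'"
  shows "\<exists>N. negligible N \<and> (\<forall>a\<in>U - N. g a = g' a)"
proof -
  note w = weak_grad_diff[OF assms]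
  have "\<exists>N. negligible N \<and> (\<forall>a\<in>U - N. (g a - g' a) $ j = 0)" for j
  proof (rule test_functions_separate[OF U])
    show "(\<lambda>a. (g a - g' a) $ j) locally_integrable_on U"
      using w by (intro locally_integrable_on_linear[OF bounded_linear_vec_nth]) (simp add: weak_grad_def)
    show "(LINT u|lebesgue_on U. (g u - g' u) $ j * \<phi> u) = 0" if "test_function U \<phi>" for \<phi>
      using w that by (simp add: weak_grad_def)
  qed
  then obtain N where N: "\<And>j. negligible (N j)" "\<And>j a. a \<in> U - N j \<Longrightarrow> (g a - g' a) $ j = 0"
    by metis
  have "negligible (\<Union>j. N j)" by (intro negligible_Union) (use N(1) in auto)
  moreover have "g a = g' a" if "a \<in> U - (\<Union>j. N j)" for a
  proof -
    have "(g a - g' a) $ j = 0" for j using that by (intro N(2)) auto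
    then show ?thesis by (simp add: vec_eq_iff)
  qed
  ultimately show ?thesis by blast
qed

text \<open>Morrey's estimate along a cone: the mollification radius \<open>t * r\<close> shrinks to \<open>0\<close> at \<open>x0\<close>, where the
  mollification becomes \<open>f x0\<close>.\<close>

lemma mollification_growth:
  fixes f :: "real^'n \<Rightarrow> real" and x0 v :: "real^'n"
  assumes U: "open U" and wg: "weak_grad U f g" and cont: "continuous_on U f"
    and p: "p > real CARD('n)" and Q: "cbox c d \<subseteq> U"
    and r: "r > 0" "norm v \<le> r" and "\<epsilon> > 0"
    and sub: "\<And>t. t \<in> {0<..<2} \<Longrightarrow> cball (x0 + t *\<^sub>R v) (t * r) \<subseteq> cbox c d"
    and subB: "\<And>t. t \<in> {0<..<1} \<Longrightarrow> ball (x0 + t *\<^sub>R v) (t * r) \<subseteq> B"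
    and B: "(\<integral>\<^sup>+u\<in>B. ennreal (norm (g u) powr p) \<partial>lebesgue) \<le> ennreal (\<epsilon> powr p * r ^ CARD('n))"
    and x0: "x0 \<in> U"
  shows "\<bar>(LINT u|lebesgue_on U. f u * mollifier (x0 + v) r u) - f x0\<bar> \<le>
    2 * (1 + 1 / bump_mass TYPE('n)) / (1 - CARD('n) / p) * \<epsilon> * r"
proof -
  define n where "n = real CARD('n)"
  define m where "m = bump_mass TYPE('n)"
  have "m > 0" unfolding m_def by (rule bump_mass_pos)
  have n1: "n \<ge> 1" unfolding n_def by (simp add: Suc_le_eq)
  have "p > n" using p by (simp add: n_def)
  with n1 have "p > 1" by simp
  \<comment> \<open>The order of the singularity at \<open>t = 0\<close>. It is below 1 because p >
    n, which makes \<open>t powr - \<alpha>\<close> integrable on the unit interval.\<close>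
  define \<alpha> where "\<alpha> = n / p"
  have \<alpha>: "0 < \<alpha>" "\<alpha> < 1" using \<open>p > n\<close> n1 by (auto simp: \<alpha>_def)
  \<comment> \<open>At \<open>t = 0\<close> the mollifier has radius 0 and loses its meaning; the
    limit value is put in by hand.\<close>
  define \<Phi> where "\<Phi> t = (if t = 0 then f x0 else LINT u|lebesgue_on U. f u * mollifier (x0 + t *\<^sub>R v) (t * r) u)" for t
  define \<Phi>' where "\<Phi>' t = (LINT u|lebesgue_on U. (g u \<bullet> (v + (r / (t * r)) *\<^sub>R (u - (x0 + t *\<^sub>R v)))) *
      mollifier (x0 + t *\<^sub>R v) (t * r) u)" for t
  define K where "K = 2 * r * (1 + 1 / m) * \<epsilon>"
  have loc: "f locally_integrable_on U" "g locally_integrable_on U" using wg by (auto simp: weak_grad_def)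
  \<comment> \<open>The interval extends beyond 1 so that the endpoint \<open>t = 1\<close> is an
    interior point, where two-sided differentiability gives continuity.\<close>
  have der: "(\<Phi> has_real_derivative \<Phi>' t) (at t)" if "t \<in> {0<..<2}" for t
  proof -
    have "((\<lambda>t. LINT u|lebesgue_on U. f u * mollifier (x0 + t *\<^sub>R v) (0 + t * r) u) has_real_derivative
        (LINT u|lebesgue_on U. (g u \<bullet> (v + (r / (0 + t * r)) *\<^sub>R (u - (x0 + t *\<^sub>R v)))) *
          mollifier (x0 + t *\<^sub>R v) (0 + t * r) u)) (at t)"
      by (rule mollification_path_derivative[OF U wg cont Q, of "{0<..<2}"]) (use that sub r in auto)
    then have "((\<lambda>t. LINT u|lebesgue_on U. f u * mollifier (x0 + t *\<^sub>R v) (t * r) u) has_real_derivative \<Phi>' t) (at t)"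
      by (simp add: \<Phi>'_def)
    then show ?thesis
      by (rule has_field_derivative_transform_within_open[of _ _ _ "{0<..<2}"]) (use that in \<open>auto simp: \<Phi>_def\<close>)
  qed
  have cont0: "(\<Phi> \<longlongrightarrow> \<Phi> 0) (at 0 within {0..1})"
    unfolding tendsto_iff eventually_at
  proof (intro allI impI)
    fix e :: real assume "e > 0"
    obtain d1 where d1: "d1 > 0" "\<And>u. dist u x0 < d1 \<Longrightarrow> dist (f u) (f x0) < e / 2"
    proof -
      have "isCont f x0" using cont U x0 continuous_on_eq_continuous_at by blast
      then show ?thesis using that \<open>e > 0\<close> unfolding continuous_at_eps_delta
        by (metis dist_norm half_gt_zero)
    qed
    show "\<exists>\<delta>>0. \<forall>t\<in>{0..1}. t \<noteq> 0 \<and> dist t 0 < \<delta> \<longrightarrow> dist (\<Phi> t) (\<Phi> 0) < e"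
    proof (intro exI[of _ "d1 / (2 * r)"] conjI ballI impI)
      fix t :: real assume "t \<in> {0..1}" "t \<noteq> 0 \<and> dist t 0 < d1 / (2 * r)"
      then have t: "0 < t" "t \<le> 1" "2 * (t * r) < d1" using r by (auto simp: field_simps)
      have "\<bar>(LINT u|lebesgue_on U. f u * mollifier (x0 + t *\<^sub>R v) (t * r) u) - f x0\<bar> \<le> e / 2"
      proof (rule mollifier_average_close[OF U loc(1)])
        show "cball (x0 + t *\<^sub>R v) (t * r) \<subseteq> U" using sub[of t] t Q by force
        fix u assume u: "u \<in> ball (x0 + t *\<^sub>R v) (t * r)"
        have "dist u x0 \<le> dist u (x0 + t *\<^sub>R v) + dist (x0 + t *\<^sub>R v) x0" by (rule dist_triangle)
        also have "dist (x0 + t *\<^sub>R v) x0 \<le> t * r" using t r by (simp add: dist_norm)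
        finally have "dist u x0 < d1" using u t by (simp add: dist_commute)
        then show "\<bar>f u - f x0\<bar> \<le> e / 2" using d1(2)[of u] by (simp add: dist_real_def)
      qed (use t r in auto)
      then show "dist (\<Phi> t) (\<Phi> 0) < e" using t \<open>e > 0\<close> by (simp add: \<Phi>_def dist_real_def)
    qed (use d1 r in auto)
  qed
  have cont\<Phi>: "continuous_on {0..1} \<Phi>"
    unfolding continuous_on
  proof
    fix t :: real assume "t \<in> {0..1}"
    show "(\<Phi> \<longlongrightarrow> \<Phi> t) (at t within {0..1})"
    proof (cases "t = 0")
      case False
      then have "isCont \<Phi> t" using \<open>t \<in> _\<close> by (intro DERIV_isCont[OF der]) auto
      then show ?thesis using continuous_at_imp_continuous_at_within continuous_within by blast
    qed (use cont0 in simp)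
  qed
  have bound: "norm (\<Phi>' t) \<le> K * t powr - \<alpha>" if t: "0 < t" "t < 1" for t
  proof -
    let ?x = "x0 + t *\<^sub>R v"
    have s: "t * r > 0" using t r by simp
    have subU: "cball ?x (t * r) \<subseteq> U" using sub[of t] t Q by force
    have k: "(\<lambda>u. norm (g u)) locally_integrable_on U"
      using loc(2) unfolding locally_integrable_on_def by (auto intro: set_integrable_norm)
    have k2: "(\<lambda>u. 2 * r * norm (g u)) locally_integrable_on U"
      by (rule locally_integrable_on_linear[OF bounded_linear_mult_right k])
    have "\<bar>\<Phi>' t\<bar> \<le> (LINT u|lebesgue_on U. (2 * r * norm (g u)) * mollifier ?x (t * r) u)"
      unfolding \<Phi>'_def
    proof (rule abs_mollifier_integral_le[OF U s k2 subU], intro AE_I2 impI)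
      fix u assume u: "u \<in> ball ?x (t * r)"
      have "norm (v + (r / (t * r)) *\<^sub>R (u - ?x)) \<le> norm v + norm ((r / (t * r)) *\<^sub>R (u - ?x))"
        by (rule norm_triangle_ineq)
      also have "norm ((r / (t * r)) *\<^sub>R (u - ?x)) = norm (u - ?x) / t" using t r by simp
      also have "\<dots> \<le> (t * r) / t"
        using u t by (intro divide_right_mono) (auto simp: dist_norm norm_minus_commute)
      also have "norm v + (t * r) / t \<le> 2 * r" using t r by simp
      finally have w: "norm (v + (r / (t * r)) *\<^sub>R (u - ?x)) \<le> 2 * r" by simp
      have "\<bar>g u \<bullet> (v + (r / (t * r)) *\<^sub>R (u - ?x))\<bar> \<le> norm (g u) * norm (v + (r / (t * r)) *\<^sub>R (u - ?x))"
        by (rule Cauchy_Schwarz_ineq2)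
      also have "\<dots> \<le> norm (g u) * (2 * r)" using w by (intro mult_left_mono) auto
      finally show "\<bar>g u \<bullet> (v + (r / (t * r)) *\<^sub>R (u - ?x))\<bar> \<le> 2 * r * norm (g u)" by (simp add: mult_ac)
    qed
    also have "\<dots> = 2 * r * (LINT u|lebesgue_on U. \<bar>norm (g u)\<bar> * mollifier ?x (t * r) u)"
      by (simp add: mult.assoc)
    \<comment> \<open>Here \<open>lam = \<epsilon> * t powr - \<alpha>\<close>. The powers of
      \<epsilon> and \<open>r\<close> cancel to a single \<epsilon>, and since
      \<open>\<alpha> * p = n\<close> the second summand has the same order
      \<open>t powr - \<alpha>\<close>.\<close>
    also have "(LINT u|lebesgue_on U. \<bar>norm (g u)\<bar> * mollifier ?x (t * r) u) \<le>
        \<epsilon> * t powr - \<alpha> + (\<epsilon> * t powr - \<alpha>) powr (1 - p) * (\<epsilon> powr p * r ^ CARD('n) / ((t * r) ^ CARD('n) * m))"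
      unfolding m_def
    proof (rule mollifier_integral_bound[OF U k s subU])
      have "(\<integral>\<^sup>+u\<in>ball ?x (t * r). ennreal (\<bar>norm (g u)\<bar> powr p) \<partial>lebesgue) \<le>
          (\<integral>\<^sup>+u\<in>B. ennreal (norm (g u) powr p) \<partial>lebesgue)"
        using subB[of t] t by (intro nn_integral_mono) (auto simp: indicator_def)
      also note B
      finally show "(\<integral>\<^sup>+u\<in>ball ?x (t * r). ennreal (\<bar>norm (g u)\<bar> powr p) \<partial>lebesgue) \<le>
          ennreal (\<epsilon> powr p * r ^ CARD('n))" .
    qed (use \<open>p > 1\<close> \<open>\<epsilon> > 0\<close> t r in auto)
    also have "\<dots> = (1 + 1 / m) * \<epsilon> * t powr - \<alpha>"
    proof -
      have "(\<epsilon> * t powr - \<alpha>) powr (1 - p) * (\<epsilon> powr p * r ^ CARD('n) / ((t * r) ^ CARD('n) * m)) =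
          (\<epsilon> powr (1 - p) * \<epsilon> powr p) * ((t powr - \<alpha>) powr (1 - p) / t ^ CARD('n)) / m"
        using \<open>\<epsilon> > 0\<close> t r by (simp add: powr_mult power_mult_distrib field_simps)
      also have "\<epsilon> powr (1 - p) * \<epsilon> powr p = \<epsilon>"
        using \<open>\<epsilon> > 0\<close> by (simp flip: powr_add)
      also have "(t powr - \<alpha>) powr (1 - p) / t ^ CARD('n) = t powr (- \<alpha> * (1 - p) - n)"
        unfolding powr_diff[of t "- \<alpha> * (1 - p)" n] powr_powr using t by (simp add: n_def powr_realpow)
      also have "- \<alpha> * (1 - p) - n = - \<alpha>"
        using \<open>p > 1\<close> by (simp add: \<alpha>_def field_simps)
      finally show ?thesis by (simp add: algebra_simps)
    qed
    finally show ?thesis using r by (simp add: K_def mult_ac)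
  qed
  \<comment> \<open>An antiderivative of the bound \<open>K * t powr - \<alpha>\<close>. It is
    continuous at 0, so the mean value inequality reaches the singular endpoint.\<close>
  define \<phi> where "\<phi> t = K / (1 - \<alpha>) * t powr (1 - \<alpha>)" for t
  have "norm (\<Phi> 1 - \<Phi> 0) \<le> \<phi> 1 - \<phi> 0"
  proof (rule differentiable_bound_general[OF _ cont\<Phi>])
    show "continuous_on {0..1} \<phi>"
      unfolding \<phi>_def using \<alpha>
      by (intro continuous_on_mult continuous_on_const continuous_on_powr' continuous_on_id) auto
    show "(\<Phi> has_vector_derivative \<Phi>' t) (at t)" if "0 < t" "t < 1" for t
      using der[of t] that by (simp add: has_real_derivative_iff_has_vector_derivative)
    show "(\<phi> has_vector_derivative K * t powr - \<alpha>) (at t)" if "0 < t" "t < 1" for t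
    proof -
      have "(\<phi> has_real_derivative K / (1 - \<alpha>) * ((1 - \<alpha>) * t powr (1 - \<alpha> - 1))) (at t)"
        unfolding \<phi>_def by (intro DERIV_cmult has_real_derivative_powr that)
      then show ?thesis using \<alpha> by (simp add: has_real_derivative_iff_has_vector_derivative)
    qed
  qed (use bound in auto)
  then show ?thesis
    by (simp add: \<Phi>_def \<phi>_def K_def \<alpha>_def n_def m_def mult_ac)
qed

text \<open>After subtracting the linear function with gradient \<open>g a\<close>, the values of
  the remainder at \<open>a\<close> and at \<open>b\<close> are both compared with the same
  mollification, centred at \<open>b\<close> with radius |b - a|. Each comparison is a case of
  \<open>mollification_growth\<close>.\<close>

lemma weak_grad_differentiable_at:
  fixes f :: "real^'n \<Rightarrow> real"
  assumes U: "open U" and wg: "weak_grad U f g" and cont: "continuous_on U f"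
    and p: "p > real CARD('n)" and a: "a \<in> U"
    and leb: "\<And>e. e > 0 \<Longrightarrow> \<exists>d>0. \<forall>r. 0 < r \<longrightarrow> r < d \<longrightarrow>
      (\<integral>\<^sup>+u\<in>ball a r. ennreal (norm (g u - g a) powr p) \<partial>lebesgue) \<le> ennreal (e * r ^ CARD('n))"
  shows "(f has_derivative (\<lambda>h. g a \<bullet> h)) (at a)"
  unfolding has_derivative_at_alt
proof (intro conjI allI impI)
  show "bounded_linear (\<lambda>h. g a \<bullet> h)" by (rule bounded_linear_inner_right)
  fix e :: real assume "e > 0"
  define f1 where "f1 x = f x - (g a \<bullet> x + 0)" for x
  define g1 where "g1 x = g x - g a" for x
  have wg1: "weak_grad U f1 g1"
    unfolding f1_def g1_def by (rule weak_grad_diff[OF U wg weak_grad_affine[OF U]])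
  have cont1: "continuous_on U f1"
    unfolding f1_def by (intro continuous_intros cont)
  define C where "C = 2 * (1 + 1 / bump_mass TYPE('n)) / (1 - CARD('n) / p)"
  have "p > 0" using p by (meson less_le_trans not_le of_nat_0_le_iff)
  then have "CARD('n) / p < 1" using p by simp
  then have "C > 0" unfolding C_def using bump_mass_pos[where 'n='n]
    by (intro divide_pos_pos mult_pos_pos add_pos_pos) auto
  \<comment> \<open>Two comparisons cost \<open>C * \<epsilon> * r\<close> each. The Lebesgue point
    condition is applied on a ball of radius \<open>2 * r\<close>, whence the factor
    \<open>2 ^ CARD('n)\<close> in the next line.\<close>
  define \<epsilon> where "\<epsilon> = e / (2 * C)"
  have "\<epsilon> > 0" using \<open>e > 0\<close> \<open>C > 0\<close> by (simp add: \<epsilon>_def)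
  then have "\<epsilon> powr p / 2 ^ CARD('n) > 0" by simp
  from leb[OF this] obtain \<delta> where \<delta>: "\<delta> > 0" "\<And>r. 0 < r \<Longrightarrow> r < \<delta> \<Longrightarrow>
      (\<integral>\<^sup>+u\<in>ball a r. ennreal (norm (g1 u) powr p) \<partial>lebesgue) \<le> ennreal (\<epsilon> powr p / 2 ^ CARD('n) * r ^ CARD('n))"
    unfolding g1_def by (elim exE conjE) simp
  obtain c d where cd: "cbox c d \<subseteq> U" "a \<in> box c d"
    using open_contains_cbox[OF U a] by metis
  obtain \<rho> where \<rho>: "\<rho> > 0" "cball a \<rho> \<subseteq> cbox c d"
    using cd(2) open_box[of c d] open_contains_cball[of "box c d"] box_subset_cbox[of c d] by blast
  show "\<exists>\<delta>>0. \<forall>b. norm (b - a) < \<delta> \<longrightarrow> norm (f b - f a - g a \<bullet> (b - a)) \<le> e * norm (b - a)"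
  \<comment> \<open>With \<open>r\<close> the distance from \<open>a\<close> to \<open>b\<close>,
    the gradient is averaged over the ball of radius \<open>2 * r\<close>, which gives \<delta> / 2.
    For \<open>t < 2\<close> the moving balls stay within \<open>4 * r\<close> of \<open>a\<close>,
    which gives \<rho> / 4.\<close>
  proof (intro exI[of _ "min (\<delta> / 2) (\<rho> / 4)"] conjI allI impI)
    show "0 < min (\<delta> / 2) (\<rho> / 4)" using \<delta> \<rho> by simp
    fix b assume b: "norm (b - a) < min (\<delta> / 2) (\<rho> / 4)"
    define r where "r = norm (b - a)"
    show "norm (f b - f a - g a \<bullet> (b - a)) \<le> e * norm (b - a)"
    proof (cases "b = a")
      case False
      have r: "r > 0" "2 * r < \<delta>" "4 * r < \<rho>" "dist a b = r"
        using False b by (auto simp: r_def dist_norm norm_minus_commute)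
      have Q: "cball a (4 * r) \<subseteq> cbox c d" using \<rho>(2) r(3) by (meson less_imp_le order_trans subset_cball)
      have "b \<in> cball a (4 * r)" using r by simp
      then have "b \<in> U" using Q cd(1) by blast
      have "(\<integral>\<^sup>+u\<in>ball a (2 * r). ennreal (norm (g1 u) powr p) \<partial>lebesgue) \<le>
          ennreal (\<epsilon> powr p / 2 ^ CARD('n) * (2 * r) ^ CARD('n))"
        using \<delta>(2)[of "2 * r"] r by simp
      then have B: "(\<integral>\<^sup>+u\<in>ball a (2 * r). ennreal (norm (g1 u) powr p) \<partial>lebesgue) \<le>
          ennreal (\<epsilon> powr p * r ^ CARD('n))"
        by (simp add: power_mult_distrib)
      \<comment> \<open>The centre travels from \<open>a\<close> to \<open>b\<close> while the
        radius grows from 0 to \<open>r\<close>.\<close>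
      have A: "\<bar>(LINT u|lebesgue_on U. f1 u * mollifier (a + (b - a)) r u) - f1 a\<bar> \<le> C * \<epsilon> * r"
        unfolding C_def
      proof (rule mollification_growth[OF U wg1 cont1 p cd(1) r(1) _ \<open>\<epsilon> > 0\<close> _ _ B a])
        have near: "dist a x \<le> t * r + dist (a + t *\<^sub>R (b - a)) x" if "t > 0" for t x
          using dist_triangle[of a x "a + t *\<^sub>R (b - a)"] that by (simp add: dist_norm r_def)
        show "cball (a + t *\<^sub>R (b - a)) (t * r) \<subseteq> cbox c d" if "t \<in> {0<..<2}" for t
        proof
          fix x assume x: "x \<in> cball (a + t *\<^sub>R (b - a)) (t * r)"
          have "t * r < 2 * r" using that r by simp
          then have "x \<in> cball a (4 * r)" using near[of t x] that x by simp
          with Q show "x \<in> cbox c d" by blast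
        qed
        show "ball (a + t *\<^sub>R (b - a)) (t * r) \<subseteq> ball a (2 * r)" if "t \<in> {0<..<1}" for t
        proof
          fix x assume x: "x \<in> ball (a + t *\<^sub>R (b - a)) (t * r)"
          have "t * r < r" using that r by simp
          then show "x \<in> ball a (2 * r)" using near[of t x] that x by simp
        qed
      qed (simp add: r_def)
      \<comment> \<open>The same final mollifier, reached with the centre fixed at
        \<open>b\<close>.\<close>
      have "\<bar>(LINT u|lebesgue_on U. f1 u * mollifier (b + 0) r u) - f1 b\<bar> \<le> C * \<epsilon> * r"
        unfolding C_def
      proof (rule mollification_growth[OF U wg1 cont1 p cd(1) r(1) _ \<open>\<epsilon> > 0\<close> _ _ B \<open>b \<in> U\<close>])
        have near: "dist a x \<le> r + dist b x" for x using dist_triangle[of a x b] r by simp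
        show "cball (b + t *\<^sub>R 0) (t * r) \<subseteq> cbox c d" if "t \<in> {0<..<2}" for t
        proof
          fix x assume x: "x \<in> cball (b + t *\<^sub>R 0) (t * r)"
          have "t * r < 2 * r" using that r by simp
          moreover have "dist b x \<le> t * r" using x by simp
          ultimately have "dist a x \<le> 4 * r" using near[of x] r by linarith
          then have "x \<in> cball a (4 * r)" by simp
          with Q show "x \<in> cbox c d" by blast
        qed
        show "ball (b + t *\<^sub>R 0) (t * r) \<subseteq> ball a (2 * r)" if "t \<in> {0<..<1}" for t
        proof
          fix x assume x: "x \<in> ball (b + t *\<^sub>R 0) (t * r)"
          have "t * r < r" using that r by simp
          then show "x \<in> ball a (2 * r)" using near[of x] x by simp
        qed
      qed (use r in simp)
      with A have "\<bar>f1 b - f1 a\<bar> \<le> 2 * (C * \<epsilon> * r)" by simp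
      also have "\<dots> = e * r" using \<open>C > 0\<close> by (simp add: \<epsilon>_def)
      finally show ?thesis by (simp add: f1_def r_def inner_diff_right algebra_simps)
    qed simp
  qed
qed

lemma weak_grad_differentiable_ae:
  fixes f :: "real^'n \<Rightarrow> real"
  assumes U: "open U" and wg: "weak_grad U f g" and cont: "continuous_on U f"
    and p: "p > real CARD('n)"
    and fin: "\<And>C. compact C \<Longrightarrow> C \<subseteq> U \<Longrightarrow> (\<integral>\<^sup>+u\<in>C. ennreal (norm (g u) powr p) \<partial>lebesgue) < \<infinity>"
  shows "\<exists>N. negligible N \<and> (\<forall>a\<in>U - N. (f has_derivative (\<lambda>h. g a \<bullet> h)) (at a))"
proof -
  have "p > 0" using p by (meson less_le_trans not_le of_nat_0_le_iff)
  have g: "g \<in> borel_measurable (lebesgue_on U)"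
    using wg by (intro locally_integrable_imp_measurable[OF U]) (simp add: weak_grad_def)
  obtain N where N: "negligible N \<and> (\<forall>a\<in>U - N. \<forall>e>0. \<exists>d>0. \<forall>r. 0 < r \<longrightarrow> r < d \<longrightarrow>
    (\<integral>\<^sup>+u\<in>ball a r. ennreal (norm (g u - g a) powr p) \<partial>lebesgue) \<le> ennreal (e * r ^ DIM(real^'n)))"
    using lebesgue_points[OF U g \<open>p > 0\<close> fin] ..
  show ?thesis
  proof (intro exI[of _ N] conjI ballI)
    show "negligible N" using N ..
    fix a assume a: "a \<in> U - N"
    from bspec[OF conjunct2[OF N] this]
    have leb: "\<exists>d>0. \<forall>r. 0 < r \<longrightarrow> r < d \<longrightarrow>
      (\<integral>\<^sup>+u\<in>ball a r. ennreal (norm (g u - g a) powr p) \<partial>lebesgue) \<le> ennreal (e * r ^ CARD('n))"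
      if "e > 0" for e using that by simp
    show "(f has_derivative (\<lambda>h. g a \<bullet> h)) (at a)"
      by (rule weak_grad_differentiable_at[OF U wg cont p _ leb]) (use a in auto)
  qed
qed

text \<open>With the radius fixed, the mollified function has derivative at most
  \<open>norm v\<close> along the segment from \<open>a\<close> to \<open>b\<close>, since the
  kernel averages a gradient of norm at most 1. Letting the radius tend to 0 recovers
  \<open>f\<close> by continuity.\<close>

lemma weak_grad_lipschitz:
  fixes f :: "real^'n \<Rightarrow> real"
  assumes U: "open U" and wg: "weak_grad U f g" and cont: "continuous_on U f"
    and le: "AE u in lebesgue_on U. norm (g u) \<le> 1"
    and Q: "cbox c d \<subseteq> U" and z: "ball z (6 * \<rho>) \<subseteq> cbox c d"
    and ab: "a \<in> ball z \<rho>" "b \<in> ball z \<rho>"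
  shows "\<bar>f b - f a\<bar> \<le> dist a b"
proof -
  have "\<rho> > 0" using ab(1) by (metis dist_not_less_zero mem_ball not_less_iff_gr_or_eq order_less_trans)
  have loc: "f locally_integrable_on U" using wg by (simp add: weak_grad_def)
  define v where "v = b - a"
  have v: "norm v < 2 * \<rho>"
    using ab dist_triangle[of a b z] by (simp add: v_def dist_norm norm_minus_commute)
  define M where "M s t = (LINT u|lebesgue_on U. f u * mollifier (a + t *\<^sub>R v) (s + t * 0) u)" for s t
  have step: "\<bar>M s 1 - M s 0\<bar> \<le> norm v" if s: "0 < s" "s < \<rho>" for s
  proof -
    \<comment> \<open>The factor 6: \<open>a\<close> lies within \<rho> of \<open>z\<close>, the
      displacement \<open>t *\<^sub>R v\<close> is shorter than 4 \<rho> because |t| < 2 and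
      \<open>norm v < 2 * \<rho>\<close>, and the mollification radius is less than \<rho>.\<close>
    have sub: "cball (a + t *\<^sub>R v) s \<subseteq> cbox c d" if "t \<in> {-1<..<2}" for t
    proof -
      have "u \<in> ball z (6 * \<rho>)" if u: "dist (a + t *\<^sub>R v) u \<le> s" for u
      proof -
        have "dist z u \<le> dist z a + dist a u" by (rule dist_triangle)
        also have "dist a u \<le> dist a (a + t *\<^sub>R v) + dist (a + t *\<^sub>R v) u" by (rule dist_triangle)
        also have "dist a (a + t *\<^sub>R v) = \<bar>t\<bar> * norm v" by (simp add: dist_norm)
        also have "\<bar>t\<bar> * norm v \<le> 2 * norm v" using \<open>t \<in> _\<close> by (intro mult_right_mono) auto
        finally show ?thesis using ab(1) s v u by (simp add: dist_commute)
      qed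
      then show ?thesis using z by auto
    qed
    have der: "(M s has_real_derivative (LINT u|lebesgue_on U. (g u \<bullet> v) * mollifier (a + t *\<^sub>R v) s u)) (at t)"
      if "t \<in> {-1<..<2}" for t
      using mollification_path_derivative[OF U wg cont Q, of "{-1<..<2}" t s 0 a v] sub s that
      by (simp add: M_def[abs_def])
    have bnd: "\<bar>LINT u|lebesgue_on U. (g u \<bullet> v) * mollifier (a + t *\<^sub>R v) s u\<bar> \<le> norm v"
      if "t \<in> {-1<..<2}" for t
    proof -
      have subU: "cball (a + t *\<^sub>R v) s \<subseteq> U" using sub[OF that] Q by blast
      have "\<bar>LINT u|lebesgue_on U. (g u \<bullet> v) * mollifier (a + t *\<^sub>R v) s u\<bar> \<le>
          (LINT u|lebesgue_on U. norm v * mollifier (a + t *\<^sub>R v) s u)"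
      proof (rule abs_mollifier_integral_le[OF U s(1) locally_integrable_on_const subU])
        show "AE u in lebesgue_on U. u \<in> ball (a + t *\<^sub>R v) s \<longrightarrow> \<bar>g u \<bullet> v\<bar> \<le> norm v"
          using le
        proof eventually_elim
          case (elim u)
          have "\<bar>g u \<bullet> v\<bar> \<le> norm (g u) * norm v" by (rule Cauchy_Schwarz_ineq2)
          also have "\<dots> \<le> 1 * norm v" using elim by (intro mult_right_mono) auto
          finally show ?case by simp
        qed
      qed
      also have "\<dots> = norm v" using integral_mollifier[OF s(1) U subU] by simp
      finally show ?thesis .
    qed
    have "norm (M s 1 - M s 0) \<le> norm v * 1 - norm v * 0"
    proof (rule differentiable_bound_general[where \<phi> = "\<lambda>t. norm v * t"])
      show "continuous_on {0..1} (M s)"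
        by (intro continuous_at_imp_continuous_on ballI DERIV_isCont[OF der]) auto
      show "(M s has_vector_derivative (LINT u|lebesgue_on U. (g u \<bullet> v) * mollifier (a + t *\<^sub>R v) s u)) (at t)"
        if "0 < t" "t < 1" for t
        using der[of t] that by (simp add: has_real_derivative_iff_has_vector_derivative)
      show "((\<lambda>t. norm v * t) has_vector_derivative norm v) (at t)" for t
        unfolding has_real_derivative_iff_has_vector_derivative[symmetric]
        by (auto intro!: derivative_eq_intros)
    qed (use bnd in \<open>auto intro!: continuous_intros\<close>)
    then show ?thesis by simp
  qed
  have "\<bar>f b - f a\<bar> \<le> norm v + e" if "e > 0" for e
  proof -
    have zU: "ball z (6 * \<rho>) \<subseteq> U" using z Q by blast
    have near: "\<exists>s0>0. \<forall>s. 0 < s \<longrightarrow> s < s0 \<longrightarrow> \<bar>(LINT u|lebesgue_on U. f u * mollifier x s u) - f x\<bar> \<le> e / 2"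
      if x: "x \<in> ball z \<rho>" for x
    proof -
      have "x \<in> U" using x zU \<open>\<rho> > 0\<close> by (auto simp: subset_iff)
      then have "isCont f x" using cont U continuous_on_eq_continuous_at by blast
      then obtain d1 where d1: "d1 > 0" "\<And>u. dist u x < d1 \<Longrightarrow> dist (f u) (f x) < e / 2"
        using \<open>e > 0\<close> unfolding continuous_at_eps_delta by (metis dist_norm half_gt_zero)
      show ?thesis
      proof (intro exI[of _ "min d1 \<rho>"] conjI allI impI)
        fix s assume s: "0 < s" "s < min d1 \<rho>"
        show "\<bar>(LINT u|lebesgue_on U. f u * mollifier x s u) - f x\<bar> \<le> e / 2"
        proof (rule mollifier_average_close[OF U loc s(1)])
          show "cball x s \<subseteq> U"
          proof
            fix u assume "u \<in> cball x s"
            then have "dist z u < 6 * \<rho>" using dist_triangle[of z u x] x s by simp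
            then show "u \<in> U" using zU by auto
          qed
          show "\<bar>f u - f x\<bar> \<le> e / 2" if "u \<in> ball x s" for u
            using d1(2)[of u] that s by (simp add: dist_real_def dist_commute)
        qed
      qed (use d1 \<open>\<rho> > 0\<close> in auto)
    qed
    obtain s1 where s1: "s1 > 0" "\<And>s. 0 < s \<Longrightarrow> s < s1 \<Longrightarrow> \<bar>(LINT u|lebesgue_on U. f u * mollifier a s u) - f a\<bar> \<le> e / 2"
      using near[OF ab(1)] by metis
    obtain s2 where s2: "s2 > 0" "\<And>s. 0 < s \<Longrightarrow> s < s2 \<Longrightarrow> \<bar>(LINT u|lebesgue_on U. f u * mollifier b s u) - f b\<bar> \<le> e / 2"
      using near[OF ab(2)] by metis
    define s where "s = min (min s1 s2) \<rho> / 2"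
    have s: "0 < s" "s < s1" "s < s2" "s < \<rho>" using s1 s2 \<open>\<rho> > 0\<close> by (auto simp: s_def)
    have "\<bar>M s 0 - f a\<bar> \<le> e / 2" "\<bar>M s 1 - f b\<bar> \<le> e / 2"
      using s1(2)[OF s(1,2)] s2(2)[OF s(1,3)] by (simp_all add: M_def v_def)
    with step[OF s(1,4)] show ?thesis by linarith
  qed
  then have "\<bar>f b - f a\<bar> \<le> norm v" by (rule field_le_epsilon)
  then show ?thesis by (simp add: v_def dist_norm norm_minus_commute)
qed

subsection \<open>Volume and isometries\<close>

text \<open>Continuity of \<open>z\<close> brings \<open>z v\<close> into the neighbourhood of
  \<open>x\<close> where the first-order expansion of \<open>y\<close> has error at most
  \<open>(c - b)\<close> times the distance. Subtracting this error from the lower bound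
  \<open>c\<close> for the derivative leaves \<open>b\<close>.\<close>

lemma inverse_pointwise_lipschitz:
  fixes y z :: "'a::euclidean_space \<Rightarrow> 'a"
  assumes hom: "homeomorphism U1 U2 y z" and "open U2" and x: "x \<in> U1"
    and D: "(y has_derivative D) (at x)" and c: "\<And>h. c * norm h \<le> norm (D h)" and b: "b < c"
  shows "\<exists>\<delta>>0. ball (y x) \<delta> \<subseteq> U2 \<and> (\<forall>v\<in>ball (y x) \<delta>. b * norm (z v - x) \<le> norm (v - y x))"
proof -
  have zy: "z (y x) = x" and yx: "y x \<in> U2" and yz: "\<And>v. v \<in> U2 \<Longrightarrow> y (z v) = v"
    using hom x by (auto simp: homeomorphism_def)
  obtain d where d: "d > 0" "\<And>x'. norm (x' - x) < d \<Longrightarrow> norm (y x' - y x - D (x' - x)) \<le> (c - b) * norm (x' - x)"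
    using D b unfolding has_derivative_at_alt by (metis diff_gt_0_iff_gt)
  have "isCont z (y x)"
    using hom yx \<open>open U2\<close> continuous_on_eq_continuous_at by (auto simp: homeomorphism_def)
  then obtain \<delta>1 where \<delta>1: "\<delta>1 > 0" "\<And>v. dist v (y x) < \<delta>1 \<Longrightarrow> dist (z v) x < d"
    using d(1) zy unfolding continuous_at_eps_delta by (metis dist_norm)
  obtain \<delta>2 where \<delta>2: "\<delta>2 > 0" "ball (y x) \<delta>2 \<subseteq> U2"
    using \<open>open U2\<close> yx open_contains_ball by blast
  show ?thesis
  proof (intro exI[of _ "min \<delta>1 \<delta>2"] conjI ballI)
    show "min \<delta>1 \<delta>2 > 0" using \<delta>1 \<delta>2 by simp
    show "ball (y x) (min \<delta>1 \<delta>2) \<subseteq> U2" using \<delta>2 by auto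
    fix v assume v: "v \<in> ball (y x) (min \<delta>1 \<delta>2)"
    then have "v \<in> U2" using \<delta>2 by auto
    have "dist v (y x) < \<delta>1" using v by (simp add: dist_commute)
    from \<delta>1(2)[OF this] have "norm (z v - x) < d" by (simp add: dist_norm)
    from d(2)[OF this] have "norm (v - y x - D (z v - x)) \<le> (c - b) * norm (z v - x)"
      using yz[OF \<open>v \<in> U2\<close>] by simp
    moreover have "norm (D (z v - x)) \<le> norm (v - y x) + norm (v - y x - D (z v - x))"
      using norm_triangle_ineq4[of "v - y x" "v - y x - D (z v - x)"] by simp
    ultimately show "b * norm (z v - x) \<le> norm (v - y x)"
      using c[of "z v - x"] by (simp add: algebra_simps)
  qed
qed

lemma negligible_homeomorphism_preimage:
  fixes y z :: "'a::euclidean_space \<Rightarrow> 'a"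
  assumes hom: "homeomorphism U1 U2 y z" and "open U2" and S: "S \<subseteq> U1"
    and D: "\<And>x. x \<in> S \<Longrightarrow> (y has_derivative D x) (at x)"
    and inj: "\<And>x. x \<in> S \<Longrightarrow> \<exists>c>0. \<forall>h. c * norm h \<le> norm (D x h)"
    and neg: "negligible (y ` S)"
  shows "negligible S"
proof -
  have zy: "\<And>x. x \<in> U1 \<Longrightarrow> z (y x) = x" using hom by (auto simp: homeomorphism_def)
  have "negligible (z ` y ` S)"
  proof (rule negligible_locally_Lipschitz_image[OF order_refl neg])
    fix v assume "v \<in> y ` S"
    then obtain x where x: "x \<in> S" "v = y x" by blast
    obtain c where c: "c > 0" "\<And>h. c * norm h \<le> norm (D x h)" using inj[OF x(1)] by blast
    have "x \<in> U1" using x S by blast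
    obtain \<delta> where \<delta>: "\<delta> > 0" "\<And>w. w \<in> ball (y x) \<delta> \<Longrightarrow> c / 2 * norm (z w - x) \<le> norm (w - y x)"
      using inverse_pointwise_lipschitz[OF hom \<open>open U2\<close> \<open>x \<in> U1\<close> D[OF x(1)] c(2), of "c / 2"] c(1) by auto
    show "\<exists>T B. open T \<and> v \<in> T \<and> (\<forall>w\<in>y ` S \<inter> T. norm (z w - z v) \<le> B * norm (w - v))"
    proof (intro exI[of _ "ball v \<delta>"] exI[of _ "2 / c"] conjI ballI)
      fix w assume "w \<in> y ` S \<inter> ball v \<delta>"
      then have "c / 2 * norm (z w - x) \<le> norm (w - y x)" using \<delta>(2) x(2) by blast
      then show "norm (z w - z v) \<le> 2 / c * norm (w - v)"
        using c(1) zy[OF \<open>x \<in> U1\<close>] x(2) by (simp add: field_simps)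
    qed (use \<delta> in auto)
  qed
  also have "z ` y ` S = S" using zy S by force
  finally show ?thesis .
qed

section \<open>Volume comparison for expanding homeomorphisms\<close>

lemma homeomorphism_open_image:
  assumes "homeomorphism \<Omega>1 \<Omega>2 y z" "open \<Omega>2" "open U" "U \<subseteq> \<Omega>1"
  shows "open (y ` U)"
proof -
  have "y ` U = \<Omega>2 \<inter> z -` U"
    using assms(1,4) by (force simp: homeomorphism_def)
  moreover have "open (\<Omega>2 \<inter> z -` U)"
    using assms by (intro continuous_open_preimage) (auto simp: homeomorphism_def)
  ultimately show ?thesis by simp
qed

text \<open>Subadditivity for a countable index set without an enumeration. The balls enlarged by
  \<open>1 / b\<close> in the domain may overlap, so only an inequality is available for their
  union.\<close>

lemma emeasure_UN_le_count_space:
  assumes "countable I" and [measurable]: "\<And>i. i \<in> I \<Longrightarrow> X i \<in> sets M"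
  shows "emeasure M (\<Union>i\<in>I. X i) \<le> (\<integral>\<^sup>+i. emeasure M (X i) \<partial>count_space I)"
proof -
  have "emeasure M (\<Union>i\<in>I. X i) = (\<integral>\<^sup>+x. indicator (\<Union>i\<in>I. X i) x \<partial>M)"
    using assms by (intro nn_integral_indicator[symmetric] sets.countable_UN'')
  also have "\<dots> \<le> (\<integral>\<^sup>+x. (\<integral>\<^sup>+i. indicator (X i) x \<partial>count_space I) \<partial>M)"
  proof (intro nn_integral_mono)
    fix x
    show "indicator (\<Union>i\<in>I. X i) x \<le> (\<integral>\<^sup>+i. indicator (X i) x \<partial>count_space I)"
    proof (cases "x \<in> (\<Union>i\<in>I. X i)")
      case True
      then obtain i where "i \<in> I" "x \<in> X i" by blast
      then show ?thesis
        using nn_integral_ge_point[of i I "\<lambda>i. indicator (X i) x"] by (simp add: indicator_def)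
    qed simp
  qed
  also have "\<dots> = (\<integral>\<^sup>+i. (\<integral>\<^sup>+x. indicator (X i) x \<partial>M) \<partial>count_space I)"
    by (rule nn_integral_count_space_nn_integral[OF assms(1)]) measurable
  also have "\<dots> = (\<integral>\<^sup>+i. emeasure M (X i) \<partial>count_space I)"
    by (intro nn_integral_cong nn_integral_indicator assms) simp
  finally show ?thesis .
qed

text \<open>For b < 1 every small ball of radius \<open>r\<close> about \<open>y x\<close> is
  carried by \<open>z\<close> into the ball of radius \<open>r / b\<close> about \<open>x\<close>. A
  Vitali family of disjoint balls in the image thus yields balls in the domain covering almost all
  of \<open>U\<close>, with volumes larger by \<open>(1 / b) ^ DIM('a)\<close>.\<close>

lemma measure_le_expanding_image:
  fixes y z :: "'a::euclidean_space \<Rightarrow> 'a"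
  assumes hom: "homeomorphism \<Omega>1 \<Omega>2 y z" and "open \<Omega>2" and "bounded \<Omega>2"
    and U: "open U" "U \<subseteq> \<Omega>1" and N: "negligible N"
    and D: "\<And>x. x \<in> U - N \<Longrightarrow> (y has_derivative D x) (at x)"
    and exp: "\<And>x h. x \<in> U - N \<Longrightarrow> norm h \<le> norm (D x h)"
  shows "emeasure lebesgue U \<le> emeasure lebesgue (y ` U)"
proof -
  have zy: "\<And>x. x \<in> \<Omega>1 \<Longrightarrow> z (y x) = x" using hom by (auto simp: homeomorphism_def)
  define V where "V = y ` U"
  have oV: "open V" unfolding V_def by (rule homeomorphism_open_image[OF hom \<open>open \<Omega>2\<close> U])
  define S where "S = y ` (U - N)"
  have le: "emeasure lebesgue U \<le> ennreal ((1 / b) ^ DIM('a)) * emeasure lebesgue V" if b: "0 < b" "b < 1" for b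
  proof -
    define K where "K = {(v, r). v \<in> S \<and> 0 < r \<and> ball v r \<subseteq> V \<and> z ` ball v r \<subseteq> ball (z v) (r / b)}"
    have cover: "\<exists>i. i \<in> K \<and> v \<in> ball (fst i) (snd i) \<and> snd i < d" if v: "v \<in> S" and "0 < d" for v d
    proof -
      obtain x where x: "x \<in> U - N" "v = y x" using v by (auto simp: S_def)
      then have "x \<in> \<Omega>1" "v \<in> V" using U by (auto simp: V_def)
      obtain \<delta> where \<delta>: "\<delta> > 0" "\<And>w. w \<in> ball (y x) \<delta> \<Longrightarrow> b * norm (z w - x) \<le> norm (w - y x)"
        using inverse_pointwise_lipschitz[OF hom \<open>open \<Omega>2\<close> \<open>x \<in> \<Omega>1\<close> D[OF x(1)], of 1 b] exp[OF x(1)] b by auto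
      obtain \<delta>' where \<delta>': "\<delta>' > 0" "ball v \<delta>' \<subseteq> V" using oV \<open>v \<in> V\<close> open_contains_ball by blast
      define r where "r = min (min \<delta> \<delta>') d / 2"
      have r: "0 < r" "r < \<delta>" "r < \<delta>'" "r < d" using \<delta> \<delta>' \<open>0 < d\<close> by (auto simp: r_def)
      have "z ` ball v r \<subseteq> ball (z v) (r / b)"
      proof
        fix u assume "u \<in> z ` ball v r"
        then obtain w where w: "u = z w" "w \<in> ball v r" by blast
        then have "b * norm (z w - x) \<le> norm (w - y x)" using \<delta>(2)[of w] r x by auto
        also have "\<dots> < r" using w x by (simp add: dist_norm norm_minus_commute)
        finally show "u \<in> ball (z v) (r / b)"
          using b zy[OF \<open>x \<in> \<Omega>1\<close>] w x by (simp add: dist_norm norm_minus_commute field_simps)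
      qed
      then have "(v, r) \<in> K" using r v \<delta>'(2) by (auto simp: K_def)
      with r show ?thesis by (intro exI[of _ "(v, r)"]) auto
    qed
    obtain C where C: "countable C" "C \<subseteq> K"
      "pairwise (\<lambda>i j. disjnt (ball (fst i) (snd i)) (ball (fst j) (snd j))) C"
      "negligible (S - (\<Union>i\<in>C. ball (fst i) (snd i)))"
      by (rule Vitali_covering_theorem_balls[of S K fst snd, OF cover]) (assumption | rule that)+
    let ?b = "\<lambda>i::'a \<times> real. ball (fst i) (snd i)"
    let ?B = "\<lambda>i::'a \<times> real. ball (z (fst i)) (snd i / b)"
    \<comment> \<open>The points whose images are missed by the Vitali family. The image of
      \<open>R\<close> is null, and \<open>negligible_homeomorphism_preimage\<close> transfers this
      to \<open>R\<close>.\<close>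
    define R where "R = {x \<in> U - N. y x \<notin> (\<Union>i\<in>C. ?b i)}"
    have "negligible R"
    proof (rule negligible_homeomorphism_preimage[OF hom \<open>open \<Omega>2\<close>])
      show "R \<subseteq> \<Omega>1" using U by (auto simp: R_def)
      show "(y has_derivative D x) (at x)" if "x \<in> R" for x using that D by (simp add: R_def)
      show "\<exists>c>0. \<forall>h. c * norm h \<le> norm (D x h)" if "x \<in> R" for x
        using that exp by (intro exI[of _ 1]) (auto simp: R_def)
      have "y ` R \<subseteq> S - (\<Union>i\<in>C. ?b i)" by (auto simp: R_def S_def)
      then show "negligible (y ` R)" using C(4) negligible_subset by blast
    qed
    then have NR: "N \<union> R \<in> null_sets lebesgue"
      using N by (simp add: negligible_iff_null_sets null_sets.Un)
    have "open (\<Union>i\<in>C. ?B i)" by (intro open_UN ballI open_ball)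
    then have W: "(\<Union>i\<in>C. ?B i) \<in> sets lebesgue" by simp
    have "U \<subseteq> (\<Union>i\<in>C. ?B i) \<union> (N \<union> R)"
    proof
      fix x assume "x \<in> U"
      show "x \<in> (\<Union>i\<in>C. ?B i) \<union> (N \<union> R)"
      proof (cases "x \<in> N \<union> R")
        case False
        then obtain i where i: "i \<in> C" "y x \<in> ?b i" using \<open>x \<in> U\<close> by (auto simp: R_def)
        then have "i \<in> K" using C(2) by blast
        then have "z ` ?b i \<subseteq> ?B i" by (auto simp: K_def split: prod.splits)
        moreover have "z (y x) = x" using zy \<open>x \<in> U\<close> U by blast
        ultimately have "x \<in> ?B i" using i(2) by (metis image_subset_iff)
        with i(1) show ?thesis by blast
      qed simp
    qed
    then have "emeasure lebesgue U \<le> emeasure lebesgue ((\<Union>i\<in>C. ?B i) \<union> (N \<union> R))"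
      using W NR by (intro emeasure_mono) auto
    also have "\<dots> = emeasure lebesgue (\<Union>i\<in>C. ?B i)"
      by (rule emeasure_Un_null_set[OF W NR])
    also have "\<dots> \<le> (\<integral>\<^sup>+i. emeasure lebesgue (?B i) \<partial>count_space C)"
      by (rule emeasure_UN_le_count_space) (use C(1) in auto)
    also have "\<dots> = (\<integral>\<^sup>+i. ennreal ((1 / b) ^ DIM('a)) * emeasure lebesgue (?b i) \<partial>count_space C)"
    proof (intro nn_integral_cong)
      fix i assume "i \<in> space (count_space C)"
      then have "snd i > 0" using C(2) by (auto simp: K_def)
      then show "emeasure lebesgue (?B i) = ennreal ((1 / b) ^ DIM('a)) * emeasure lebesgue (?b i)"
        using b by (simp add: emeasure_ball power_divide mult_ac flip: ennreal_mult)
    qed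
    also have "\<dots> = ennreal ((1 / b) ^ DIM('a)) * (\<integral>\<^sup>+i. emeasure lebesgue (?b i) \<partial>count_space C)"
      by (rule nn_integral_cmult) auto
    also have "(\<integral>\<^sup>+i. emeasure lebesgue (?b i) \<partial>count_space C) = emeasure lebesgue (\<Union>i\<in>C. ?b i)"
      using C(1,3) by (intro emeasure_UN_countable[symmetric])
        (auto simp: pairwise_def disjoint_family_on_def disjnt_def)
    also have "\<dots> \<le> emeasure lebesgue V"
    proof (rule emeasure_mono)
      show "(\<Union>i\<in>C. ?b i) \<subseteq> V" using C(2) unfolding K_def by fastforce
    qed (use oV in simp)
    finally show ?thesis by (simp add: mult_left_mono)
  qed
  \<comment> \<open>Boundedness makes the volume of \<open>V\<close> a real number, so that the
    factor \<open>(1 / b) ^ DIM('a)\<close> can be removed by a limit of real numbers as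
    \<open>b\<close> tends to 1 from below.\<close>
  have "V \<subseteq> \<Omega>2" using hom U unfolding V_def homeomorphism_def by blast
  with \<open>bounded \<Omega>2\<close> have "bounded V" by (rule bounded_subset)
  then have "V \<in> lmeasurable" using oV by (intro bounded_set_imp_lmeasurable) auto
  then have V: "emeasure lebesgue V = ennreal (measure lebesgue V)"
    by (rule emeasure_eq_measure2)
  have "((\<lambda>b. ennreal ((1 / b) ^ DIM('a) * measure lebesgue V)) \<longlongrightarrow>
      ennreal ((1 / 1) ^ DIM('a) * measure lebesgue V)) (at_left 1)"
    by (intro tendsto_ennrealI tendsto_mult tendsto_const tendsto_power tendsto_divide tendsto_ident_at) simp
  moreover have "\<forall>\<^sub>F b in at_left 1. emeasure lebesgue U \<le> ennreal ((1 / b) ^ DIM('a) * measure lebesgue V)"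
    using le unfolding eventually_at_left_field V
    by (intro exI[of _ 0]) (auto simp: ennreal_mult)
  ultimately have "emeasure lebesgue U \<le> ennreal ((1 / 1) ^ DIM('a) * measure lebesgue V)"
    by (intro tendsto_lowerbound) auto
  then show ?thesis using V by (simp add: V_def)
qed

lemma measure_expanding_contraction_isometry:
  fixes y :: "'a::euclidean_space \<Rightarrow> 'a"
  assumes inj: "inj_on y (ball z R)"
    and lip: "\<And>a b. a \<in> ball z R \<Longrightarrow> b \<in> ball z R \<Longrightarrow> dist (y a) (y b) \<le> dist a b"
    and opn: "\<And>U. open U \<Longrightarrow> U \<subseteq> ball z R \<Longrightarrow> open (y ` U)"
    and vol: "\<And>U. open U \<Longrightarrow> U \<subseteq> ball z R \<Longrightarrow> emeasure lebesgue U \<le> emeasure lebesgue (y ` U)"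
    and a: "a \<in> ball z (R / 2)" and b: "b \<in> ball z (R / 2)"
  shows "dist (y a) (y b) = dist a b"
proof (rule ccontr)
  assume ne: "dist (y a) (y b) \<noteq> dist a b"
  have "R > 0" using a by (metis dist_not_less_zero half_gt_zero_iff mem_ball not_less_iff_gr_or_eq order_less_trans)
  have ab: "a \<in> ball z R" "b \<in> ball z R" using a b \<open>R > 0\<close> by auto
  with lip ne have lt: "dist (y a) (y b) < dist a b" by (simp add: order_less_le)
  define r where "r = dist a b / 2"
  have "r > 0" using lt by (simp add: r_def) (metis dist_nz dist_self less_irrefl)
  have "2 * r < R" using dist_triangle[of a b z] a b by (simp add: r_def dist_commute)
  \<comment> \<open>The centres are in the concentric ball of radius \<open>R / 2\<close> and
    satisfy |a - b| < R, hence \<open>r < R / 2\<close> and the touching balls fit into the large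
    one.\<close>
  have sub: "ball a r \<subseteq> ball z R" "ball b r \<subseteq> ball z R"
  proof -
    have "u \<in> ball z R" if "dist c u < r" "c \<in> ball z (R / 2)" for c u
      using dist_triangle[of z u c] that \<open>2 * r < R\<close> by simp
    with a b show "ball a r \<subseteq> ball z R" "ball b r \<subseteq> ball z R" by auto
  qed
  have disj: "ball a r \<inter> ball b r = {}"
  proof -
    have False if "dist a u < r" "dist b u < r" for u
      using dist_triangle[of a b u] that by (simp add: r_def dist_commute)
    then show ?thesis by auto
  qed
  define A where "A = y ` ball a r"
  define B where "B = y ` ball b r"
  have oAB: "open A" "open B" using opn sub by (auto simp: A_def B_def)
  have AB: "A \<inter> B = {}"
    using inj_on_image_Int[OF inj sub] disj by (simp add: A_def B_def)
  have subA: "A \<subseteq> ball (y a) r"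
  proof
    fix v assume "v \<in> A"
    then obtain u where u: "v = y u" "u \<in> ball a r" by (auto simp: A_def)
    with lip[OF ab(1), of u] sub(1) show "v \<in> ball (y a) r" by fastforce
  qed
  have subB: "B \<subseteq> ball (y b) r"
  proof
    fix v assume "v \<in> B"
    then obtain u where u: "v = y u" "u \<in> ball b r" by (auto simp: B_def)
    with lip[OF ab(2), of u] sub(2) show "v \<in> ball (y b) r" by fastforce
  qed
  \<comment> \<open>The overlap of the two target balls. It contains the midpoint of the centres
    because their distance is less than \<open>2 * r\<close>; being open and nonempty, it has
    positive volume, which is exactly the missing volume.\<close>
  define W where "W = ball (y a) r \<inter> ball (y b) r"
  define m where "m = emeasure lebesgue (ball (0::'a) r)"
  have m: "emeasure lebesgue (ball c r) = m" for c :: 'a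
    using \<open>r > 0\<close> by (simp add: m_def emeasure_ball)
  have "m \<noteq> top" using \<open>r > 0\<close> by (simp add: m_def emeasure_ball)
  have "midpoint (y a) (y b) \<in> W"
    using lt by (simp add: W_def r_def dist_midpoint)
  then have "W \<noteq> {}" "open W" by (auto simp: W_def)
  then have Wpos: "emeasure lebesgue W \<noteq> 0"
    using open_not_negligible[of W] by (auto simp: negligible_iff_null_sets null_sets_def)
  have "m + m \<le> emeasure lebesgue A + emeasure lebesgue B"
    using vol[of "ball a r"] vol[of "ball b r"] sub m unfolding A_def B_def by (intro add_mono) auto
  also have "\<dots> = emeasure lebesgue (A \<union> B)"
    using oAB AB by (intro plus_emeasure) auto
  also have "\<dots> \<le> emeasure lebesgue (ball (y a) r \<union> ball (y b) r)"
    using subA subB oAB by (intro emeasure_mono) auto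
  finally have 1: "m + m \<le> emeasure lebesgue (ball (y a) r \<union> ball (y b) r)" .
  have "emeasure lebesgue (ball (y a) r \<union> ball (y b) r) + emeasure lebesgue W = m + m"
    unfolding W_def using emeasure_Un_Int[of "ball (y a) r" lebesgue "ball (y b) r"] by (simp add: m)
  then have "(m + m) + emeasure lebesgue W \<le> m + m"
    using 1 by (metis add_right_mono)
  then show False using Wpos \<open>m \<noteq> top\<close>
    by (metis add.right_neutral ennreal_add_left_cancel_le ennreal_add_eq_top le_zero_eq)
qed

text \<open>Polarisation: after translation \<open>f\<close> fixes 0 and preserves norms and
  distances, hence inner products. The images of scaled axis vectors give an orthonormal family
  \<open>E\<close>, and \<open>f w\<close> minus its expansion in \<open>E\<close> has norm
  0.\<close>

lemma isometry_on_ball_affine: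
  fixes y :: "real^'n \<Rightarrow> real^'n"
  assumes "\<rho> > 0"
    and iso: "\<And>a b. a \<in> ball z \<rho> \<Longrightarrow> b \<in> ball z \<rho> \<Longrightarrow> dist (y a) (y b) = dist a b"
  shows "\<exists>A. \<forall>x\<in>ball z \<rho>. y x = y z + A *v (x - z)"
proof -
  define f where "f w = y (z + w) - y z" for w
  have fdiff: "norm (f w - f w') = norm (w - w')" if "norm w < \<rho>" "norm w' < \<rho>" for w w'
    using iso[of "z + w" "z + w'"] that by (simp add: f_def dist_norm)
  have f0: "f 0 = 0" by (simp add: f_def)
  have fnorm: "norm (f w) = norm w" if "norm w < \<rho>" for w
    using fdiff[OF that, of 0] \<open>\<rho> > 0\<close> f0 by simp
  have inner: "f w \<bullet> f w' = w \<bullet> w'" if "norm w < \<rho>" "norm w' < \<rho>" for w w'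
    unfolding dot_norm_neg fdiff[OF that] fnorm[OF that(1)] fnorm[OF that(2)] ..
  \<comment> \<open>The unit axis vectors may lie outside the ball; multiples by
    \<open>\<rho> / 2\<close> lie inside and are rescaled in \<open>E\<close>.\<close>
  define t where "t = \<rho> / 2"
  have t: "t > 0" "t < \<rho>" using \<open>\<rho> > 0\<close> by (auto simp: t_def)
  define E where "E i = f (t *\<^sub>R axis i 1) /\<^sub>R t" for i
  have nt: "norm (t *\<^sub>R axis i (1::real)) < \<rho>" for i :: 'n using t by simp
  have EE: "E i \<bullet> E j = (if i = j then 1 else 0)" for i j
    unfolding E_def using t by (simp add: inner[OF nt nt] inner_axis_axis field_simps)
  have fE: "f w \<bullet> E i = w $ i" if "norm w < \<rho>" for w i
    unfolding E_def using t by (simp add: inner[OF that nt] inner_axis)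
  have fw: "f w = (\<Sum>i\<in>UNIV. w $ i *\<^sub>R E i)" if w: "norm w < \<rho>" for w
  proof -
    let ?s = "\<Sum>i\<in>UNIV. w $ i *\<^sub>R E i"
    have ww: "w \<bullet> w = (\<Sum>i\<in>UNIV. w $ i * w $ i)" by (simp add: inner_vec_def)
    have "f w \<bullet> ?s = w \<bullet> w" by (simp add: inner_sum_right fE[OF w] ww)
    moreover have "?s \<bullet> ?s = w \<bullet> w"
      by (simp add: inner_sum_right inner_sum_left EE ww if_distrib sum.delta cong: if_cong)
    ultimately have "(f w - ?s) \<bullet> (f w - ?s) = 0"
      using inner[OF w w] by (simp add: inner_diff_left inner_diff_right inner_commute)
    then show ?thesis by simp
  qed
  define A where "A = (\<chi> i j. E j $ i)"
  show ?thesis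
  proof (intro exI[of _ A] ballI)
    fix x assume x: "x \<in> ball z \<rho>"
    then have "norm (x - z) < \<rho>" by (simp add: dist_norm norm_minus_commute)
    from fw[OF this] have "y x - y z = (\<Sum>i\<in>UNIV. (x - z) $ i *\<^sub>R E i)" by (simp add: f_def)
    also have "\<dots> = A *v (x - z)"
      by (simp add: A_def matrix_vector_mult_def vec_eq_iff mult_ac)
    finally show "y x = y z + A *v (x - z)" by (simp add: algebra_simps)
  qed
qed

text \<open>Two locally constant functions on a connected set: the linear part, and then
  \<open>y\<close> minus that linear part.\<close>

lemma locally_affine_imp_affine:
  fixes y :: "real^'n \<Rightarrow> real^'n"
  assumes "connected U" "open U"
    and loc: "\<And>z. z \<in> U \<Longrightarrow> \<exists>R>0. \<exists>A. \<forall>x\<in>ball z R. y x = y z + A *v (x - z)"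
  shows "\<exists>a A. \<forall>x\<in>U. y x = a + A *v x"
proof (cases "U = {}")
  case False
  then obtain x0 where x0: "x0 \<in> U" by blast
  \<comment> \<open>The derivative singles out the local matrix as a function of the point, so that
    matrices on overlapping balls agree without comparing them.\<close>
  define D where "D x = matrix (frechet_derivative y (at x))" for x
  have locD: "\<exists>R>0. \<exists>A. (\<forall>x\<in>ball z R. y x = y z + A *v (x - z)) \<and> (\<forall>x\<in>ball z R. D x = A)" if "z \<in> U" for z
  proof -
    obtain R A where A: "R > 0" "\<And>x. x \<in> ball z R \<Longrightarrow> y x = y z + A *v (x - z)"
      using loc[OF \<open>z \<in> U\<close>] by blast
    have "D x = A" if x: "x \<in> ball z R" for x
    proof -
      have "((\<lambda>x. y z + A *v (x - z)) has_derivative (\<lambda>h. A *v h)) (at x)"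
        by (auto intro!: derivative_eq_intros bounded_linear.has_derivative[OF matrix_vector_mul_bounded_linear])
      then have "(y has_derivative (\<lambda>h. A *v h)) (at x)"
        by (rule has_derivative_transform_within_open[of _ _ _ _ "ball z R"]) (use x A(2) in auto)
      then show ?thesis
        unfolding D_def by (metis frechet_derivative_at matrix_of_matrix_vector_mul)
    qed
    with A show ?thesis by blast
  qed
  have Dconst: "D x = D x0" if "x \<in> U" for x
  proof (rule connected_local_const[OF \<open>connected U\<close> that x0], intro ballI)
    fix a assume "a \<in> U"
    then obtain R A where "R > 0" "\<forall>x\<in>ball a R. D x = A" using locD by blast
    then show "\<forall>\<^sub>F b in at a within U. D a = D b"
      unfolding eventually_at by (intro exI[of _ R]) (auto simp: dist_commute)
  qed
  have "y x - D x0 *v x = y x0 - D x0 *v x0" if "x \<in> U" for x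
  proof (rule connected_local_const[OF \<open>connected U\<close> that x0], intro ballI)
    fix a assume "a \<in> U"
    then obtain R A where R: "R > 0" "\<forall>x\<in>ball a R. y x = y a + A *v (x - a)" "\<forall>x\<in>ball a R. D x = A"
      using locD by blast
    then have "A = D x0" using Dconst[OF \<open>a \<in> U\<close>] by auto
    have "y a - D x0 *v a = y b - D x0 *v b" if "dist b a < R" for b
      using R(2) that \<open>A = D x0\<close> by (simp add: dist_commute matrix_vector_mult_diff_distrib)
    then show "\<forall>\<^sub>F b in at a within U. y a - D x0 *v a = y b - D x0 *v b"
      unfolding eventually_at using \<open>R > 0\<close> by (intro exI[of _ R]) auto
  qed
  then show ?thesis
    by (intro exI[of _ "y x0 - D x0 *v x0"] exI[of _ "D x0"] ballI) (metis diff_add_cancel)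
qed simp

subsection \<open>Sobolev homeomorphisms\<close>

lemma AE_lebesgue_on_iff_negligible:
  fixes U :: "'a::euclidean_space set"
  assumes "open U"
  shows "(AE x in lebesgue_on U. P x) \<longleftrightarrow> (\<exists>N. negligible N \<and> (\<forall>x\<in>U - N. P x))"
proof -
  have "(AE x in lebesgue_on U. P x) \<longleftrightarrow> (AE x in lebesgue. x \<in> U \<longrightarrow> P x)"
    using assms by (intro AE_restrict_space_iff) simp
  also have "\<dots> \<longleftrightarrow> (\<exists>N. negligible N \<and> (\<forall>x\<in>U - N. P x))"
  proof
    assume "AE x in lebesgue. x \<in> U \<longrightarrow> P x"
    then obtain N where "{x \<in> space lebesgue. \<not> (x \<in> U \<longrightarrow> P x)} \<subseteq> N" "N \<in> null_sets lebesgue"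
      by (auto simp: eventually_ae_filter)
    then show "\<exists>N. negligible N \<and> (\<forall>x\<in>U - N. P x)"
      by (intro exI[of _ N]) (auto simp: negligible_iff_null_sets)
  next
    assume "\<exists>N. negligible N \<and> (\<forall>x\<in>U - N. P x)"
    then obtain N where "negligible N" "\<forall>x\<in>U - N. P x" by blast
    then show "AE x in lebesgue. x \<in> U \<longrightarrow> P x"
      by (intro AE_I'[of N]) (auto simp: negligible_iff_null_sets)
  qed
  finally show ?thesis .
qed

text \<open>Axis vectors \<open>w\<close> give the rows of the gradient. A unit vector in the
  direction of \<open>y b - y a\<close> turns the scalar Lipschitz bound into one for
  \<open>y\<close> with the same constant.\<close>

lemma has_weak_gradient_inner:
  fixes y :: "real^'n \<Rightarrow> real^'k"
  assumes "open U" and G: "has_weak_gradient U y G"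
  shows "weak_grad U (\<lambda>x. w \<bullet> y x) (\<lambda>x. w v* G x)"
  unfolding weak_grad_def
proof (intro conjI allI impI)
  have loc: "y locally_integrable_on U" "G locally_integrable_on U"
    using G by (auto simp: has_weak_gradient_def)
  show "(\<lambda>x. w \<bullet> y x) locally_integrable_on U"
    by (rule locally_integrable_on_linear[OF bounded_linear_inner_right loc(1)])
  have "linear (\<lambda>M::real^'n^'k. w v* M)"
    by (rule linearI) (simp_all add: vector_matrix_mult_def vec_eq_iff sum.distrib sum_distrib_left algebra_simps)
  then show "(\<lambda>x. w v* G x) locally_integrable_on U"
    by (intro locally_integrable_on_linear[OF _ loc(2)]) (simp add: linear_conv_bounded_linear)
  note yi = locally_integrable_on_linear[OF bounded_linear_vec_nth loc(1)]
  have Gij: "(\<lambda>x. G x $ i $ j) locally_integrable_on U" for i j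
    by (rule locally_integrable_on_linear[OF bounded_linear_compose[OF bounded_linear_vec_nth bounded_linear_vec_nth] loc(2)])
  fix \<phi> :: "real^'n \<Rightarrow> real" and j assume \<phi>: "test_function U \<phi>"
  have "(LINT x|lebesgue_on U. (w \<bullet> y x) * partial_deriv j \<phi> x) =
      (LINT x|lebesgue_on U. (\<Sum>i\<in>UNIV. w $ i * (y x $ i * partial_deriv j \<phi> x)))"
    by (simp add: inner_vec_def sum_distrib_left sum_distrib_right mult_ac)
  also have "\<dots> = (\<Sum>i\<in>UNIV. w $ i * (LINT x|lebesgue_on U. y x $ i * partial_deriv j \<phi> x))"
    using integrable_mult_test_function(2)[OF \<open>open U\<close> yi \<phi>] by simp
  also have "\<dots> = - (\<Sum>i\<in>UNIV. w $ i * (LINT x|lebesgue_on U. G x $ i $ j * \<phi> x))"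
    using G \<phi> by (simp add: has_weak_gradient_def sum_negf)
  also have "\<dots> = - (LINT x|lebesgue_on U. (\<Sum>i\<in>UNIV. w $ i * (G x $ i $ j * \<phi> x)))"
    using integrable_mult_test_function(1)[OF \<open>open U\<close> Gij \<phi>] by simp
  also have "\<dots> = - (LINT x|lebesgue_on U. (w v* G x) $ j * \<phi> x)"
    by (simp add: vector_matrix_mult_def sum_distrib_left sum_distrib_right mult_ac)
  finally show "(LINT x|lebesgue_on U. (w \<bullet> y x) * partial_deriv j \<phi> x) =
      - (LINT x|lebesgue_on U. (w v* G x) $ j * \<phi> x)" .
qed

lemma axis_inner_row:
  fixes M :: "real^'n^'k"
  shows "axis i 1 \<bullet> v = v $ i" "axis i 1 v* M = M $ i"
proof -
  show "axis i 1 \<bullet> v = v $ i" by (simp add: inner_axis')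
  show "axis i 1 v* M = M $ i"
    by (simp add: vector_matrix_mult_def vec_eq_iff axis_def if_distrib if_distribR cong: if_cong)
qed

lemma has_weak_gradient_row:
  fixes y :: "real^'n \<Rightarrow> real^'k"
  assumes "open U" "has_weak_gradient U y G"
  shows "weak_grad U (\<lambda>x. y x $ i) (\<lambda>x. G x $ i)"
  using has_weak_gradient_inner[OF assms, of "axis i 1"] by (simp add: axis_inner_row)

lemma has_weak_gradient_unique:
  fixes y :: "real^'n \<Rightarrow> real^'k"
  assumes U: "open U" and G: "has_weak_gradient U y G" "has_weak_gradient U y G'"
  shows "\<exists>N. negligible N \<and> (\<forall>x\<in>U - N. G x = G' x)"
proof -
  have "\<forall>i. \<exists>N. negligible N \<and> (\<forall>x\<in>U - N. G x $ i = G' x $ i)"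
    using weak_grad_unique[OF U has_weak_gradient_row[OF U G(1)] has_weak_gradient_row[OF U G(2)]] by blast
  then obtain N where N: "\<And>i. negligible (N i)" "\<And>i x. x \<in> U - N i \<Longrightarrow> G x $ i = G' x $ i"
    by metis
  have "negligible (\<Union>i. N i)" by (intro negligible_Union) (use N(1) in auto)
  moreover have "G x = G' x" if "x \<in> U - (\<Union>i. N i)" for x
  proof -
    have "G x $ i = G' x $ i" for i using that by (intro N(2)) auto
    then show ?thesis by (simp add: vec_eq_iff)
  qed
  ultimately show ?thesis by blast
qed

text \<open>Makes the choice operator in \<open>weak_gradient\<close> harmless: once some weak
  gradient exists, the chosen one is a weak gradient and agrees with it off a null set.\<close>

lemma weak_gradient_eq:
  assumes "open U" "has_weak_gradient U y G"
  shows "has_weak_gradient U y (weak_gradient U y)"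
    and "\<exists>N. negligible N \<and> (\<forall>x\<in>U - N. weak_gradient U y x = G x)"
proof -
  show *: "has_weak_gradient U y (weak_gradient U y)"
    unfolding weak_gradient_def using assms(2) by (rule someI[of "has_weak_gradient U y"])
  show "\<exists>N. negligible N \<and> (\<forall>x\<in>U - N. weak_gradient U y x = G x)"
    by (rule has_weak_gradient_unique[OF assms(1) * assms(2)])
qed

lemma has_weak_gradient_affine:
  fixes A :: "real^'n^'k"
  assumes U: "open U" and y: "\<And>x. x \<in> U \<Longrightarrow> y x = a + A *v x"
  shows "has_weak_gradient U y (\<lambda>x. A)"
  unfolding has_weak_gradient_def
proof (intro conjI allI impI)
  have "continuous_on U (\<lambda>x. a + A *v x)"
    by (intro continuous_intros matrix_vector_mult_linear_continuous_on)
  then have "continuous_on U y" using y by (simp cong: continuous_on_cong)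
  then show "y locally_integrable_on U" by (rule continuous_imp_locally_integrable_on)
  show "(\<lambda>x. A) locally_integrable_on U" by (rule locally_integrable_on_const)
  fix \<phi> :: "real^'n \<Rightarrow> real" and i j assume \<phi>: "test_function U \<phi>"
  have "(LINT x|lebesgue_on U. y x $ i * partial_deriv j \<phi> x) =
      (LINT x|lebesgue_on U. (A $ i \<bullet> x + a $ i) * partial_deriv j \<phi> x)"
    by (intro Bochner_Integration.integral_cong) (auto simp: y matrix_vector_mul_component)
  then show "(LINT x|lebesgue_on U. y x $ i * partial_deriv j \<phi> x) = - (LINT x|lebesgue_on U. A $ i $ j * \<phi> x)"
    using weak_grad_affine[OF U, of "A $ i" "a $ i"] \<phi> by (simp add: weak_grad_def)
qed

text \<open>Each row of an L^p gradient has finite p-th power integral over every compact subset, so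
  Morrey's theorem applies to each component. Countably many exceptional sets, including the one for
  the choice of gradient, are merged.\<close>

lemma W1p_differentiable_ae:
  fixes y :: "real^'n \<Rightarrow> real^'k"
  assumes U: "open U" and cont: "continuous_on U y" and W: "in_W1p p U y" and p: "p > real CARD('n)"
  shows "\<exists>N. negligible N \<and> (\<forall>x\<in>U - N. (y has_derivative (\<lambda>h. weak_gradient U y x *v h)) (at x))"
proof -
  have "p > 0" using p by (meson less_le_trans not_le of_nat_0_le_iff)
  obtain G where G: "has_weak_gradient U y G" "in_Lp p U G"
    using W by (auto simp: in_W1p_def)
  have fin: "(\<integral>\<^sup>+u\<in>C. ennreal (norm (G u $ i) powr p) \<partial>lebesgue) < \<infinity>" if "C \<subseteq> U" for C i
  proof -
    have "(\<integral>\<^sup>+u\<in>C. ennreal (norm (G u $ i) powr p) \<partial>lebesgue) \<le>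
        (\<integral>\<^sup>+u. ennreal (norm (G u) powr p) * indicator U u \<partial>lebesgue)"
      using that \<open>p > 0\<close>
      by (intro nn_integral_mono) (auto simp: indicator_def intro!: ennreal_leI powr_mono2 Finite_Cartesian_Product.norm_nth_le)
    also have "\<dots> = (\<integral>\<^sup>+u. ennreal (norm (G u) powr p) \<partial>lebesgue_on U)"
      using U by (intro nn_integral_restrict_space[symmetric]) simp
    also have "\<dots> < \<infinity>"
      using G(2) by (simp add: in_Lp_def integrable_iff_bounded)
    finally show ?thesis .
  qed
  have "\<forall>i. \<exists>N. negligible N \<and> (\<forall>x\<in>U - N. ((\<lambda>x. y x $ i) has_derivative (\<lambda>h. G x $ i \<bullet> h)) (at x))"
  proof
    fix i
    show "\<exists>N. negligible N \<and> (\<forall>x\<in>U - N. ((\<lambda>x. y x $ i) has_derivative (\<lambda>h. G x $ i \<bullet> h)) (at x))"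
      by (rule weak_grad_differentiable_ae[OF U has_weak_gradient_row[OF U G(1)] _ p fin])
        (intro continuous_intros cont)
  qed
  then obtain N where N: "\<And>i. negligible (N i)"
      "\<And>i x. x \<in> U - N i \<Longrightarrow> ((\<lambda>x. y x $ i) has_derivative (\<lambda>h. G x $ i \<bullet> h)) (at x)"
    by metis
  obtain N' where N': "negligible N'" "\<And>x. x \<in> U - N' \<Longrightarrow> weak_gradient U y x = G x"
    using weak_gradient_eq(2)[OF U G(1)] by blast
  have "negligible (\<Union>i. N i)" by (intro negligible_Union) (use N(1) in auto)
  then have "negligible ((\<Union>i. N i) \<union> N')" using N'(1) by (rule negligible_Un)
  moreover have "(y has_derivative (\<lambda>h. weak_gradient U y x *v h)) (at x)"
    if x: "x \<in> U - ((\<Union>i. N i) \<union> N')" for x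
  proof -
    have wG: "weak_gradient U y x = G x" using N'(2) x by blast
    show ?thesis
      unfolding wG has_derivative_componentwise_within[of y]
    proof
      fix b :: "real^'k" assume "b \<in> Basis"
      then obtain i where b: "b = axis i 1" by (auto simp: Basis_vec_def)
      have "((\<lambda>x. y x $ i) has_derivative (\<lambda>h. G x $ i \<bullet> h)) (at x)" using x by (intro N(2)) auto
      then show "((\<lambda>x. y x \<bullet> b) has_derivative (\<lambda>h. (G x *v h) \<bullet> b)) (at x)"
        by (simp add: b inner_axis matrix_vector_mul_component)
    qed
  qed
  ultimately show ?thesis by blast
qed

section \<open>Composition with Lebesgue measurable maps, and rotation matrices\<close>

lemma matrix_det_nz_bounded_below:
  fixes A :: "real^'n^'n"
  assumes "det A \<noteq> 0"
  shows "\<exists>c>0. \<forall>h. c * norm h \<le> norm (A *v h)"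
proof -
  have "inj ((*v) A)" using assms by (intro inj_matrix_vector_mult) (simp add: invertible_det_nz)
  then show ?thesis
    using linear_inj_bounded_below_pos[OF matrix_vector_mul_linear] by metis
qed

lemma fsigma_borel: "fsigma F \<Longrightarrow> F \<in> sets borel"
  by (induction rule: fsigma.induct) (auto intro: borel_closed)

text \<open>A Lebesgue set is an F-sigma set together with a null set. Continuity of
  \<open>y\<close> handles the first part; the second is pulled back to a null set by the lower
  bound on the derivative.\<close>

lemma measurable_compose_homeomorphism:
  fixes y z :: "'a::euclidean_space \<Rightarrow> 'a" and c :: "'a \<Rightarrow> 'b::euclidean_space"
  assumes hom: "homeomorphism U1 U2 y z" and U: "open U1" "open U2" and N: "negligible N"
    and D: "\<And>x. x \<in> U1 - N \<Longrightarrow> (y has_derivative D x) (at x)"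
    and inj: "\<And>x. x \<in> U1 - N \<Longrightarrow> \<exists>c>0. \<forall>h. c * norm h \<le> norm (D x h)"
    and c: "c \<in> borel_measurable (lebesgue_on U2)"
  shows "(\<lambda>x. c (y x)) \<in> borel_measurable (lebesgue_on U1)"
proof (rule measurableI)
  fix B :: "'b set" assume "B \<in> sets borel"
  then have "c -` B \<inter> U2 \<in> sets lebesgue"
    using measurable_sets[OF c, of B] U by (simp add: sets_restrict_space_iff)
  then obtain F M where F: "fsigma F" and M: "M \<in> null_sets lebesgue" and FM: "F \<union> M = c -` B \<inter> U2"
    using lebesgue_set_almost_fsigma by metis
  have img: "y ` U1 = U2" using hom by (simp add: homeomorphism_def)
  have "y -` F \<inter> U1 \<in> sets lebesgue"
  proof -
    have "y \<in> borel_measurable (lebesgue_on U1)"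
      using hom U(1) by (intro continuous_imp_measurable_on_sets_lebesgue) (auto simp: homeomorphism_def)
    then show ?thesis
      using measurable_sets[of y "lebesgue_on U1" borel F] fsigma_borel[OF F] U(1)
      by (simp add: sets_restrict_space_iff)
  qed
  moreover have "negligible (y -` M \<inter> U1)"
  proof -
    have "negligible {x \<in> U1 - N. y x \<in> M}"
    proof (rule negligible_homeomorphism_preimage[OF hom U(2)])
      show "negligible (y ` {x \<in> U1 - N. y x \<in> M})"
        by (rule negligible_subset[of M]) (use M in \<open>auto simp: negligible_iff_null_sets\<close>)
    qed (use D inj in auto)
    then have "negligible ({x \<in> U1 - N. y x \<in> M} \<union> N)" using N by (rule negligible_Un)
    then show ?thesis by (rule negligible_subset) auto
  qed
  then have "y -` M \<inter> U1 \<in> sets lebesgue" by (rule negligible_imp_sets)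
  ultimately have "(y -` F \<inter> U1) \<union> (y -` M \<inter> U1) \<in> sets lebesgue" by (rule sets.Un)
  also have "(y -` F \<inter> U1) \<union> (y -` M \<inter> U1) = (\<lambda>x. c (y x)) -` B \<inter> U1"
    using FM img by auto
  finally show "(\<lambda>x. c (y x)) -` B \<inter> space (lebesgue_on U1) \<in> sets (lebesgue_on U1)"
    using U(1) by (simp add: sets_restrict_space_iff)
qed simp

lemma rotation_matrix_norm:
  fixes A :: "real^'n^'n"
  assumes "rotation_matrix A"
  shows "norm (A *v h) = norm h"
proof -
  have "transpose A ** A = mat 1" using assms by (simp add: rotation_matrix_def orthogonal_matrix_def)
  then have "((A *v h) v* A) \<bullet> h = h \<bullet> h"
    by (simp flip: transpose_matrix_vector add: matrix_vector_mul_assoc)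
  then show ?thesis by (simp add: dot_lmul_matrix norm_eq)
qed

lemma rotation_matrix_norm_transpose_le:
  fixes A :: "real^'n^'n"
  assumes "rotation_matrix A"
  shows "norm (w v* A) \<le> norm w"
proof -
  have "(norm (w v* A))\<^sup>2 = w \<bullet> (A *v (w v* A))"
    by (simp add: power2_norm_eq_inner dot_lmul_matrix)
  also have "\<dots> \<le> norm w * norm (w v* A)"
    using norm_cauchy_schwarz[of w "A *v (w v* A)"] by (simp add: rotation_matrix_norm[OF assms])
  finally show ?thesis
    by (cases "norm (w v* A) = 0") (auto simp: power2_eq_square)
qed

text \<open>Orthogonality of \<open>G x\<close> is used on both sides: \<open>w v* G x\<close> is no
  longer than \<open>w\<close>, which makes \<open>y\<close> contract distances, and
  \<open>G x *v h\<close> is as long as \<open>h\<close>, which keeps volumes from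
  shrinking.\<close>

lemma weak_gradient_rotation_imp_rigid:
  fixes y :: "real^'n \<Rightarrow> real^'n"
  assumes hom: "homeomorphism \<Omega>1 \<Omega>2 y z" and \<Omega>: "open \<Omega>1" "open \<Omega>2" "connected \<Omega>1" "\<Omega>1 \<noteq> {}" "bounded \<Omega>2"
    and wg: "has_weak_gradient \<Omega>1 y G" and N: "negligible N"
    and D: "\<And>x. x \<in> \<Omega>1 - N \<Longrightarrow> (y has_derivative (\<lambda>h. G x *v h)) (at x)"
    and rot: "\<And>x. x \<in> \<Omega>1 - N \<Longrightarrow> rotation_matrix (G x)"
  shows "\<exists>E. rigid_transformation E \<and> (\<forall>x\<in>\<Omega>1. y x = E x)"
proof -
  have cont: "continuous_on \<Omega>1 y" and inj: "inj_on y \<Omega>1"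
    using hom by (auto simp: homeomorphism_def inj_on_def) metis
  have local: "\<exists>\<rho>>0. \<exists>A. \<forall>x\<in>ball z0 \<rho>. y x = y z0 + A *v (x - z0)" if z0: "z0 \<in> \<Omega>1" for z0
  proof -
    obtain c d where cd: "cbox c d \<subseteq> \<Omega>1" "z0 \<in> box c d"
      using open_contains_cbox[OF \<Omega>(1) z0] by metis
    obtain \<rho>' where \<rho>': "\<rho>' > 0" "ball z0 \<rho>' \<subseteq> cbox c d"
      using cd(2) open_box[of c d] open_contains_ball[of "box c d"] box_subset_cbox[of c d] by blast
    define \<rho> where "\<rho> = \<rho>' / 6"
    have \<rho>: "\<rho> > 0" "ball z0 (6 * \<rho>) \<subseteq> cbox c d" using \<rho>' by (auto simp: \<rho>_def)
    have "ball z0 \<rho> \<subseteq> ball z0 (6 * \<rho>)" using \<rho>(1) by (intro subset_ball) simp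
    then have sub: "ball z0 \<rho> \<subseteq> \<Omega>1" using \<rho>(2) cd(1) by blast
    have lip: "dist (y a) (y b) \<le> dist a b" if ab: "a \<in> ball z0 \<rho>" "b \<in> ball z0 \<rho>" for a b
    proof (cases "y a = y b")
      case False
      \<comment> \<open>The scalar function \<open>w \<bullet> y x\<close> realises the full
        distance between \<open>y a\<close> and \<open>y b\<close>. Estimating components separately
        would lose a dimensional constant.\<close>
      define w where "w = (y b - y a) /\<^sub>R norm (y b - y a)"
      have "norm w = 1" using False by (simp add: w_def)
      have "AE u in lebesgue_on \<Omega>1. norm (w v* G u) \<le> 1"
        unfolding AE_lebesgue_on_iff_negligible[OF \<Omega>(1)]
        using N rot rotation_matrix_norm_transpose_le \<open>norm w = 1\<close> by metis
      from weak_grad_lipschitz[OF \<Omega>(1) has_weak_gradient_inner[OF \<Omega>(1) wg] _ this cd(1) \<rho>(2) ab]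
      have "\<bar>w \<bullet> y b - w \<bullet> y a\<bar> \<le> dist a b" by (simp add: continuous_on_inner cont)
      moreover have "w \<bullet> y b - w \<bullet> y a = norm (y b - y a)"
      proof -
        have "w \<bullet> y b - w \<bullet> y a = inverse (norm (y b - y a)) * ((y b - y a) \<bullet> (y b - y a))"
          by (simp add: w_def inner_diff_right algebra_simps)
        then show ?thesis
          using False by (simp add: power2_norm_eq_inner[symmetric] power2_eq_square)
      qed
      ultimately show ?thesis by (simp add: dist_norm norm_minus_commute)
    qed simp
    have iso: "dist (y a) (y b) = dist a b" if "a \<in> ball z0 (\<rho> / 2)" "b \<in> ball z0 (\<rho> / 2)" for a b
    proof (rule measure_expanding_contraction_isometry[OF _ lip _ _ that])
      show "inj_on y (ball z0 \<rho>)" by (rule inj_on_subset[OF inj sub])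
      fix U assume U: "open U" "U \<subseteq> ball z0 \<rho>"
      then have "U \<subseteq> \<Omega>1" using sub by blast
      show "open (y ` U)" by (rule homeomorphism_open_image[OF hom \<Omega>(2) U(1) \<open>U \<subseteq> \<Omega>1\<close>])
      show "emeasure lebesgue U \<le> emeasure lebesgue (y ` U)"
      proof (rule measure_le_expanding_image[OF hom \<Omega>(2,5) U(1) \<open>U \<subseteq> \<Omega>1\<close> N])
        fix x assume "x \<in> U - N"
        then have x: "x \<in> \<Omega>1 - N" using \<open>U \<subseteq> \<Omega>1\<close> by blast
        show "(y has_derivative (\<lambda>h. G x *v h)) (at x)" by (rule D[OF x])
        show "norm h \<le> norm (G x *v h)" for h by (simp add: rotation_matrix_norm[OF rot[OF x]])
      qed
    qed
    from isometry_on_ball_affine[OF _ iso] \<rho>(1) show ?thesis by (intro exI[of _ "\<rho> / 2"]) auto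
  qed
  obtain a A where A: "\<And>x. x \<in> \<Omega>1 \<Longrightarrow> y x = a + A *v x"
    using locally_affine_imp_affine[OF \<Omega>(3,1) local] by blast
  \<comment> \<open>A nonempty open set is not null, so there is a point where the derivative of
    \<open>y\<close> is both the global matrix \<open>A\<close> and the rotation
    \<open>G x\<close>.\<close>
  have "\<not> \<Omega>1 \<subseteq> N"
    using N open_not_negligible[OF \<Omega>(1,4)] negligible_subset by blast
  then obtain x where x: "x \<in> \<Omega>1 - N" by blast
  have "((\<lambda>x. a + A *v x) has_derivative (\<lambda>h. A *v h)) (at x)"
    by (auto intro!: derivative_eq_intros bounded_linear_imp_has_derivative matrix_vector_mul_bounded_linear)
  then have "(y has_derivative (\<lambda>h. A *v h)) (at x)"
    by (rule has_derivative_transform_within_open[of _ _ _ _ \<Omega>1]) (use x A \<Omega> in auto)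
  from has_derivative_unique[OF this D[OF x]] have "A = G x"
    by (metis matrix_of_matrix_vector_mul)
  then have "rotation_matrix A" using rot[OF x] by simp
  then show ?thesis
    using A by (intro exI[of _ "\<lambda>x. a + A *v x"]) (auto simp: rigid_transformation_def)
qed

subsection \<open>Convex bodies are Lipschitz domains\<close>

text \<open>Every competitor is \<open>L\<close>-Lipschitz in \<open>w\<close>, and an infimum of
  functions with a common Lipschitz constant keeps it; the lower bound \<open>m\<close> keeps the
  infimum finite.\<close>

lemma infimal_convolution_lipschitz:
  fixes f :: "'a::real_normed_vector \<Rightarrow> real" and P :: "'a \<Rightarrow> 'b::real_normed_vector"
  assumes "S \<noteq> {}" "L \<ge> 0" and m: "\<And>x. x \<in> S \<Longrightarrow> m \<le> f x"
  shows "L-lipschitz_on X (\<lambda>w. INF x\<in>S. f x + L * norm (w - P x))"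
proof (rule lipschitz_onI[OF _ \<open>L \<ge> 0\<close>])
  let ?g = "\<lambda>w. INF x\<in>S. f x + L * norm (w - P x)"
  have bdd: "bdd_below ((\<lambda>x. f x + L * norm (w - P x)) ` S)" for w
    using m \<open>L \<ge> 0\<close> by (intro bdd_belowI2[of _ m]) (simp add: add_increasing2)
  have le: "?g w - L * norm (w - w') \<le> ?g w'" for w w'
  proof (rule cINF_greatest[OF \<open>S \<noteq> {}\<close>])
    fix x assume x: "x \<in> S"
    have "norm (w - P x) \<le> norm (w - w') + norm (w' - P x)"
      using norm_triangle_ineq[of "w - w'" "w' - P x"] by simp
    then have "L * norm (w - P x) \<le> L * (norm (w - w') + norm (w' - P x))"
      using \<open>L \<ge> 0\<close> by (rule mult_left_mono)
    moreover have "?g w \<le> f x + L * norm (w - P x)" by (rule cINF_lower[OF bdd x])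
    ultimately show "?g w - L * norm (w - w') \<le> f x + L * norm (w' - P x)"
      by (simp add: distrib_left)
  qed
  show "dist (?g w) (?g w') \<le> L * dist w w'" for w w'
    using le[of w w'] le[of w' w] by (simp add: dist_real_def dist_norm norm_minus_commute abs_le_iff)
qed

text \<open>Near a boundary point a convex body has the interior cone property with respect to the
  direction of an interior point; the graph is the lower envelope of the cones with apex in the body.\<close>

lemma convex_imp_lipschitz_boundary:
  fixes C :: "(real^'n) set"
  assumes "open C" "convex C" "C \<noteq> {}"
  shows "lipschitz_boundary C"
  unfolding lipschitz_boundary_def
proof
  fix x0 assume x0: "x0 \<in> frontier C"
  obtain p where "p \<in> C" using assms by blast
  then obtain \<delta> where \<delta>: "\<delta> > 0" "ball p \<delta> \<subseteq> C" using assms open_contains_ball by blast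
  have "x0 \<notin> C" using x0 assms by (simp add: frontier_def interior_open)
  define len where "len = norm (p - x0)"
  have "len > 0" using \<open>p \<in> C\<close> \<open>x0 \<notin> C\<close> by (auto simp: len_def)
  define e where "e = (p - x0) /\<^sub>R len"
  have e: "norm e = 1" "p - x0 = len *\<^sub>R e" using \<open>len > 0\<close> by (auto simp: e_def len_def)
  have ee: "e \<bullet> e = 1" using e(1) by (simp add: norm_eq_1)
  define P where "P x = x - (x \<bullet> e) *\<^sub>R e" for x
  have P_diff: "P x - P x' = P (x - x')" for x x' by (simp add: P_def algebra_simps inner_diff_left)
  \<comment> \<open>The slope for which a cone with apex near \<open>x0\<close>, continued to height
    \<open>len\<close>, stays within \<delta> / 2 of its axis. The other half of \<delta> is left
    for the displacement of the apex from \<open>x0\<close>.\<close>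
  define L where "L = 2 * len / \<delta>"
  have "L > 0" using \<open>len > 0\<close> \<delta> by (simp add: L_def)
  \<comment> \<open>The bound \<delta> / 2 limits the displacement of the apex. The bound
    \<open>len / 2\<close> limits the height difference of two points in the ball to
    \<open>len\<close>, so that \<open>s \<le> 1\<close> below.\<close>
  define r where "r = min (\<delta> / 2) (len / 2)"
  have r: "r > 0" "r \<le> \<delta> / 2" "2 * r \<le> len" using \<delta> \<open>len > 0\<close> by (auto simp: r_def)
  have cone: "x' \<in> C" if x: "x \<in> C" "x \<in> ball x0 r" "x' \<in> ball x0 r"
    and v: "L * norm (P (x' - x)) < (x' - x) \<bullet> e" for x x'
  proof -
    define s where "s = ((x' - x) \<bullet> e) / len"
    have "(x' - x) \<bullet> e > 0" using v \<open>L > 0\<close> by (smt (verit) mult_nonneg_nonneg norm_ge_zero)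
    then have "s > 0" using \<open>len > 0\<close> by (simp add: s_def)
    have "(x' - x) \<bullet> e \<le> norm (x' - x)" using norm_cauchy_schwarz[of "x' - x" e] e by simp
    also have "norm (x' - x) \<le> dist x0 x' + dist x0 x"
      using dist_triangle3[of x' x x0] by (simp add: dist_norm)
    also have "\<dots> \<le> len" using x r by simp
    finally have "s \<le> 1" using \<open>len > 0\<close> by (simp add: s_def)
    \<comment> \<open>The segment from \<open>x\<close> through \<open>x'\<close> prolonged until
      its height above \<open>x\<close> is \<open>len\<close>. There it is within \<delta> of
      \<open>p\<close>, hence in \<open>C\<close>, and \<open>x'\<close> is a convex combination of
      \<open>x\<close> and \<open>q\<close>.\<close>
    define q where "q = x + (x' - x) /\<^sub>R s"
    have "q - p = (x - x0) + P (x' - x) /\<^sub>R s"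
    proof -
      have "((x' - x) \<bullet> e) = s * len" using \<open>len > 0\<close> by (simp add: s_def)
      then have "(x' - x) /\<^sub>R s = P (x' - x) /\<^sub>R s + len *\<^sub>R e"
        using \<open>s > 0\<close> by (simp add: P_def scaleR_diff_right)
      then show ?thesis using e(2) by (simp add: q_def algebra_simps)
    qed
    moreover have "norm (P (x' - x) /\<^sub>R s) < \<delta> / 2"
    proof -
      have "norm (P (x' - x)) * (2 * len) < \<delta> * ((x' - x) \<bullet> e)"
        using v \<delta> by (simp add: L_def field_simps)
      also have "\<dots> = \<delta> * (s * len)" using \<open>len > 0\<close> by (simp add: s_def)
      finally have "norm (P (x' - x)) * 2 < \<delta> * s" using \<open>len > 0\<close> by (simp add: mult_ac)
      then show ?thesis using \<open>s > 0\<close> by (simp add: field_simps)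
    qed
    moreover have "norm (x - x0) < \<delta> / 2" using x r by (simp add: dist_norm norm_minus_commute)
    ultimately have "norm (q - p) < \<delta>"
      using norm_triangle_ineq[of "x - x0" "P (x' - x) /\<^sub>R s"] by simp
    then have "q \<in> C" using \<delta>(2) by (auto simp: dist_norm norm_minus_commute)
    then have "(1 - s) *\<^sub>R x + s *\<^sub>R q \<in> C"
      using assms(2) x(1) \<open>s > 0\<close> \<open>s \<le> 1\<close> by (intro convexD) auto
    moreover have "(1 - s) *\<^sub>R x + s *\<^sub>R q = x'"
      using \<open>s > 0\<close> by (simp add: q_def algebra_simps)
    ultimately show ?thesis by simp
  qed
  define S where "S = C \<inter> ball x0 r"
  have "S \<noteq> {}"
  proof -
    have "x0 \<in> closure C" using x0 by (simp add: frontier_def)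
    then obtain x where "x \<in> C" "dist x x0 < r" using r(1) by (auto simp: closure_approachable)
    then have "x \<in> S" by (simp add: S_def dist_commute)
    then show ?thesis by blast
  qed
  have low: "x0 \<bullet> e - r \<le> x \<bullet> e" if "x \<in> S" for x
  proof -
    have "(x0 - x) \<bullet> e \<le> norm (x0 - x)" using norm_cauchy_schwarz[of "x0 - x" e] e by simp
    also have "\<dots> < r" using that by (simp add: S_def dist_norm)
    finally show ?thesis by (simp add: inner_diff_left)
  qed
  define g where "g w = (INF x\<in>S. x \<bullet> e + L * norm (w - P x))" for w
  have lip: "L-lipschitz_on X g" for X
    unfolding g_def using \<open>L > 0\<close> by (intro infimal_convolution_lipschitz[OF \<open>S \<noteq> {}\<close> _ low]) auto
  have bdd: "bdd_below ((\<lambda>x. x \<bullet> e + L * norm (w - P x)) ` S)" for w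
    using low \<open>L > 0\<close> by (intro bdd_belowI2[of _ "x0 \<bullet> e - r"]) (simp add: add_increasing2)
  have "x \<in> C \<longleftrightarrow> g (P x) < x \<bullet> e" if x: "x \<in> ball x0 r" for x
  proof
    assume "x \<in> C"
    have "open S" using assms by (simp add: S_def open_Int)
    moreover have "x \<in> S" using \<open>x \<in> C\<close> x by (simp add: S_def)
    \<comment> \<open>Strictness of the graph inequality: openness leaves room to lower
      \<open>x\<close> by \<open>t *\<^sub>R e\<close> inside \<open>S\<close>, and this lower point
      has the same projection.\<close>
    ultimately obtain t where t: "t > 0" "cball x t \<subseteq> S" using open_contains_cball by blast
    have xt: "x - t *\<^sub>R e \<in> S" using t e by (intro subsetD[OF t(2)]) (simp add: dist_norm)
    have "P x - P (x - t *\<^sub>R e) = 0" unfolding P_diff by (simp add: P_def ee)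
    then have "g (P x) \<le> (x - t *\<^sub>R e) \<bullet> e"
      unfolding g_def using cINF_lower[OF bdd xt, of "P x"] by simp
    then show "g (P x) < x \<bullet> e" using t(1) by (simp add: inner_diff_left ee)
  next
    assume "g (P x) < x \<bullet> e"
    then obtain x' where x': "x' \<in> S" "x' \<bullet> e + L * norm (P x - P x') < x \<bullet> e"
      unfolding g_def using cINF_less_iff[OF \<open>S \<noteq> {}\<close> bdd] by blast
    then show "x \<in> C"
      using x by (intro cone[of x' x]) (auto simp: S_def P_diff inner_diff_left)
  qed
  then have "C \<inter> ball x0 r = {x \<in> ball x0 r. g (x - (x \<bullet> e) *\<^sub>R e) < x \<bullet> e}"
    by (auto simp: P_def)
  with r(1) e(1) lip show "\<exists>r>0. \<exists>e g L. norm e = 1 \<and> L-lipschitz_on {z. z \<bullet> e = 0} g \<and>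
      C \<inter> ball x0 r = {x \<in> ball x0 r. g (x - (x \<bullet> e) *\<^sub>R e) < x \<bullet> e}"
    by blast
qed

subsection \<open>The image functional\<close>

lemma in_Lp_bounded:
  fixes f :: "real^'n \<Rightarrow> 'b::euclidean_space"
  assumes "open U" "bounded U" "f \<in> borel_measurable (lebesgue_on U)" "p > 0"
    and B: "\<And>x. x \<in> U \<Longrightarrow> norm (f x) \<le> B"
  shows "in_Lp p U f"
  unfolding in_Lp_def
proof
  have "U \<in> lmeasurable" using assms(1,2) by (intro bounded_set_imp_lmeasurable) auto
  then interpret finite_measure "lebesgue_on U" by (rule finite_measure_lebesgue_on)
  show "integrable (lebesgue_on U) (\<lambda>x. norm (f x) powr p)"
  proof (rule integrable_const_bound[of _ "B powr p"])
    show "AE x in lebesgue_on U. norm (norm (f x) powr p) \<le> B powr p"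
      using B \<open>p > 0\<close> by (intro AE_I2) (auto intro!: powr_mono2)
    show "(\<lambda>x. norm (f x) powr p) \<in> borel_measurable (lebesgue_on U)"
      using assms(3) by measurable
  qed
qed fact

lemma in_W1p_linear:
  fixes A :: "real^'n^'k"
  assumes "open U" "bounded U" "p > 0"
  shows "in_W1p p U (\<lambda>x. A *v x)"
  unfolding in_W1p_def
proof (intro conjI exI[of _ "\<lambda>x. A"])
  have cont: "continuous_on S (\<lambda>x. A *v x)" for S
    by (rule matrix_vector_mult_linear_continuous_on)
  obtain B where B: "\<And>x. x \<in> U \<Longrightarrow> norm x \<le> B" using assms(2) by (auto simp: bounded_iff)
  show "in_Lp p U (\<lambda>x. A *v x)"
  proof (rule in_Lp_bounded[OF assms(1,2) _ assms(3)])
    show "(\<lambda>x. A *v x) \<in> borel_measurable (lebesgue_on U)"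
      using assms(1) by (intro continuous_imp_measurable_on_sets_lebesgue cont) simp
    show "norm (A *v x) \<le> onorm ((*v) A) * B" if "x \<in> U" for x
      using onorm[OF matrix_vector_mul_bounded_linear, of A x] B[OF that]
        onorm_pos_le[OF matrix_vector_mul_bounded_linear, of A]
      by (meson mult_left_mono order_trans)
  qed
  show "has_weak_gradient U (\<lambda>x. A *v x) (\<lambda>x. A)"
    by (rule has_weak_gradient_affine[OF assms(1), of _ 0]) simp
  show "in_Lp p U (\<lambda>x. A)"
    by (rule in_Lp_bounded[OF assms(1,2) _ assms(3)]) auto
qed

lemma continuous_on_det: "continuous_on S (det :: real^'n^'n \<Rightarrow> real)"
  unfolding det_def by (intro continuous_intros)

text \<open>\<psi> is Borel only where the determinant is positive, whereas the chosen gradient may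
  leave that set at exceptional points. Since the set is open, extension by 0 is globally Borel and
  can be composed.\<close>

lemma measurable_extend_zero_det:
  fixes \<psi> :: "real^'m \<Rightarrow> real^'m \<Rightarrow> real^'n^'n \<Rightarrow> real"
  assumes "(\<lambda>(c, c', A). \<psi> c c' A) \<in> borel_measurable (restrict_space borel {(c, c', A). det A > 0})"
  shows "(\<lambda>(c, c', A). if det A > 0 then \<psi> c c' A else 0) \<in> borel_measurable borel"
proof -
  let ?S = "{(c, c', A). det A > 0} :: ((real^'m) \<times> (real^'m) \<times> (real^'n^'n)) set"
  have "open ?S"
    unfolding split_beta
    by (intro open_Collect_less continuous_intros continuous_on_compose2[OF continuous_on_det[of UNIV]]) auto
  then have "(\<lambda>x. indicator ?S x *\<^sub>R (\<lambda>(c, c', A). \<psi> c c' A) x) \<in> borel_measurable borel"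
    using assms by (subst (asm) borel_measurable_restrict_space_iff) auto
  also have "(\<lambda>x. indicator ?S x *\<^sub>R (\<lambda>(c, c', A). \<psi> c c' A) x) = (\<lambda>(c, c', A). if det A > 0 then \<psi> c c' A else 0)"
    by (auto simp: fun_eq_iff indicator_def)
  finally show ?thesis .
qed

lemma orientation_preserving_invertibleD:
  fixes U1 U2 :: "(real^'n) set"
  assumes "bounded_lipschitz_domain U1" "orientation_preserving_invertible p U1 U2 y"
    and p: "p > real CARD('n)"
  obtains z N where "homeomorphism U1 U2 y z" "negligible N"
    "has_weak_gradient U1 y (weak_gradient U1 y)"
    "\<And>x. x \<in> U1 - N \<Longrightarrow> (y has_derivative (\<lambda>h. weak_gradient U1 y x *v h)) (at x)"
    "\<And>x. x \<in> U1 - N \<Longrightarrow> det (weak_gradient U1 y x) > 0"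
proof -
  have U: "open U1" using assms(1) by (simp add: bounded_lipschitz_domain_def)
  obtain z where z: "homeomorphism U1 U2 y z" "in_W1p p U1 y"
    and det: "AE x in lebesgue_on U1. 0 < det (weak_gradient U1 y x)"
    using assms(2) by (auto simp: orientation_preserving_invertible_def)
  obtain N1 where N1: "negligible N1" "\<And>x. x \<in> U1 - N1 \<Longrightarrow> det (weak_gradient U1 y x) > 0"
    using det unfolding AE_lebesgue_on_iff_negligible[OF U] by blast
  have cont: "continuous_on U1 y" using z(1) by (simp add: homeomorphism_def)
  obtain N2 where N2: "negligible N2"
    "\<And>x. x \<in> U1 - N2 \<Longrightarrow> (y has_derivative (\<lambda>h. weak_gradient U1 y x *v h)) (at x)"
    using W1p_differentiable_ae[OF U cont z(2) p] by blast
  obtain G where G: "has_weak_gradient U1 y G" using z(2) by (auto simp: in_W1p_def)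
  show ?thesis
    by (rule that[OF z(1) negligible_Un[OF N1(1) N2(1)] weak_gradient_eq(1)[OF U G]])
      (use N1(2) N2(2) in auto)
qed

text \<open>A nonnegative integral vanishes exactly when the integrand does almost everywhere,
  provided the integrand is measurable. This is shown for \<open>h\<close>, which agrees with the
  integrand off the null set where the determinant condition fails.\<close>

lemma image_functional_eq_0_iff:
  fixes \<psi> :: "real^'m \<Rightarrow> real^'m \<Rightarrow> real^'n^'n \<Rightarrow> real" and p :: real
  assumes p: "p > real CARD('n)"
    and psi_nonneg: "\<And>c c' A. det A > 0 \<Longrightarrow> \<psi> c c' A \<ge> 0"
    and psi_borel: "(\<lambda>(c, c', A). \<psi> c c' A)
          \<in> borel_measurable (restrict_space borel {(c, c', A). det A > 0})"
    and img: "is_image (U1, c1)" "is_image (U2, c2)"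
    and y: "orientation_preserving_invertible p U1 U2 y"
  shows "image_functional \<psi> (U1, c1) (U2, c2) y = 0 \<longleftrightarrow>
    (AE x in lebesgue_on U1. \<psi> (c1 x) (c2 (y x)) (weak_gradient U1 y x) = 0)"
proof -
  let ?G = "weak_gradient U1 y"
  have U: "open U1" "open U2" "bounded_lipschitz_domain U1" using img by (auto simp: bounded_lipschitz_domain_def)
  have c: "c1 \<in> borel_measurable (lebesgue_on U1)" "c2 \<in> borel_measurable (lebesgue_on U2)"
    using img by auto
  obtain z N where z: "homeomorphism U1 U2 y z" and N: "negligible N"
    and wg: "has_weak_gradient U1 y ?G"
    and D: "\<And>x. x \<in> U1 - N \<Longrightarrow> (y has_derivative (\<lambda>h. ?G x *v h)) (at x)"
    and det: "\<And>x. x \<in> U1 - N \<Longrightarrow> det (?G x) > 0"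
    by (rule orientation_preserving_invertibleD[OF U(3) y p]) blast
  have c2y: "(\<lambda>x. c2 (y x)) \<in> borel_measurable (lebesgue_on U1)"
  proof (rule measurable_compose_homeomorphism[OF z U(1,2) N D _ c(2)])
    fix x assume "x \<in> U1 - N"
    then show "\<exists>c>0. \<forall>h. c * norm h \<le> norm (?G x *v h)"
      using det[of x] by (intro matrix_det_nz_bounded_below) simp
  qed
  have G: "?G \<in> borel_measurable (lebesgue_on U1)"
    using wg by (intro locally_integrable_imp_measurable[OF U(1)]) (simp add: has_weak_gradient_def)
  define h where "h x = (if det (?G x) > 0 then \<psi> (c1 x) (c2 (y x)) (?G x) else 0)" for x
  have "h \<in> borel_measurable (lebesgue_on U1)"
    using measurable_compose[OF borel_measurable_Pair[OF c(1) borel_measurable_Pair[OF c2y G]]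
        measurable_extend_zero_det[OF psi_borel]]
    by (simp add: h_def[abs_def])
  then have h_meas: "(\<lambda>x. ennreal (h x)) \<in> borel_measurable (lebesgue_on U1)" by measurable
  have eq: "AE x in lebesgue_on U1. \<psi> (c1 x) (c2 (y x)) (?G x) = h x"
    unfolding AE_lebesgue_on_iff_negligible[OF U(1)] using N det by (auto simp: h_def)
  have "image_functional \<psi> (U1, c1) (U2, c2) y = (\<integral>\<^sup>+x. ennreal (h x) \<partial>lebesgue_on U1)"
    unfolding image_functional.simps using eq by (intro nn_integral_cong_AE) auto
  also have "\<dots> = 0 \<longleftrightarrow> (AE x in lebesgue_on U1. ennreal (h x) = 0)"
    by (rule nn_integral_0_iff_AE[OF h_meas])
  also have "\<dots> \<longleftrightarrow> (AE x in lebesgue_on U1. \<psi> (c1 x) (c2 (y x)) (?G x) = 0)"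
  proof -
    have "h x \<ge> 0" for x by (simp add: h_def psi_nonneg)
    then have "ennreal (h x) = 0 \<longleftrightarrow> h x = 0" for x by (auto simp: ennreal_eq_0_iff intro: antisym)
    then show ?thesis using eq by (auto elim: AE_mp)
  qed
  finally show ?thesis .
qed

text \<open>\<open>y\<close> is a total function whose values outside \<open>U1\<close> carry no
  meaning, so being the rigid transformation is expressed as agreement on \<open>U1\<close> with
  some rigid \<open>E\<close>. In the converse direction, uniqueness of weak gradients identifies
  the gradient of \<open>y\<close> with the matrix of \<open>E\<close>.\<close>

lemma functional_zero_characterization:
  fixes \<psi> :: "real^'m \<Rightarrow> real^'m \<Rightarrow> real^'n^'n \<Rightarrow> real" and p :: real
  assumes p: "p > real CARD('n)"
    and psi_nonneg: "\<And>c c' A. det A > 0 \<Longrightarrow> \<psi> c c' A \<ge> 0"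
    and psi_borel: "(\<lambda>(c, c', A). \<psi> c c' A)
          \<in> borel_measurable (restrict_space borel {(c, c', A). det A > 0})"
    and B: "\<And>c c' A. det A > 0 \<Longrightarrow> \<psi> c c' A = 0 \<longleftrightarrow> c = c' \<and> rotation_matrix A"
    and img: "is_image (U1, c1)" "is_image (U2, c2)"
    and y: "orientation_preserving_invertible p U1 U2 y"
  shows "image_functional \<psi> (U1, c1) (U2, c2) y = 0 \<longleftrightarrow>
    (\<exists>E. image_equiv_via E (U1, c1) (U2, c2) \<and> (\<forall>x\<in>U1. y x = E x))"
proof -
  let ?G = "weak_gradient U1 y"
  have U: "open U1" "open U2" "connected U1" "U1 \<noteq> {}" "bounded U2" "bounded_lipschitz_domain U1"
    using img by (auto simp: bounded_lipschitz_domain_def)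
  obtain z N where z: "homeomorphism U1 U2 y z" and N: "negligible N"
    and wg: "has_weak_gradient U1 y ?G"
    and D: "\<And>x. x \<in> U1 - N \<Longrightarrow> (y has_derivative (\<lambda>h. ?G x *v h)) (at x)"
    and det: "\<And>x. x \<in> U1 - N \<Longrightarrow> det (?G x) > 0"
    by (rule orientation_preserving_invertibleD[OF U(6) y p]) blast
  have yU: "y ` U1 = U2" using z by (simp add: homeomorphism_def)
  have zero_iff: "image_functional \<psi> (U1, c1) (U2, c2) y = 0 \<longleftrightarrow>
      (AE x in lebesgue_on U1. \<psi> (c1 x) (c2 (y x)) (?G x) = 0)"
    by (rule image_functional_eq_0_iff[OF p _ psi_borel img y]) (rule psi_nonneg)
  show ?thesis
    unfolding zero_iff
  proof
    assume "AE x in lebesgue_on U1. \<psi> (c1 x) (c2 (y x)) (?G x) = 0"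
    then obtain M where M: "negligible M" "\<And>x. x \<in> U1 - M \<Longrightarrow> \<psi> (c1 x) (c2 (y x)) (?G x) = 0"
      unfolding AE_lebesgue_on_iff_negligible[OF U(1)] by blast
    have ae: "c1 x = c2 (y x)" "rotation_matrix (?G x)" if "x \<in> U1 - (M \<union> N)" for x
      using B[OF det[of x], of "c1 x" "c2 (y x)"] M(2)[of x] that by auto
    have MN: "negligible (M \<union> N)" using M(1) N by (rule negligible_Un)
    obtain E where E: "rigid_transformation E" "\<And>x. x \<in> U1 \<Longrightarrow> y x = E x"
      using weak_gradient_rotation_imp_rigid[OF z U(1-5) wg MN D ae(2)] by blast
    have "U2 = E ` U1" using yU E(2) by (metis image_cong)
    moreover have "AE x in lebesgue_on U1. c2 (E x) = c1 x"
      unfolding AE_lebesgue_on_iff_negligible[OF U(1)]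
    proof (intro exI[of _ "M \<union> N"] conjI ballI MN)
      fix x assume x: "x \<in> U1 - (M \<union> N)"
      then show "c2 (E x) = c1 x" using ae(1)[OF x] E(2)[of x] by simp
    qed
    ultimately show "\<exists>E. image_equiv_via E (U1, c1) (U2, c2) \<and> (\<forall>x\<in>U1. y x = E x)"
      using E by (intro exI[of _ E]) simp
  next
    assume "\<exists>E. image_equiv_via E (U1, c1) (U2, c2) \<and> (\<forall>x\<in>U1. y x = E x)"
    then obtain a R where R: "rotation_matrix R" "\<And>x. x \<in> U1 \<Longrightarrow> y x = a + R *v x"
      and c: "AE x in lebesgue_on U1. c2 (a + R *v x) = c1 x"
      by (auto simp: rigid_transformation_def)
    obtain M1 where M1: "negligible M1" "\<And>x. x \<in> U1 - M1 \<Longrightarrow> c2 (a + R *v x) = c1 x"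
      using c unfolding AE_lebesgue_on_iff_negligible[OF U(1)] by blast
    obtain M2 where M2: "negligible M2" "\<And>x. x \<in> U1 - M2 \<Longrightarrow> ?G x = R"
      using weak_gradient_eq(2)[OF U(1) has_weak_gradient_affine[OF U(1) R(2)]] by blast
    have "det R > 0" using R(1) by (simp add: rotation_matrix_def)
    show "AE x in lebesgue_on U1. \<psi> (c1 x) (c2 (y x)) (?G x) = 0"
      unfolding AE_lebesgue_on_iff_negligible[OF U(1)]
    proof (intro exI[of _ "M1 \<union> M2"] conjI ballI negligible_Un M1(1) M2(1))
      fix x assume x: "x \<in> U1 - (M1 \<union> M2)"
      then show "\<psi> (c1 x) (c2 (y x)) (?G x) = 0"
        using B[OF \<open>det R > 0\<close>, of "c1 x" "c1 x"] M1(2)[of x] M2(2)[of x] R by simp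
    qed
  qed
qed

lemma open_convex_imp_bounded_lipschitz_domain:
  fixes U :: "(real^'n) set"
  assumes "open U" "convex U" "bounded U" "U \<noteq> {}"
  shows "bounded_lipschitz_domain U"
  unfolding bounded_lipschitz_domain_def
  using assms convex_imp_lipschitz_boundary convex_connected by blast

text \<open>A linear isomorphism maps the ball to a bounded open convex set, so both domains are
  Lipschitz. With constant intensities the integrand is constant almost everywhere, and the
  functional vanishes exactly when this constant does, since the ball has positive volume.\<close>

lemma psi_zero_iff_of_characterization:
  fixes \<psi> :: "real^'m \<Rightarrow> real^'m \<Rightarrow> real^'n^'n \<Rightarrow> real" and p :: real
  assumes p: "p > real CARD('n)"
    and psi_nonneg: "\<And>c c' A. det A > 0 \<Longrightarrow> \<psi> c c' A \<ge> 0"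
    and A: "\<And>U1 c1 U2 c2 y. is_image (U1, c1) \<Longrightarrow> is_image (U2, c2) \<Longrightarrow>
            orientation_preserving_invertible p U1 U2 y \<Longrightarrow>
            image_functional \<psi> (U1, c1) (U2, c2) y = 0 \<longleftrightarrow>
             (\<exists>E. image_equiv_via E (U1, c1) (U2, c2) \<and> (\<forall>x\<in>U1. y x = E x))"
    and M: "det M > 0"
  shows "\<psi> c c' M = 0 \<longleftrightarrow> c = c' \<and> rotation_matrix M"
proof -
  have "p > 0" using p by (meson less_le_trans not_le of_nat_0_le_iff)
  define U where "U = ball (0 :: real^'n) 1"
  define f where "f x = M *v x" for x
  have "invertible M" using M by (simp add: invertible_det_nz)
  then obtain M' where M': "M ** M' = mat 1" "M' ** M = mat 1" by (auto simp: invertible_def)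
  define f' where "f' x = M' *v x" for x
  have inv: "f' (f x) = x" "f (f' x) = x" for x
    using M' by (simp_all add: f_def f'_def matrix_vector_mul_assoc)
  have lin: "linear f" "linear f'" by (simp_all add: f_def[abs_def] f'_def[abs_def])
  have U: "open U" "convex U" "bounded U" "U \<noteq> {}" by (auto simp: U_def)
  have bl: "bounded_linear f" "bounded_linear f'" using lin by (simp_all add: linear_conv_bounded_linear)
  have "surj f" using inv(2) by (rule surjI)
  then have fU: "open (f ` U)" "convex (f ` U)" "bounded (f ` U)" "f ` U \<noteq> {}"
    using open_surjective_linear_image[OF U(1) lin(1)] convex_linear_image[OF lin(1) U(2)]
      bounded_linear_image[OF U(3) bl(1)] U(4) by blast+
  have img: "is_image (U, \<lambda>x. c)" "is_image (f ` U, \<lambda>x. c')"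
    using open_convex_imp_bounded_lipschitz_domain U fU by auto
  have wgM: "has_weak_gradient U f (\<lambda>x. M)"
    by (rule has_weak_gradient_affine[OF U(1), of _ 0]) (simp add: f_def)
  obtain N where N: "negligible N" "\<And>x. x \<in> U - N \<Longrightarrow> weak_gradient U f x = M"
    using weak_gradient_eq(2)[OF U(1) wgM] by blast
  have ae: "AE x in lebesgue_on U. weak_gradient U f x = M"
    unfolding AE_lebesgue_on_iff_negligible[OF U(1)] using N by blast
  have opi: "orientation_preserving_invertible p U (f ` U) f"
    unfolding orientation_preserving_invertible_def
  proof (intro conjI exI[of _ f'])
    show "homeomorphism U (f ` U) f f'"
      using linear_continuous_on[OF bl(1)] linear_continuous_on[OF bl(2)] inv
      by (simp add: homeomorphism_def image_image)
    show "in_W1p p U f" "in_W1p p (f ` U) f'"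
      unfolding f_def[abs_def] f'_def[abs_def]
      using in_W1p_linear U(1,3) fU(1,3) \<open>p > 0\<close> unfolding f_def[abs_def] by blast+
    show "AE x in lebesgue_on U. 0 < det (weak_gradient U f x)"
      using ae by eventually_elim (simp add: M)
  qed
  have "image_functional \<psi> (U, \<lambda>x. c) (f ` U, \<lambda>x. c') f = (\<integral>\<^sup>+x. ennreal (\<psi> c c' M) \<partial>lebesgue_on U)"
    unfolding image_functional.simps using ae by (intro nn_integral_cong_AE) auto
  also have "\<dots> = ennreal (\<psi> c c' M) * emeasure lebesgue U"
    using U(1) by (simp add: emeasure_restrict_space space_restrict_space)
  finally have eq: "image_functional \<psi> (U, \<lambda>x. c) (f ` U, \<lambda>x. c') f = ennreal (\<psi> c c' M) * emeasure lebesgue U" .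
  then have "image_functional \<psi> (U, \<lambda>x. c) (f ` U, \<lambda>x. c') f = 0 \<longleftrightarrow> \<psi> c c' M = 0"
  proof -
    have "0 < unit_ball_vol (real CARD('n))" by (rule unit_ball_vol_pos) simp
    moreover have "emeasure lebesgue U = ennreal (unit_ball_vol (real CARD('n)))"
      by (simp add: U_def emeasure_ball)
    ultimately have "emeasure lebesgue U \<noteq> 0" by (simp only: ennreal_eq_0_iff not_le)
    then show ?thesis
      using eq psi_nonneg[OF M, of c c'] by (simp add: ennreal_eq_0_iff del: image_functional.simps)
  qed
  also have "image_functional \<psi> (U, \<lambda>x. c) (f ` U, \<lambda>x. c') f = 0 \<longleftrightarrow>
      (\<exists>E. image_equiv_via E (U, \<lambda>x. c) (f ` U, \<lambda>x. c') \<and> (\<forall>x\<in>U. f x = E x))"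
    by (rule A[OF img opi])
  finally have iff: "\<psi> c c' M = 0 \<longleftrightarrow>
      (\<exists>E. image_equiv_via E (U, \<lambda>x. c) (f ` U, \<lambda>x. c') \<and> (\<forall>x\<in>U. f x = E x))" by blast
  show ?thesis
    unfolding iff
  proof
    assume "\<exists>E. image_equiv_via E (U, \<lambda>x. c) (f ` U, \<lambda>x. c') \<and> (\<forall>x\<in>U. f x = E x)"
    then obtain a R where R: "rotation_matrix R" "\<And>x. x \<in> U \<Longrightarrow> M *v x = a + R *v x"
      and c: "AE x in lebesgue_on U. c' = c"
      by (auto simp: rigid_transformation_def f_def)
    obtain K where "negligible K" "\<forall>x\<in>U - K. c' = c"
      using c unfolding AE_lebesgue_on_iff_negligible[OF U(1)] by blast
    moreover have "\<not> U \<subseteq> K"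
      using \<open>negligible K\<close> open_not_negligible[OF U(1,4)] negligible_subset by blast
    ultimately have "c = c'" by blast
    \<comment> \<open>The ball is centred at the origin, so evaluating the affine identity at 0
      removes the translation.\<close>
    have "a = 0" using R(2)[of 0] by (simp add: U_def)
    have "M *v x = R *v x" for x
    proof -
      \<comment> \<open>Scales an arbitrary vector into the unit ball; the 1 in the denominator also
        covers \<open>x = 0\<close>.\<close>
      define t where "t = 1 / (norm x + 1)"
      have "t > 0" by (simp add: t_def add_nonneg_pos)
      have "norm x < norm x + 1" by simp
      then have "t *\<^sub>R x \<in> U" by (simp add: U_def t_def abs_of_nonneg divide_simps add_nonneg_pos)
      from R(2)[OF this] have "t *\<^sub>R (M *v x) = t *\<^sub>R (R *v x)"
        using \<open>a = 0\<close> by (simp add: matrix_vector_mult_scaleR)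
      then show ?thesis using \<open>t > 0\<close> by simp
    qed
    then have "M = R" by (simp add: matrix_eq)
    with R(1) \<open>c = c'\<close> show "c = c' \<and> rotation_matrix M" by simp
  next
    assume "c = c' \<and> rotation_matrix M"
    then show "\<exists>E. image_equiv_via E (U, \<lambda>x. c) (f ` U, \<lambda>x. c') \<and> (\<forall>x\<in>U. f x = E x)"
      by (intro exI[of _ f]) (auto simp: rigid_transformation_def f_def[abs_def] intro!: exI[of _ 0] exI[of _ M])
  qed
qed

theorem proposition2:
  fixes \<psi> :: "real^'m \<Rightarrow> real^'m \<Rightarrow> real^'n^'n \<Rightarrow> real" and p :: real
  assumes p: "p > real CARD('n)"
    and psi_nonneg: "\<And>c c' A. det A > 0 \<Longrightarrow> \<psi> c c' A \<ge> 0"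
    and psi_borel: "(\<lambda>(c, c', A). \<psi> c c' A)
          \<in> borel_measurable (restrict_space borel {(c, c', A). det A > 0})"
  shows "(\<forall>\<Omega>\<^sub>1 c\<^sub>1 \<Omega>\<^sub>2 c\<^sub>2 y.
            is_image (\<Omega>\<^sub>1, c\<^sub>1) \<and> is_image (\<Omega>\<^sub>2, c\<^sub>2) \<and>
            orientation_preserving_invertible p \<Omega>\<^sub>1 \<Omega>\<^sub>2 y \<longrightarrow>
            (image_functional \<psi> (\<Omega>\<^sub>1, c\<^sub>1) (\<Omega>\<^sub>2, c\<^sub>2) y = 0 \<longleftrightarrow>
             (\<exists>E. image_equiv_via E (\<Omega>\<^sub>1, c\<^sub>1) (\<Omega>\<^sub>2, c\<^sub>2) \<and> (\<forall>x\<in>\<Omega>\<^sub>1. y x = E x))))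
     \<longleftrightarrow>
         (\<forall>c c' A. det A > 0 \<longrightarrow>
            (\<psi> c c' A = 0 \<longleftrightarrow> c = c' \<and> rotation_matrix A))"
    (is "?A \<longleftrightarrow> ?B")
proof
  assume A: ?A
  show ?B
  proof (intro allI impI)
    fix c c' :: "real^'m" and M :: "real^'n^'n"
    assume M: "det M > 0"
    show "\<psi> c c' M = 0 \<longleftrightarrow> c = c' \<and> rotation_matrix M"
      by (rule psi_zero_iff_of_characterization[OF p psi_nonneg _ M]) (use A in blast)+
  qed
next
  assume B: ?B
  show ?A
  proof (intro allI impI, elim conjE)
    fix \<Omega>\<^sub>1 \<Omega>\<^sub>2 :: "(real^'n) set" and c\<^sub>1 c\<^sub>2 :: "real^'n \<Rightarrow> real^'m" and y
    assume *: "is_image (\<Omega>\<^sub>1, c\<^sub>1)" "is_image (\<Omega>\<^sub>2, c\<^sub>2)" "orientation_preserving_invertible p \<Omega>\<^sub>1 \<Omega>\<^sub>2 y"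
    show "image_functional \<psi> (\<Omega>\<^sub>1, c\<^sub>1) (\<Omega>\<^sub>2, c\<^sub>2) y = 0 \<longleftrightarrow>
        (\<exists>E. image_equiv_via E (\<Omega>\<^sub>1, c\<^sub>1) (\<Omega>\<^sub>2, c\<^sub>2) \<and> (\<forall>x\<in>\<Omega>\<^sub>1. y x = E x))"
      by (rule functional_zero_characterization[OF p psi_nonneg psi_borel _ *]) (use B in auto)
  qed
qed

end
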